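(* Let $a<b$ be real numbers, $0<\alpha<1$, and $y_a,y_b\in\mathbb{R}$. Let $J$ be a functional of the form $$J[y]=\int_a^b L\left(x,y,{_a^CD}^{\alpha}_x y\right)dx=\Gamma(\alpha)\,{_aJ}^{\alpha}_b\left[(b-x)^{1-\alpha}L\left(x,y,{_a^CD}^{\alpha}_x y\right)\right],$$ defined in the class of functions $y\in C^1([a,b])$ satisfying the boundary conditions $y(a)=y_a$ and $y(b)=y_b$, where $L\in C^1([a,b[\,\times\mathbb{R}^2)$ is differentiable with respect to all of its arguments. If $y$ is an extremizer of $J$ (in this class), then there is a constant $K$ such that $y$ satisfies the fractional Euler--Lagrange integral equation $${_xJ}^{\alpha}_b\,\frac{\partial L\left(x,y,{_a^CD}^{\alpha}_x y\right)}{\partial y}+\frac{\partial L\left(x,y,{_a^CD}^{\alpha}_x y\right)}{\partial({_a^CD}^{\alpha}_x y)}=\frac{K}{(b-x)^{1-\alpha}}$$ for all $x\in[a,b[$.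
   Context: For $\alpha>0$ and $h\in L_1([a,b])$, the left and right Riemann--Liouville fractional integrals are ${_aJ}^{\alpha}_x h(x):=\frac{1}{\Gamma(\alpha)}\int_a^x\frac{h(u)}{(x-u)^{1-\alpha}}\,du$ and ${_xJ}^{\alpha}_b h(x):=\frac{1}{\Gamma(\alpha)}\int_x^b\frac{h(u)}{(u-x)^{1-\alpha}}\,du$; ${_aJ}^{\alpha}_b h$ denotes the left integral evaluated at $x=b$. For $0<\alpha<1$, the left Caputo fractional derivative is ${_a^CD}^{\alpha}_x y(x):={_aJ}^{1-\alpha}_x y'(x)=\frac{1}{\Gamma(1-\alpha)}\int_a^x\frac{y'(u)}{(x-u)^{\alpha}}\,du$. In $L(x,y,{_a^CD}^{\alpha}_x y)$, the function $y$ and its Caputo derivative are evaluated at $x$; $\frac{\partial L}{\partial y}$ and $\frac{\partial L}{\partial({_a^CD}^{\alpha}_x y)}$ denote the partial derivatives of $L$ with respect to its second and third arguments, evaluated at $(x,y(x),{_a^CD}^{\alpha}_x y(x))$. An extremizer of $J$ is a function in the given class that minimizes or maximizes $J$ over that class.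
   Formalization: The formal theorem also assumes that ∂L/∂y along the extremizer y is in L_1([a,b]); without this the right Riemann–Liouville integral in the equation can diverge for an extremizer, so the equation is undefined. *)

theory Defs
  imports "HOL-Analysis.Analysis"
begin

definition RL_left :: "real \<Rightarrow> real \<Rightarrow> (real \<Rightarrow> real) \<Rightarrow> real \<Rightarrow> real" where
  "RL_left a \<alpha> h x = 1 / Gamma \<alpha> * (LINT u:{a..x}|lebesgue. h u / (x - u) powr (1 - \<alpha>))"

definition RL_right :: "real \<Rightarrow> real \<Rightarrow> (real \<Rightarrow> real) \<Rightarrow> real \<Rightarrow> real" where
  "RL_right b \<alpha> h x = 1 / Gamma \<alpha> * (LINT u:{x..b}|lebesgue. h u / (u - x) powr (1 - \<alpha>))"

text \<open>\<^term>\<open>deriv y\<close> is the two-sided derivative. For \<open>y\<close> that is \<open>C\<^sup>1\<close> on \<open>[a,b]\<close> it agrees with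
  the one-sided one except possibly at the end points, which the integral ignores.\<close>

definition caputo_left :: "real \<Rightarrow> real \<Rightarrow> (real \<Rightarrow> real) \<Rightarrow> real \<Rightarrow> real" where
  "caputo_left a \<alpha> y x = RL_left a (1 - \<alpha>) (deriv y) x"

text \<open>\<open>C\<^sup>1\<close> on a set that need not be open; at boundary points belonging to the set the derivative
  is the relative one. It is used for \<open>[a,b]\<close> and for \<open>[a,b[ \<times> \<real>\<^sup>2\<close>, where it is unique.\<close>

definition C1_on :: "'a::real_normed_vector set \<Rightarrow> ('a \<Rightarrow> 'b::real_normed_vector) \<Rightarrow> bool" where
  "C1_on S f \<longleftrightarrow> (\<exists>f' :: 'a \<Rightarrow> 'a \<Rightarrow>\<^sub>L 'b.
     (\<forall>p\<in>S. (f has_derivative blinfun_apply (f' p)) (at p within S)) \<and> continuous_on S f')"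

definition admissible :: "real \<Rightarrow> real \<Rightarrow> real \<Rightarrow> real \<Rightarrow> (real \<Rightarrow> real) set" where
  "admissible a b ya yb = {y. C1_on {a..b} y \<and> y a = ya \<and> y b = yb}"

definition along ::
    "real \<Rightarrow> real \<Rightarrow> (real \<times> real \<times> real \<Rightarrow> real) \<Rightarrow> (real \<Rightarrow> real) \<Rightarrow> real \<Rightarrow> real" where
  "along a \<alpha> F y x = F (x, y x, caputo_left a \<alpha> y x)"

text \<open>Partial derivatives with respect to the second and third argument.\<close>

definition partial_y :: "(real \<times> real \<times> real \<Rightarrow> real) \<Rightarrow> real \<times> real \<times> real \<Rightarrow> real" where
  "partial_y L = (\<lambda>(x, y, v). deriv (\<lambda>t. L (x, t, v)) y)"

definition partial_v :: "(real \<times> real \<times> real \<Rightarrow> real) \<Rightarrow> real \<times> real \<times> real \<Rightarrow> real" where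
  "partial_v L = (\<lambda>(x, y, v). deriv (\<lambda>t. L (x, y, t)) v)"

text \<open>The Lagrangian is only meaningful for \<open>x < b\<close>; its value at \<open>x = b\<close> does not affect the integral.\<close>

definition J_functional ::
    "real \<Rightarrow> real \<Rightarrow> real \<Rightarrow> (real \<times> real \<times> real \<Rightarrow> real) \<Rightarrow> (real \<Rightarrow> real) \<Rightarrow> real" where
  "J_functional a b \<alpha> L y = (LINT x:{a..b}|lebesgue. along a \<alpha> L y x)"

definition is_extremizer :: "('f \<Rightarrow> real) \<Rightarrow> 'f set \<Rightarrow> 'f \<Rightarrow> bool" where
  "is_extremizer J Y y \<longleftrightarrow> y \<in> Y \<and> ((\<forall>z\<in>Y. J y \<le> J z) \<or> (\<forall>z\<in>Y. J z \<le> J y))"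

text \<open>The functional in its fractional form.\<close>

lemma J_functional_eq_RL_left:
  assumes "0 < \<alpha>" and int: "set_integrable lebesgue {a..b} (along a \<alpha> L y)"
  shows "J_functional a b \<alpha> L y
           = Gamma \<alpha> * RL_left a \<alpha> (\<lambda>x. (b - x) powr (1 - \<alpha>) * along a \<alpha> L y x) b"
proof -
  let ?f = "along a \<alpha> L y"
  let ?g = "\<lambda>x. (b - x) powr (1 - \<alpha>) * ?f x / (b - x) powr (1 - \<alpha>)"
  have eq: "?g x = ?f x" if "x \<in> {a..b} - {b}" for x
    using that by simp
  have intg: "?g absolutely_integrable_on {a..b}"
    by (rule absolutely_integrable_spike[OF int, of "{b}"]) (use eq in auto)
  have "integral {a..b} ?g = integral {a..b} ?f"
    by (rule integral_spike[of "{b}"]) (use eq in auto)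
  then have "(LINT x:{a..b}|lebesgue. ?g x) = (LINT x:{a..b}|lebesgue. ?f x)"
    using set_lebesgue_integral_eq_integral(2)[OF intg] set_lebesgue_integral_eq_integral(2)[OF int]
    by simp
  moreover have "Gamma \<alpha> \<noteq> 0"
    using Gamma_real_pos[OF assms(1)] by simp
  ultimately show ?thesis
    by (simp add: J_functional_def RL_left_def)
qed

end

theory Submission
  imports Defs
begin

text \<open>
  The Lagrangian is only \<open>C\<^sup>1\<close> on \<open>[a,b[ \<times> \<real>\<^sup>2\<close>, and the Caputo derivative of a nonzero variation
  cannot vanish near \<open>b\<close> together with the variation. Hence every variation is felt near \<open>b\<close>, where
  \<open>J\<close> need not be differentiable in any direction, and one cannot differentiate under the integral.

  Two devices replace this. First, for a variation \<open>\<epsilon> \<eta>\<close> with \<open>\<eta> = 0\<close> near \<open>b\<close>, the small value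
  \<open>\<epsilon> D \<eta>\<close> of the third argument is realised near \<open>b\<close> only in the mean, by a rapid oscillation
  (chattering) between \<open>0\<close> and a fixed function \<open>D \<theta>\<close>, the latter with density of order \<open>\<epsilon>\<close>. Since
  \<open>y + \<theta>\<close> is admissible, this costs at most \<open>\<epsilon>\<close> times the tail of a convergent integral. Second,
  chattering has to stop before \<open>b\<close>. On the remaining tail Baire's theorem, applied to the set of
  parameters \<open>\<epsilon>\<close> for which the tail of \<open>J\<close> is small, yields an interval of good \<open>\<epsilon>\<close>, and averaging
  over this interval absorbs the small influence of the chattering on the tail.

  So the first variation, with its \<open>L\<^sub>v\<close> part cut off at \<open>c\<close>, is bounded by a quantity which tends to
  \<open>0\<close> as \<open>c\<close> tends to \<open>b\<close>. Testing with \<open>\<eta> = J\<^sup>\<alpha> w\<close>, where \<open>w\<close> has compact support in \<open>]a,b[\<close> and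
  \<open>\<eta>(b) = 0\<close>, Fubini's theorem and the lemma of du Bois-Reymond give the equation.
\<close>

section \<open>Riemann--Liouville integrals of continuous functions\<close>

text \<open>A chattering density must lie in \<open>[0,1]\<close>, so the basic estimate asks for
  \<open>1 \<le> D \<eta> / D \<theta> \<le> B\<close> beyond the cut; for a general
  \<open>\<eta>\<close> this is arranged by adding a multiple of \<open>\<theta>\<close>, and both
  signs are treated. For \<open>\<theta>\<close> a negative bump is taken: it vanishes well before
  \<open>b\<close>, but its Caputo derivative remembers the past and stays positive up to
  \<open>b\<close>, so one \<open>\<theta>\<close> serves all cuts near \<open>b\<close>. An
  oscillating third argument is affordable because \<open>J^\<alpha>\<close> smooths: a control with
  small primitive yields a uniformly small perturbation, and beyond the support of the control the
  derivative of the perturbation is small too, so it can be cut off there. The order of choices is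
  essential. The Baire interval of parameters and the point where chattering stops come from the
  unperturbed tail; only then is the chattering made so fine that its influence on the tail fits
  inside that interval. The constants must not deteriorate as the cut approaches \<open>b\<close>. A
  function vanishing at \<open>b\<close> is \<open>O(b - x)\<close>, so cutting it off over a length
  comparable with the distance to \<open>b\<close> keeps its derivative bounded.\<close>

lemma continuous_on_Icc_bounded:
  fixes h :: "real \<Rightarrow> real"
  assumes "continuous_on {a..b} h"
  obtains M where "\<And>u. u \<in> {a..b} \<Longrightarrow> \<bar>h u\<bar> \<le> M"
proof -
  have "bounded (h ` {a..b})"
    using assms by (intro compact_imp_bounded compact_continuous_image) auto
  then obtain M where "\<forall>z\<in>h ` {a..b}. norm z \<le> M"
    unfolding bounded_iff by blast
  then show ?thesis by (intro that[of M]) auto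
qed

section \<open>The weakly singular kernel and the left fractional integral\<close>

text \<open>The end point \<open>d = x\<close> is included: for \<open>\<beta> < 1\<close> the
  integrand is unbounded there, but the primitive is continuous because \<open>\<beta> > 0\<close>,
  and the interior form of the fundamental theorem asks for no more.\<close>

lemma kernel_has_integral:
  fixes \<beta> c d x :: real
  assumes "0 < \<beta>" "c \<le> d" "d \<le> x"
  shows "((\<lambda>u. (x - u) powr (\<beta> - 1)) has_integral ((x - c) powr \<beta> - (x - d) powr \<beta>) / \<beta>) {c..d}"
proof -
  have "((\<lambda>u. (x - u) powr (\<beta> - 1)) has_integral
          (- ((x - d) powr \<beta> / \<beta>) - - ((x - c) powr \<beta> / \<beta>))) {c..d}"
  proof (rule fundamental_theorem_of_calculus_interior[OF \<open>c \<le> d\<close>])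
    show "continuous_on {c..d} (\<lambda>u. - ((x - u) powr \<beta> / \<beta>))"
      using assms by (intro continuous_intros continuous_on_powr') auto
    fix u assume "u \<in> {c<..<d}"
    then show "((\<lambda>u. - ((x - u) powr \<beta> / \<beta>)) has_vector_derivative (x - u) powr (\<beta> - 1)) (at u)"
      using assms unfolding has_real_derivative_iff_has_vector_derivative[symmetric]
      by (auto intro!: derivative_eq_intros)
  qed
  then show ?thesis by (simp add: diff_divide_distrib)
qed

lemma kernel_absolutely_integrable:
  fixes \<beta> c d x :: real
  assumes "0 < \<beta>" "d \<le> x"
  shows "(\<lambda>u. (x - u) powr (\<beta> - 1)) absolutely_integrable_on {c..d}"
proof (cases "c \<le> d")
  case True
  then show ?thesis
    using kernel_has_integral[OF assms(1) True assms(2)]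
    by (intro nonnegative_absolutely_integrable_1) (auto intro: has_integral_integrable)
qed simp

lemma kernel_mult_absolutely_integrable:
  fixes \<beta> c d x :: real
  assumes "0 < \<beta>" "d \<le> x" "continuous_on {c..d} h"
  shows "(\<lambda>u. h u * (x - u) powr (\<beta> - 1)) absolutely_integrable_on {c..d}"
  using assms
  by (intro absolutely_integrable_bounded_measurable_product_real kernel_absolutely_integrable
        compact_imp_bounded compact_continuous_image continuous_imp_measurable_on_sets_lebesgue) auto

lemma kernel_mult_bound:
  fixes \<beta> c d x :: real
  assumes "0 < \<beta>" "c \<le> d" "d \<le> x" "continuous_on {c..d} h" "\<And>u. u \<in> {c<..<d} \<Longrightarrow> \<bar>h u\<bar> \<le> M"
  shows "\<bar>integral {c..d} (\<lambda>u. h u * (x - u) powr (\<beta> - 1))\<bar>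
           \<le> M * (((x - c) powr \<beta> - (x - d) powr \<beta>) / \<beta>)"
proof -
  have hi: "(\<lambda>u. h u * (x - u) powr (\<beta> - 1)) integrable_on {c..d}"
    using kernel_mult_absolutely_integrable[OF assms(1,3,4)] set_lebesgue_integral_eq_integral(1) by blast
  have "norm (integral {c<..<d} (\<lambda>u. h u * (x - u) powr (\<beta> - 1)))
          \<le> integral {c<..<d} (\<lambda>u. M * (x - u) powr (\<beta> - 1))"
  proof (rule integral_norm_bound_integral)
    show "(\<lambda>u. h u * (x - u) powr (\<beta> - 1)) integrable_on {c<..<d}"
      using hi by (simp add: integrable_on_Icc_iff_Ioo)
    show "(\<lambda>u. M * (x - u) powr (\<beta> - 1)) integrable_on {c<..<d}"
      using has_integral_integrable[OF has_integral_mult_right[OF kernel_has_integral[OF assms(1-3)], of M]]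
      by (simp add: integrable_on_Icc_iff_Ioo)
  qed (use assms(5) in \<open>auto simp: abs_mult intro!: mult_right_mono\<close>)
  then show ?thesis
    using integral_unique[OF kernel_has_integral[OF assms(1-3)]]
    by (simp add: integral_open_interval_real)
qed

lemma RL_left_eq_integral:
  assumes "0 < \<beta>" "continuous_on {a..x} h"
  shows "RL_left a \<beta> h x = integral {a..x} (\<lambda>u. h u * (x - u) powr (\<beta> - 1)) / Gamma \<beta>"
proof -
  have "(\<lambda>u. h u / (x - u) powr (1 - \<beta>)) = (\<lambda>u. h u * (x - u) powr (\<beta> - 1))"
    by (auto simp: powr_minus_divide[of _ "1 - \<beta>", simplified])
  then show ?thesis
    using set_lebesgue_integral_eq_integral(2)[OF kernel_mult_absolutely_integrable[OF assms(1) order_refl assms(2)]]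
    by (simp add: RL_left_def)
qed

text \<open>Integrability itself survives a change on a negligible set, and if it fails both
  integrals have the default value 0. The congruence rules for fractional integrals therefore apply
  to arbitrary functions.\<close>

lemma set_lebesgue_integral_spike:
  fixes f g :: "real \<Rightarrow> real"
  assumes "negligible N" "\<And>u. u \<in> S - N \<Longrightarrow> f u = g u"
  shows "(LINT u:S|lebesgue. f u) = (LINT u:S|lebesgue. g u)"
proof (cases "f absolutely_integrable_on S")
  case True
  moreover have "g absolutely_integrable_on S"
    by (rule absolutely_integrable_spike[OF True assms(1)]) (use assms(2) in auto)
  moreover have "integral S f = integral S g"
    by (rule integral_spike[OF assms(1)]) (use assms(2) in auto)
  ultimately show ?thesis by (simp add: set_lebesgue_integral_eq_integral(2))
next
  case False
  moreover have "\<not> g absolutely_integrable_on S"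
  proof
    assume "g absolutely_integrable_on S"
    then have "f absolutely_integrable_on S"
      by (rule absolutely_integrable_spike[OF _ assms(1)]) (use assms(2) in auto)
    with False show False by simp
  qed
  ultimately show ?thesis
    by (simp add: set_lebesgue_integral_def set_integrable_def not_integrable_integral_eq)
qed

text \<open>Meant for derivatives: \<open>deriv y\<close> is meaningful only inside
  \<open>]a,b[\<close>, since \<open>y\<close> is differentiable at the end points only from one
  side.\<close>

lemma RL_left_cong:
  assumes "\<And>u. a < u \<Longrightarrow> u < x \<Longrightarrow> h u = g u"
  shows "RL_left a \<beta> h x = RL_left a \<beta> g x"
  unfolding RL_left_def
  by (subst set_lebesgue_integral_spike[of "{a, x}"]) (use assms in auto)

lemma RL_right_cong:
  assumes "\<And>u. x < u \<Longrightarrow> u < b \<Longrightarrow> h u = g u"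
  shows "RL_right b \<beta> h x = RL_right b \<beta> g x"
  unfolding RL_right_def
  by (subst set_lebesgue_integral_spike[of "{x, b}"]) (use assms in auto)

lemma RL_right_uminus: "RL_right b \<beta> (\<lambda>u. - h u) x = - RL_right b \<beta> h x"
  by (simp add: RL_right_def set_lebesgue_integral_def)

lemma RL_left_cmult: "RL_left a \<beta> (\<lambda>u. k * h u) x = k * RL_left a \<beta> h x"
  by (simp add: RL_left_def mult.assoc[symmetric] times_divide_eq_right[symmetric]
      del: times_divide_eq_right)

lemma RL_left_add:
  assumes "0 < \<beta>" "continuous_on {a..x} h" "continuous_on {a..x} g"
  shows "RL_left a \<beta> (\<lambda>u. h u + g u) x = RL_left a \<beta> h x + RL_left a \<beta> g x"
proof -
  have "(\<lambda>u. h u * (x - u) powr (\<beta> - 1)) integrable_on {a..x}" "(\<lambda>u. g u * (x - u) powr (\<beta> - 1)) integrable_on {a..x}"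
    using kernel_mult_absolutely_integrable[OF assms(1) order_refl] assms set_lebesgue_integral_eq_integral(1) by blast+
  then show ?thesis
    using assms by (simp add: RL_left_eq_integral continuous_on_add integral_add[symmetric] ring_distribs add_divide_distrib[symmetric])
qed

lemma RL_left_bound:
  assumes "0 < \<beta>" "a \<le> x" "continuous_on {a..x} h" "\<And>u. u \<in> {a<..<x} \<Longrightarrow> \<bar>h u\<bar> \<le> M"
  shows "\<bar>RL_left a \<beta> h x\<bar> \<le> M * (x - a) powr \<beta> / (\<beta> * Gamma \<beta>)"
  using kernel_mult_bound[OF assms(1,2) order_refl assms(3,4)] Gamma_real_pos[OF assms(1)] assms
  by (simp add: RL_left_eq_integral divide_right_mono mult.commute flip: divide_divide_eq_left)

lemma RL_left_empty: "x < a \<Longrightarrow> RL_left a \<beta> h x = 0"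
  by (simp add: RL_left_def set_lebesgue_integral_def)

lemma RL_left_self: "RL_left a \<beta> h a = 0"
  using RL_left_cong[of a a h "\<lambda>_. 0" \<beta>] by (simp add: RL_left_def)

text \<open>The new piece \<open>[x,x']\<close> contributes at most
  \<open>M * (x' - x) powr \<beta> / \<beta>\<close>. On \<open>[a,x]\<close> the kernel decreases
  when \<open>x\<close> moves to \<open>x'\<close>, as \<open>\<beta> \<le> 1\<close>; the
  difference of kernels thus has a sign, its integral is explicit, and it is bounded by the same
  quantity.\<close>

lemma kernel_mult_Hoelder:
  fixes a x x' \<beta> :: real
  assumes "0 < \<beta>" "\<beta> \<le> 1" "a \<le> x" "x \<le> x'" "continuous_on {a..x'} h" "\<And>u. u \<in> {a..x'} \<Longrightarrow> \<bar>h u\<bar> \<le> M"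
  shows "\<bar>integral {a..x'} (\<lambda>u. h u * (x' - u) powr (\<beta> - 1))
          - integral {a..x} (\<lambda>u. h u * (x - u) powr (\<beta> - 1))\<bar> \<le> 2 * M * (x' - x) powr \<beta> / \<beta>"
proof -
  let ?k = "\<lambda>x u. (x - u) powr (\<beta> - 1)"
  have M: "0 \<le> M" using assms(6)[of x] assms(3,4) by auto
  have c1: "continuous_on {a..x} h" and c2: "continuous_on {x..x'} h"
    using assms by (auto intro: continuous_on_subset)
  have i1: "(\<lambda>u. h u * ?k x' u) integrable_on {a..x'}" "(\<lambda>u. h u * ?k x' u) integrable_on {a..x}"
    "(\<lambda>u. h u * ?k x u) integrable_on {a..x}"
    using assms c1 by (intro set_lebesgue_integral_eq_integral(1) kernel_mult_absolutely_integrable; simp)+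
  have k: "(?k x has_integral ((x - a) powr \<beta> - (x - x) powr \<beta>) / \<beta>) {a..x}"
    "(?k x' has_integral ((x' - a) powr \<beta> - (x' - x) powr \<beta>) / \<beta>) {a..x}"
    using assms by (intro kernel_has_integral; simp)+
  have km: "?k x' u \<le> ?k x u" if "u < x" for u
    using that assms by (intro powr_mono2') auto
  have "integral {a..x'} (\<lambda>u. h u * ?k x' u) = integral {a..x} (\<lambda>u. h u * ?k x' u) + integral {x..x'} (\<lambda>u. h u * ?k x' u)"
    using Henstock_Kurzweil_Integration.integral_combine[OF assms(3,4) i1(1)] by simp
  moreover have "\<bar>integral {x..x'} (\<lambda>u. h u * ?k x' u)\<bar> \<le> M * (((x' - x) powr \<beta> - (x' - x') powr \<beta>) / \<beta>)"
    using assms c2 by (intro kernel_mult_bound) auto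
  moreover have "\<bar>integral {a..x} (\<lambda>u. h u * ?k x' u) - integral {a..x} (\<lambda>u. h u * ?k x u)\<bar>
      \<le> M * (x' - x) powr \<beta> / \<beta>"
  proof -
    have "norm (integral {a<..<x} (\<lambda>u. h u * ?k x' u - h u * ?k x u)) \<le> integral {a<..<x} (\<lambda>u. M * (?k x u - ?k x' u))"
    proof (rule integral_norm_bound_integral)
      show "(\<lambda>u. h u * ?k x' u - h u * ?k x u) integrable_on {a<..<x}"
        using i1 by (simp add: integrable_on_Icc_iff_Ioo integrable_diff)
      show "(\<lambda>u. M * (?k x u - ?k x' u)) integrable_on {a<..<x}"
        using has_integral_integrable[OF has_integral_mult_right[OF has_integral_diff[OF k], of M]]
        by (simp add: integrable_on_Icc_iff_Ioo)
    next
      fix u assume u: "u \<in> {a<..<x}"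
      have "\<bar>h u * ?k x' u - h u * ?k x u\<bar> = \<bar>h u\<bar> * (?k x u - ?k x' u)"
        using km[of u] u by (simp add: abs_mult right_diff_distrib[symmetric])
      also have "\<dots> \<le> M * (?k x u - ?k x' u)"
        using assms(6)[of u] km[of u] u assms by (intro mult_right_mono) auto
      finally show "norm (h u * ?k x' u - h u * ?k x u) \<le> M * (?k x u - ?k x' u)" by simp
    qed
    also have "integral {a<..<x} (\<lambda>u. M * (?k x u - ?k x' u)) = integral {a..x} (\<lambda>u. M * (?k x u - ?k x' u))"
      by (rule integral_spike_set; rule negligible_subset[of "{a, x}"]) auto
    also have "\<dots> = M * (((x - a) powr \<beta> - (x - x) powr \<beta>) / \<beta> - ((x' - a) powr \<beta> - (x' - x) powr \<beta>) / \<beta>)"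
      using has_integral_mult_right[OF has_integral_diff[OF k], of M] by (intro integral_unique) simp
    also have "\<dots> \<le> M * ((x' - x) powr \<beta> / \<beta>)"
    proof (rule mult_left_mono[OF _ M])
      have "(x - a) powr \<beta> \<le> (x' - a) powr \<beta>" using assms by (intro powr_mono2) auto
      then show "((x - a) powr \<beta> - (x - x) powr \<beta>) / \<beta> - ((x' - a) powr \<beta> - (x' - x) powr \<beta>) / \<beta> \<le> (x' - x) powr \<beta> / \<beta>"
        using assms by (simp add: divide_right_mono diff_divide_distrib[symmetric])
    qed
    also have "integral {a<..<x} (\<lambda>u. h u * ?k x' u - h u * ?k x u) = integral {a..x} (\<lambda>u. h u * ?k x' u - h u * ?k x u)"
      by (rule integral_spike_set; rule negligible_subset[of "{a, x}"]) auto
    finally show ?thesis using i1 by (simp add: integral_diff)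
  qed
  ultimately show ?thesis by simp
qed

lemma continuous_on_RL_left:
  assumes "0 < \<beta>" "\<beta> \<le> 1" "continuous_on {a..b} h"
  shows "continuous_on {a..b} (RL_left a \<beta> h)"
proof -
  obtain M where M: "\<And>u. u \<in> {a..b} \<Longrightarrow> \<bar>h u\<bar> \<le> M"
    using continuous_on_Icc_bounded[OF assms(3)] by blast
  have H: "\<bar>RL_left a \<beta> h x' - RL_left a \<beta> h x\<bar> \<le> 2 * M / (\<beta> * Gamma \<beta>) * \<bar>x' - x\<bar> powr \<beta>"
    if "x \<in> {a..b}" "x' \<in> {a..b}" "x \<le> x'" for x x'
  proof -
    have "continuous_on {a..x} h" "continuous_on {a..x'} h"
      using that assms by (auto intro: continuous_on_subset)
    then have "\<bar>RL_left a \<beta> h x' - RL_left a \<beta> h x\<bar> \<le> 2 * M * (x' - x) powr \<beta> / \<beta> / Gamma \<beta>"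
      using kernel_mult_Hoelder[OF assms(1,2), of a x x' h M] that M assms Gamma_real_pos[OF assms(1)]
      by (simp add: RL_left_eq_integral divide_right_mono flip: diff_divide_distrib divide_divide_eq_left)
    then show ?thesis using that by simp
  qed
  show ?thesis unfolding continuous_on_def
  proof
    fix x assume x: "x \<in> {a..b}"
    have "((\<lambda>x'. 2 * M / (\<beta> * Gamma \<beta>) * \<bar>x' - x\<bar> powr \<beta>) \<longlongrightarrow> 2 * M / (\<beta> * Gamma \<beta>) * \<bar>x - x\<bar> powr \<beta>) (at x within {a..b})"
      using assms by (intro tendsto_intros tendsto_powr') auto
    then have "((\<lambda>x'. 2 * M / (\<beta> * Gamma \<beta>) * \<bar>x' - x\<bar> powr \<beta>) \<longlongrightarrow> 0) (at x within {a..b})"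
      by simp
    then have "((\<lambda>x'. RL_left a \<beta> h x' - RL_left a \<beta> h x) \<longlongrightarrow> 0) (at x within {a..b})"
    proof (rule Lim_null_comparison[rotated, where g = "\<lambda>x'. 2 * M / (\<beta> * Gamma \<beta>) * \<bar>x' - x\<bar> powr \<beta>"])
      show "\<forall>\<^sub>F x' in at x within {a..b}. norm (RL_left a \<beta> h x' - RL_left a \<beta> h x) \<le> 2 * M / (\<beta> * Gamma \<beta>) * \<bar>x' - x\<bar> powr \<beta>"
        unfolding eventually_at_filter
        by (rule always_eventually) (metis H x abs_minus_commute linear real_norm_def)
    qed
    then show "(RL_left a \<beta> h \<longlongrightarrow> RL_left a \<beta> h x) (at x within {a..b})"
      by (simp add: Lim_null[symmetric])
  qed
qed

section \<open>Fubini for the singular kernel and the composition of fractional integrals\<close>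

text \<open>\<open>A\<close> may be merely integrable up to \<open>X\<close>, as for
  \<open>L_y\<close> along \<open>y\<close>; all boundedness comes from \<open>B\<close>. The
  integral of \<open>|B|\<close> against the kernel is at most
  \<open>M * (X - a) powr \<beta> / \<beta>\<close> uniformly in \<open>u\<close>, so the double
  integral is dominated by a multiple of that of \<open>|A|\<close>.\<close>

lemma RL_Fubini:
  fixes a X \<beta> :: real
  assumes aX: "a < X" and \<beta>: "0 < \<beta>"
    and contA: "continuous_on {a..<X} A" and intA: "A absolutely_integrable_on {a..X}"
    and contB: "continuous_on {a..X} B"
  defines "R \<equiv> \<lambda>s. LINT u:{s..X}|lebesgue. A u * (u - s) powr (\<beta> - 1)"
  shows "(\<lambda>s. B s * R s) absolutely_integrable_on {a..X}"
    and "integral {a..X} (\<lambda>u. A u * integral {a..u} (\<lambda>s. B s * (u - s) powr (\<beta> - 1)))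
           = integral {a..X} (\<lambda>s. B s * R s)"
proof -
  \<comment> \<open>Borel representatives on the product: \<open>A\<close> is continuous only on the
    half-open interval, and the kernel is set to 0 on and above the diagonal. The results return to
    Lebesgue measure by completion.\<close>
  define A' where "A' u = indicator {a..<X} u *\<^sub>R A u" for u
  define B' where "B' s = indicator {a..X} s *\<^sub>R B s" for s
  define k where "k u s = (if s < u then (u - s) powr (\<beta> - 1) else 0)" for u s :: real
  define F where "F u s = A' u * (B' s * k u s)" for u s
  have [measurable]: "A' \<in> borel_measurable borel"
    unfolding A'_def using contA by (intro borel_measurable_continuous_on_indicator) auto
  have [measurable]: "B' \<in> borel_measurable borel"
    unfolding B'_def using contB by (intro borel_measurable_continuous_on_indicator) auto
  have [measurable]: "case_prod k \<in> borel_measurable (borel \<Otimes>\<^sub>M borel)"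
    unfolding k_def by measurable
  have Fm: "case_prod F \<in> borel_measurable (lborel \<Otimes>\<^sub>M lborel)"
    unfolding F_def by measurable
  obtain M where M: "\<And>u. u \<in> {a..X} \<Longrightarrow> \<bar>B u\<bar> \<le> M"
    using continuous_on_Icc_bounded[OF contB] by blast
  have M0: "0 \<le> M" using M[of a] aX by simp
  have Bk: "integrable lborel (\<lambda>s. B' s * k u s)"
      "(LINT s|lborel. B' s * k u s) = integral {a..u} (\<lambda>s. B s * (u - s) powr (\<beta> - 1))"
      "(LINT s|lborel. \<bar>B' s * k u s\<bar>) \<le> M * ((X - a) powr \<beta> / \<beta>)" if u: "u \<in> {a..<X}" for u
  proof -
    have c: "continuous_on {a..u} B" using contB u by (auto intro: continuous_on_subset)
    have e: "B' s * k u s = indicator {a..u} s *\<^sub>R (B s * (u - s) powr (\<beta> - 1))" for s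
      using u by (auto simp: B'_def k_def indicator_def)
    note ai = kernel_mult_absolutely_integrable[OF \<beta> order_refl c]
    have m: "(\<lambda>s. B' s * k u s) \<in> borel_measurable lborel" by measurable
    show i: "integrable lborel (\<lambda>s. B' s * k u s)"
      using ai integrable_completion[OF m] by (simp add: set_integrable_def e)
    show "(LINT s|lborel. B' s * k u s) = integral {a..u} (\<lambda>s. B s * (u - s) powr (\<beta> - 1))"
      using set_lebesgue_integral_eq_integral(2)[OF ai] integral_completion[OF m]
      by (simp add: set_lebesgue_integral_def e)
    have m2: "(\<lambda>s. \<bar>B' s * k u s\<bar>) \<in> borel_measurable lborel" by measurable
    have e2: "\<bar>B' s * k u s\<bar> = indicator {a..u} s *\<^sub>R (\<bar>B s\<bar> * (u - s) powr (\<beta> - 1))" for s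
      unfolding e by (simp add: abs_mult indicator_def)
    have c2: "continuous_on {a..u} (\<lambda>s. \<bar>B s\<bar>)" using c by (intro continuous_intros)
    have "(LINT s|lborel. \<bar>B' s * k u s\<bar>) = integral {a..u} (\<lambda>s. \<bar>B s\<bar> * (u - s) powr (\<beta> - 1))"
      using set_lebesgue_integral_eq_integral(2)[OF kernel_mult_absolutely_integrable[OF \<beta> order_refl c2]]
        integral_completion[OF m2]
      unfolding e2 by (simp add: set_lebesgue_integral_def)
    also have "\<dots> \<le> M * (((u - a) powr \<beta> - (u - u) powr \<beta>) / \<beta>)"
      using kernel_mult_bound[OF \<beta> _ order_refl c2, of M] u M by (auto simp: abs_le_iff)
    also have "\<dots> \<le> M * ((X - a) powr \<beta> / \<beta>)"
      using u \<beta> M0 by (intro mult_left_mono divide_right_mono) (auto intro!: powr_mono2)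
    finally show "(LINT s|lborel. \<bar>B' s * k u s\<bar>) \<le> M * ((X - a) powr \<beta> / \<beta>)" .
  qed
  have A'z: "A' u = 0" if "u \<notin> {a..<X}" for u using that by (simp add: A'_def)
  have "A absolutely_integrable_on {a..<X}"
    by (rule set_integrable_subset[OF intA]) auto
  then have "integrable lebesgue A'"
    by (simp only: A'_def[abs_def] set_integrable_def)
  then have iA': "integrable lborel A'"
    using integrable_completion[of A' lborel] by simp
  have iF: "integrable (lborel \<Otimes>\<^sub>M lborel) (case_prod F)"
  proof (rule lborel_pair.Fubini_integrable[OF Fm])
    show "integrable lborel (\<lambda>u. LINT s|lborel. norm (case (u, s) of (u, s) \<Rightarrow> F u s))"
    proof (rule Bochner_Integration.integrable_bound)
      show "integrable lborel (\<lambda>u. M * ((X - a) powr \<beta> / \<beta>) * A' u)" using iA' by simp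
      show "AE u in lborel. norm (LINT s|lborel. norm (case (u, s) of (u, s) \<Rightarrow> F u s))
              \<le> norm (M * ((X - a) powr \<beta> / \<beta>) * A' u)"
      proof (rule AE_I2)
        fix u
        show "norm (LINT s|lborel. norm (case (u, s) of (u, s) \<Rightarrow> F u s)) \<le> norm (M * ((X - a) powr \<beta> / \<beta>) * A' u)"
        proof (cases "u \<in> {a..<X}")
          case True
          have "norm (LINT s|lborel. norm (F u s)) = \<bar>A' u\<bar> * (LINT s|lborel. \<bar>B' s * k u s\<bar>)"
            by (simp add: F_def abs_mult)
          also have "\<dots> \<le> \<bar>A' u\<bar> * (M * ((X - a) powr \<beta> / \<beta>))"
            by (intro mult_left_mono Bk(3)[OF True]) auto
          finally show ?thesis using M0 \<beta> by (simp add: abs_mult mult_ac)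
        qed (simp add: F_def A'z)
      qed
    qed (unfold F_def, measurable)
    show "AE u in lborel. integrable lborel (\<lambda>s. case (u, s) of (u, s) \<Rightarrow> F u s)"
    proof (rule AE_I2)
      fix u show "integrable lborel (\<lambda>s. case (u, s) of (u, s) \<Rightarrow> F u s)"
        by (cases "u \<in> {a..<X}") (auto simp: F_def A'z Bk(1))
    qed
  qed
  \<comment> \<open>This holds for every \<open>s\<close>, not only almost every one: both sides are
    Bochner integrals of almost everywhere equal functions, hence equal even where the integrand is
    not integrable.\<close>
  have inner: "(LINT u|lborel. F u s) = indicator {a..X} s *\<^sub>R (B s * R s)" for s
  proof (cases "s \<in> {a..X}")
    case True
    have e: "A' u * k u s = indicator {s..X} u *\<^sub>R (A u * (u - s) powr (\<beta> - 1))" if "u \<noteq> X" for u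
      using that True by (auto simp: A'_def k_def indicator_def)
    have m: "(\<lambda>u. A' u * k u s) \<in> borel_measurable lborel" by measurable
    have "(LINT u|lborel. F u s) = B s * (LINT u|lborel. A' u * k u s)"
      using True by (simp add: F_def B'_def mult.left_commute[of _ "B s"])
    also have "(LINT u|lborel. A' u * k u s) = (LINT u|lebesgue. A' u * k u s)"
      using integral_completion[OF m] by simp
    also have "\<dots> = R s" unfolding R_def set_lebesgue_integral_def
    proof (rule integral_cong_AE)
      have ae: "AE u in lebesgue. A' u * k u s = indicator {s..X} u *\<^sub>R (A u * (u - s) powr (\<beta> - 1))"
      proof (rule AE_I')
        show "{X} \<in> null_sets lebesgue"
          by (intro null_sets_completionI finite_imp_null_set_lborel) auto
      qed (use e in auto)
      show m1: "(\<lambda>u. A' u * k u s) \<in> borel_measurable lebesgue"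
        using m by (rule measurable_completion)
      show "(\<lambda>u. indicator {s..X} u *\<^sub>R (A u * (u - s) powr (\<beta> - 1))) \<in> borel_measurable lebesgue"
        using borel_measurable_AE[OF m1 ae] .
      show "AE u in lebesgue. A' u * k u s = indicator {s..X} u *\<^sub>R (A u * (u - s) powr (\<beta> - 1))"
        by (fact ae)
    qed
    finally show ?thesis using True by simp
  qed (simp add: F_def B'_def)
  have "integrable lborel (\<lambda>s. LINT u|lborel. F u s)"
    using lborel_pair.integrable_snd[OF iF] by simp
  then have "integrable lborel (\<lambda>s. indicator {a..X} s *\<^sub>R (B s * R s))"
    unfolding inner .
  then show ai: "(\<lambda>s. B s * R s) absolutely_integrable_on {a..X}"
    unfolding set_integrable_def using integrable_completion borel_measurable_integrable by blast
  have "(LINT s|lborel. LINT u|lborel. F u s) = integral {a..X} (\<lambda>s. B s * R s)"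
    unfolding inner using set_lebesgue_integral_eq_integral(2)[OF ai]
      integral_completion[OF borel_measurable_integrable, of lborel "\<lambda>s. indicator {a..X} s *\<^sub>R (B s * R s)"]
      \<open>integrable lborel (\<lambda>s. indicator {a..X} s *\<^sub>R (B s * R s))\<close>
    by (simp add: set_lebesgue_integral_def)
  moreover have "(LINT u|lborel. LINT s|lborel. F u s)
      = integral {a..X} (\<lambda>u. A u * integral {a..u} (\<lambda>s. B s * (u - s) powr (\<beta> - 1)))"
  proof -
    define I where "I u = (LINT s|lborel. F u s)" for u
    have Ii: "integrable lborel I"
      unfolding I_def using lborel_pair.integrable_fst[OF iF] by simp
    have Iz: "I u = 0" if "u \<notin> {a..<X}" for u using that by (simp add: I_def F_def A'z)
    have "(\<lambda>u. indicator {a..X} u *\<^sub>R I u) = I"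
    proof
      fix u show "indicator {a..X} u *\<^sub>R I u = I u"
        using Iz[of u] by (cases "u \<in> {a..<X}") auto
    qed
    then have Ia: "I absolutely_integrable_on {a..X}"
      unfolding set_integrable_def using Ii integrable_completion borel_measurable_integrable by metis
    have "(LINT u|lborel. I u) = (LINT u:{a..X}|lebesgue. I u)"
      unfolding set_lebesgue_integral_def \<open>(\<lambda>u. indicator {a..X} u *\<^sub>R I u) = I\<close>
      using integral_completion[OF borel_measurable_integrable[OF Ii]] by simp
    also have "\<dots> = integral {a..X} I" using set_lebesgue_integral_eq_integral(2)[OF Ia] .
    also have "\<dots> = integral {a..X} (\<lambda>u. A u * integral {a..u} (\<lambda>s. B s * (u - s) powr (\<beta> - 1)))"
    proof (rule integral_spike[of "{X}"])
      fix u assume "u \<in> {a..X} - {X}"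
      then show "A u * integral {a..u} (\<lambda>s. B s * (u - s) powr (\<beta> - 1)) = I u"
        using Bk(2)[of u] by (simp add: I_def F_def A'_def)
    qed simp
    finally show ?thesis by (simp add: I_def)
  qed
  ultimately show "integral {a..X} (\<lambda>u. A u * integral {a..u} (\<lambda>s. B s * (u - s) powr (\<beta> - 1)))
           = integral {a..X} (\<lambda>s. B s * R s)"
    using lborel_pair.Fubini_integral[OF iF] by simp
qed

text \<open>The affine substitution \<open>(u - s) / (X - s)\<close> in Euler's Beta
  integral.\<close>

lemma Beta_kernel_integral:
  fixes s X p q :: real
  assumes "s < X" "0 < p" "0 < q"
  shows "((\<lambda>u. (X - u) powr (q - 1) * (u - s) powr (p - 1)) has_integral (X - s) powr (p + q - 1) * Beta p q) {s..X}"
proof -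
  have "((\<lambda>u. (1 / (X - s) * u + - s / (X - s)) powr (p - 1) * (1 - (1 / (X - s) * u + - s / (X - s))) powr (q - 1))
      has_integral (1 / \<bar>1 / (X - s)\<bar>) *\<^sub>R Beta p q)
      ((\<lambda>x. (1 / (1 / (X - s))) *\<^sub>R x + - ((1 / (1 / (X - s))) *\<^sub>R (- s / (X - s)))) ` cbox 0 1)"
    using has_integral_affinity[where m = "1 / (X - s)" and c = "- s / (X - s)",
        OF has_integral_Beta_real[OF assms(2,3), folded cbox_interval]] assms by simp
  moreover have "(\<lambda>x. (1 / (1 / (X - s))) *\<^sub>R x + - ((1 / (1 / (X - s))) *\<^sub>R (- s / (X - s)))) ` cbox 0 1 = {s..X}"
    using assms by (simp add: image_affinity_atLeastAtMost)
  ultimately have "((\<lambda>u. (1 / (X - s) * u + - s / (X - s)) powr (p - 1) * (1 - (1 / (X - s) * u + - s / (X - s))) powr (q - 1))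
      has_integral (X - s) * Beta p q) {s..X}"
    using assms by simp
  then have h: "((\<lambda>u. (X - s) powr (p + q - 2) * ((1 / (X - s) * u + - s / (X - s)) powr (p - 1) * (1 - (1 / (X - s) * u + - s / (X - s))) powr (q - 1)))
      has_integral (X - s) powr (p + q - 2) * ((X - s) * Beta p q)) {s..X}"
    by (rule has_integral_mult_right)
  have c: "(X - s) powr (p + q - 2) * ((X - s) * Beta p q) = (X - s) powr (p + q - 1) * Beta p q"
  proof -
    have "(X - s) * (X - s) powr (p + q - 2) = (X - s) powr (1 + (p + q - 2))"
      using assms by (intro powr_mult_base) auto
    then show ?thesis by (simp add: mult.assoc[symmetric] mult.commute[of _ "X - s"])
  qed
  have e: "(X - s) powr (p + q - 2) * ((1 / (X - s) * u + - s / (X - s)) powr (p - 1) * (1 - (1 / (X - s) * u + - s / (X - s))) powr (q - 1))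
      = (X - u) powr (q - 1) * (u - s) powr (p - 1)" if "u \<in> {s..X}" for u
  proof -
    have *: "1 / (X - s) * u + - s / (X - s) = (u - s) / (X - s)"
      using assms by (simp add: diff_divide_distrib)
    moreover have "1 - (1 / (X - s) * u + - s / (X - s)) = (X - u) / (X - s)"
    proof -
      have "1 - (u - s) / (X - s) = (X - s) / (X - s) - (u - s) / (X - s)"
        using assms by simp
      then show ?thesis unfolding * by (simp only: diff_divide_distrib[symmetric]) simp
    qed
    moreover have "(X - s) powr (p + q - 2) = (X - s) powr (p - 1) * (X - s) powr (q - 1)"
      by (simp add: powr_add[symmetric])
    ultimately show ?thesis using assms that by (simp add: powr_divide)
  qed
  show ?thesis using has_integral_eq[OF e h] unfolding c .
qed

text \<open>The semigroup law for exponents that add up to 1. After Fubini the inner integral is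
  \<open>Beta \<alpha> (1 - \<alpha>)\<close>, which does not depend on \<open>s\<close> and cancels
  both Gamma factors because \<open>Gamma 1 = 1\<close>.\<close>

lemma RL_left_RL_left:
  assumes "0 < \<alpha>" "\<alpha> < 1" "a < x" "continuous_on {a..x} g"
  shows "RL_left a (1 - \<alpha>) (RL_left a \<alpha> g) x = integral {a..x} g"
proof -
  let ?A = "\<lambda>u. (x - u) powr (- \<alpha>)"
  let ?R = "\<lambda>s. LINT u:{s..x}|lebesgue. ?A u * (u - s) powr (\<alpha> - 1)"
  have pos: "Gamma \<alpha> > 0" "Gamma (1 - \<alpha>) > 0" using assms by (auto intro: Gamma_real_pos)
  have c: "continuous_on {a..u} g" if "u \<le> x" for u
    using assms(4) that by (auto intro: continuous_on_subset)
  have "RL_left a (1 - \<alpha>) (RL_left a \<alpha> g) x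
      = integral {a..x} (\<lambda>u. RL_left a \<alpha> g u * ?A u) / Gamma (1 - \<alpha>)"
    using assms continuous_on_RL_left[of \<alpha> a x g] by (subst RL_left_eq_integral) auto
  also have "integral {a..x} (\<lambda>u. RL_left a \<alpha> g u * ?A u)
      = integral {a..x} (\<lambda>u. 1 / Gamma \<alpha> * (?A u * integral {a..u} (\<lambda>s. g s * (u - s) powr (\<alpha> - 1))))"
    using assms c by (intro integral_cong) (simp add: RL_left_eq_integral)
  also have "\<dots> = integral {a..x} (\<lambda>u. ?A u * integral {a..u} (\<lambda>s. g s * (u - s) powr (\<alpha> - 1))) / Gamma \<alpha>"
    by simp
  also have "integral {a..x} (\<lambda>u. ?A u * integral {a..u} (\<lambda>s. g s * (u - s) powr (\<alpha> - 1)))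
      = integral {a..x} (\<lambda>s. g s * ?R s)"
  proof (rule RL_Fubini(2))
    show "continuous_on {a..<x} ?A" by (intro continuous_intros) auto
    show "?A absolutely_integrable_on {a..x}"
      using kernel_absolutely_integrable[of "1 - \<alpha>" x x a] assms by simp
  qed (use assms in auto)
  also have "\<dots> = integral {a..x} (\<lambda>s. Gamma \<alpha> * Gamma (1 - \<alpha>) * g s)"
  proof (rule integral_spike[of "{x}"])
    fix s assume s: "s \<in> {a..x} - {x}"
    have h: "((\<lambda>u. ?A u * (u - s) powr (\<alpha> - 1)) has_integral Beta \<alpha> (1 - \<alpha>)) {s..x}"
      using Beta_kernel_integral[of s x \<alpha> "1 - \<alpha>"] s assms by simp
    then have "?R s = Beta \<alpha> (1 - \<alpha>)"
      using set_lebesgue_integral_eq_integral(2)[OF nonnegative_absolutely_integrable_1[OF has_integral_integrable[OF h]]]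
        integral_unique[OF h] by simp
    then show "Gamma \<alpha> * Gamma (1 - \<alpha>) * g s = g s * ?R s"
      by (simp add: Beta_def)
  qed simp
  also have "\<dots> = Gamma \<alpha> * Gamma (1 - \<alpha>) * integral {a..x} g" by simp
  finally show ?thesis using pos by simp
qed

section \<open>Continuously differentiable functions that vanish up to \<open>a\<close>\<close>

text \<open>The space of variations. Living on the whole line and vanishing up to \<open>a\<close>,
  these functions have two-sided derivatives everywhere, so \<open>deriv\<close> is correct at
  \<open>a\<close> too and equals 0 there. The class is stable under
  \<open>RL_left a \<alpha>\<close>, whose value for \<open>x < a\<close> is an integral over the
  empty set.\<close>

definition C1_from :: "real \<Rightarrow> (real \<Rightarrow> real) \<Rightarrow> bool" where
  "C1_from a f \<longleftrightarrow> (\<forall>x. (f has_real_derivative deriv f x) (at x)) \<and> continuous_on UNIV (deriv f) \<and> (\<forall>x\<le>a. f x = 0)"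

lemma C1_fromI:
  assumes "\<And>x. (f has_real_derivative f' x) (at x)" "continuous_on UNIV f'" "\<And>x. x \<le> a \<Longrightarrow> f x = 0"
  shows "C1_from a f" and "deriv f = f'"
proof -
  show "deriv f = f'" using DERIV_imp_deriv[OF assms(1)] by auto
  then show "C1_from a f" using assms by (auto simp: C1_from_def)
qed

lemma C1_fromD:
  assumes "C1_from a f"
  shows "(f has_real_derivative deriv f x) (at x)" "continuous_on S (deriv f)" "x \<le> a \<Longrightarrow> f x = 0"
    "continuous_on S f"
proof -
  show d: "(f has_real_derivative deriv f x) (at x)" for x
    using assms by (auto simp: C1_from_def)
  show "continuous_on S (deriv f)" "x \<le> a \<Longrightarrow> f x = 0"
    using assms by (auto simp: C1_from_def intro: continuous_on_subset)
  show "continuous_on S f"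
    using d by (auto intro!: continuous_at_imp_continuous_on DERIV_isCont)
qed

lemma C1_from_deriv_zero_right:
  assumes "C1_from a f" "\<And>x. x \<ge> c \<Longrightarrow> f x = 0" "x > c" shows "deriv f x = 0"
proof -
  have "(f has_real_derivative 0) (at x)"
    by (rule has_field_derivative_transform_within_open[of "\<lambda>x. 0" _ _ "{c<..}"])
       (use assms in auto)
  then show "deriv f x = 0" by (rule DERIV_imp_deriv)
qed

lemma C1_from_add:
  assumes "C1_from a f" "C1_from a g"
  shows "C1_from a (\<lambda>x. f x + g x)" "deriv (\<lambda>x. f x + g x) = (\<lambda>x. deriv f x + deriv g x)"
proof -
  have d: "((\<lambda>x. f x + g x) has_real_derivative deriv f x + deriv g x) (at x)" for x
    using assms by (intro DERIV_add C1_fromD(1))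
  have c: "continuous_on UNIV (\<lambda>x. deriv f x + deriv g x)"
    using assms by (intro continuous_on_add C1_fromD(2))
  have z: "f x + g x = 0" if "x \<le> a" for x
    using that C1_fromD(3)[OF assms(1)] C1_fromD(3)[OF assms(2)] by simp
  show "C1_from a (\<lambda>x. f x + g x)" by (rule C1_fromI(1)[OF d c]) (rule z)
  show "deriv (\<lambda>x. f x + g x) = (\<lambda>x. deriv f x + deriv g x)" by (rule C1_fromI(2)[OF d c]) (rule z)
qed

lemma C1_from_mult:
  assumes "C1_from a f" "\<And>x. (g has_real_derivative g' x) (at x)" "continuous_on UNIV g'"
  shows "C1_from a (\<lambda>x. g x * f x)" "deriv (\<lambda>x. g x * f x) = (\<lambda>x. g' x * f x + g x * deriv f x)"
proof -
  have "continuous_on UNIV g" using assms(2) by (auto intro!: continuous_at_imp_continuous_on DERIV_isCont)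
  then have c: "continuous_on UNIV (\<lambda>x. g' x * f x + g x * deriv f x)"
    using assms by (intro continuous_on_add continuous_on_mult C1_fromD(2,4)[OF assms(1)])
  have d: "((\<lambda>x. g x * f x) has_real_derivative g' x * f x + g x * deriv f x) (at x)" for x
    using DERIV_mult[OF assms(2) C1_fromD(1)[OF assms(1)]] by (simp add: mult.commute)
  have z: "g x * f x = 0" if "x \<le> a" for x
    using that C1_fromD(3)[OF assms(1)] by simp
  show "C1_from a (\<lambda>x. g x * f x)" by (rule C1_fromI(1)[OF d c]) (rule z)
  show "deriv (\<lambda>x. g x * f x) = (\<lambda>x. g' x * f x + g x * deriv f x)" by (rule C1_fromI(2)[OF d c]) (rule z)
qed

lemma C1_from_cmult:
  assumes "C1_from a f"
  shows "C1_from a (\<lambda>x. k * f x)" "deriv (\<lambda>x. k * f x) = (\<lambda>x. k * deriv f x)"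
  using C1_from_mult[OF assms, where g = "\<lambda>_. k" and g' = "\<lambda>_. 0"] by simp_all

lemma C1_from_antimono: "C1_from a f \<Longrightarrow> a' \<le> a \<Longrightarrow> C1_from a' f"
  by (auto simp: C1_from_def)

lemma continuous_on_UNIV_from:
  fixes g :: "real \<Rightarrow> real"
  assumes "\<And>b. continuous_on {a..b} g" "\<And>x. x \<le> a \<Longrightarrow> g x = 0"
  shows "continuous_on UNIV g"
proof -
  have "isCont g x" for x
  proof -
    have "continuous_on ({x - \<bar>a\<bar> - 1..a} \<union> {a..\<bar>x\<bar> + \<bar>a\<bar> + 1}) g"
    proof (rule continuous_on_closed_Un)
      show "continuous_on {x - \<bar>a\<bar> - 1..a} g"
        using assms(2) continuous_on_cong[of "{x - \<bar>a\<bar> - 1..a}" "{x - \<bar>a\<bar> - 1..a}" g "\<lambda>_. 0"] by simp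
    qed (use assms in auto)
    then have "continuous_on {x - 1<..<x + 1} g"
      by (rule continuous_on_subset) auto
    then show ?thesis by (subst (asm) continuous_on_eq_continuous_at) auto
  qed
  then show ?thesis by (auto intro: continuous_at_imp_continuous_on)
qed

lemma C1_from_integral:
  fixes g :: "real \<Rightarrow> real"
  assumes "continuous_on UNIV g" "\<And>x. x \<le> a \<Longrightarrow> g x = 0"
  shows "C1_from a (\<lambda>x. integral {a..x} g)" "deriv (\<lambda>x. integral {a..x} g) = g"
proof -
  have d: "((\<lambda>x. integral {a..x} g) has_real_derivative g x) (at x)" for x
  proof -
    \<comment> \<open>A starting point strictly to the left of \<open>a\<close> and \<open>x\<close>
      makes \<open>x\<close> interior to the interval of integration; it changes nothing because
      \<open>g\<close> vanishes up to \<open>a\<close>.\<close>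
    define lo where "lo = min a x - 1"
    have c: "continuous_on S g" for S using assms(1) by (rule continuous_on_subset) auto
    have z: "integral {p..q} g = 0" if "q \<le> a" for p q
      using integral_cong[of "{p..q}" g "\<lambda>_. 0"] assms(2) that by simp
    have eq: "integral {lo..t} g = integral {a..t} g" if "t > lo" for t
    proof (cases "a \<le> t")
      case True
      then have "integral {lo..a} g + integral {a..t} g = integral {lo..t} g"
        using c by (intro Henstock_Kurzweil_Integration.integral_combine integrable_continuous_real) (auto simp: lo_def)
      then show ?thesis using z[of a lo] by simp
    next
      case False
      then show ?thesis using z[of t lo] by simp
    qed
    have "((\<lambda>x. integral {lo..x} g) has_real_derivative g x) (at x within {lo..x + 1})"
      using c by (intro integral_has_real_derivative) (auto simp: lo_def)
    then have "((\<lambda>x. integral {lo..x} g) has_real_derivative g x) (at x)"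
      by (subst (asm) at_within_interior) (auto simp: lo_def interior_atLeastAtMost_real)
    then show ?thesis
      by (rule has_field_derivative_transform_within_open[of _ _ _ "{lo<..}"]) (use eq in \<open>auto simp: lo_def\<close>)
  qed
  have z: "integral {a..x} g = 0" if "x \<le> a" for x using that by (cases "x = a") auto
  show "C1_from a (\<lambda>x. integral {a..x} g)" by (rule C1_fromI(1)[OF d assms(1)]) (rule z)
  show "deriv (\<lambda>x. integral {a..x} g) = g" by (rule C1_fromI(2)[OF d assms(1)]) (rule z)
qed

lemma C1_from_integral_deriv:
  assumes "C1_from a f" "a \<le> x"
  shows "integral {a..x} (deriv f) = f x"
proof -
  have "(deriv f has_integral f x - f a) {a..x}"
    using assms by (intro fundamental_theorem_of_calculus)
      (auto simp: has_real_derivative_iff_has_vector_derivative[symmetric] intro: DERIV_subset C1_fromD)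
  then show ?thesis using C1_fromD(3)[OF assms(1), of a] by (simp add: integral_unique)
qed

lemma right_kernel_has_integral:
  fixes \<beta> c d x :: real
  assumes "0 < \<beta>" "x \<le> c" "c \<le> d"
  shows "((\<lambda>u. (u - x) powr (\<beta> - 1)) has_integral ((d - x) powr \<beta> - (c - x) powr \<beta>) / \<beta>) {c..d}"
proof -
  have "((\<lambda>u. (u - x) powr (\<beta> - 1)) has_integral ((d - x) powr \<beta> / \<beta> - (c - x) powr \<beta> / \<beta>)) {c..d}"
  proof (rule fundamental_theorem_of_calculus_interior[OF \<open>c \<le> d\<close>])
    show "continuous_on {c..d} (\<lambda>u. (u - x) powr \<beta> / \<beta>)"
      using assms by (intro continuous_intros continuous_on_powr') auto
    fix u assume "u \<in> {c<..<d}"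
    then show "((\<lambda>u. (u - x) powr \<beta> / \<beta>) has_vector_derivative (u - x) powr (\<beta> - 1)) (at u)"
      using assms unfolding has_real_derivative_iff_has_vector_derivative[symmetric]
      by (auto intro!: derivative_eq_intros)
  qed
  then show ?thesis by (simp add: diff_divide_distrib)
qed

text \<open>Rather than differentiating under a singular kernel, \<open>J^\<alpha> f\<close> is
  recognised as the primitive of \<open>J^\<alpha> f'\<close>: Fubini turns that primitive into
  \<open>f'\<close> against \<open>(x - s) powr \<alpha> / \<alpha>\<close>, and integration by
  parts has no boundary terms, since \<open>f a = 0\<close> and the new kernel vanishes at
  \<open>s = x\<close>.\<close>

lemma C1_from_RL_left:
  assumes "0 < \<alpha>" "\<alpha> < 1" "C1_from a f"
  shows "C1_from a (RL_left a \<alpha> f)" "deriv (RL_left a \<alpha> f) = RL_left a \<alpha> (deriv f)"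
proof -
  let ?g = "deriv f"
  have cont: "continuous_on S ?g" "continuous_on S f" for S
    using C1_fromD[OF assms(3)] by auto
  have z: "RL_left a \<alpha> h x = 0" if "x \<le> a" for x h
    using that by (cases "x = a") (auto simp: RL_left_empty RL_left_self)
  have eq: "RL_left a \<alpha> f = (\<lambda>x. integral {a..x} (RL_left a \<alpha> ?g))"
  proof
    fix x show "RL_left a \<alpha> f x = integral {a..x} (RL_left a \<alpha> ?g)"
    proof (cases "a < x")
      case True
      let ?R = "\<lambda>s. LINT u:{s..x}|lebesgue. 1 * (u - s) powr (\<alpha> - 1)"
      have R: "?R s = (x - s) powr \<alpha> / \<alpha>" if "s \<in> {a..x}" for s
      proof -
        have h: "((\<lambda>u. (u - s) powr (\<alpha> - 1)) has_integral (x - s) powr \<alpha> / \<alpha>) {s..x}"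
          using right_kernel_has_integral[of \<alpha> s s x] that assms by simp
        show ?thesis
          using set_lebesgue_integral_eq_integral(2)[OF nonnegative_absolutely_integrable_1[OF has_integral_integrable[OF h]]]
            integral_unique[OF h] by simp
      qed
      have "integral {a..x} (RL_left a \<alpha> ?g)
          = integral {a..x} (\<lambda>u. 1 * integral {a..u} (\<lambda>s. ?g s * (u - s) powr (\<alpha> - 1))) / Gamma \<alpha>"
        by (subst integral_divide[symmetric]) (intro integral_cong, use assms cont in \<open>simp add: RL_left_eq_integral\<close>)
      also have "integral {a..x} (\<lambda>u. 1 * integral {a..u} (\<lambda>s. ?g s * (u - s) powr (\<alpha> - 1)))
          = integral {a..x} (\<lambda>s. ?g s * ?R s)"
        using True assms cont by (intro RL_Fubini(2)) (auto intro: absolutely_integrable_continuous_real)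
      also have "\<dots> = integral {a..x} (\<lambda>s. ?g s * ((x - s) powr \<alpha> / \<alpha>))"
        using R by (intro integral_cong) auto
      also have "\<dots> = integral {a..x} (\<lambda>s. f s * (x - s) powr (\<alpha> - 1))"
      proof (rule integral_unique, rule integration_by_parts_interior[where prod = "(*)" and f = f and f' = ?g
              and g' = "\<lambda>s. - ((x - s) powr (\<alpha> - 1))"])
        show "continuous_on {a..x} (\<lambda>s. (x - s) powr \<alpha> / \<alpha>)"
          using assms by (intro continuous_intros continuous_on_powr') auto
        fix s assume s: "s \<in> {a<..<x}"
        show "(f has_vector_derivative ?g s) (at s)"
          using C1_fromD(1)[OF assms(3)] by (simp add: has_real_derivative_iff_has_vector_derivative)
        show "((\<lambda>s. (x - s) powr \<alpha> / \<alpha>) has_vector_derivative - ((x - s) powr (\<alpha> - 1))) (at s)"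
          using s assms unfolding has_real_derivative_iff_has_vector_derivative[symmetric]
          by (auto intro!: derivative_eq_intros)
      next
        have "(\<lambda>s. f s * (x - s) powr (\<alpha> - 1)) integrable_on {a..x}"
          using kernel_mult_absolutely_integrable[OF assms(1) order_refl cont(2)] set_lebesgue_integral_eq_integral(1) by blast
        then show "((\<lambda>s. f s * - ((x - s) powr (\<alpha> - 1))) has_integral
           f x * ((x - x) powr \<alpha> / \<alpha>) - f a * ((x - a) powr \<alpha> / \<alpha>) - integral {a..x} (\<lambda>s. f s * (x - s) powr (\<alpha> - 1))) {a..x}"
          using C1_fromD(3)[OF assms(3), of a] by (simp add: has_integral_neg integrable_integral)
      qed (use True cont in \<open>auto intro: bounded_bilinear_mult\<close>)
      finally show ?thesis
        unfolding RL_left_eq_integral[OF assms(1) cont(2)] by simp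
    next
      case False
      then show ?thesis using z[of x] by (cases "x = a") auto
    qed
  qed
  have c: "continuous_on UNIV (RL_left a \<alpha> ?g)"
    using assms cont by (intro continuous_on_UNIV_from[OF continuous_on_RL_left z]) auto
  show "C1_from a (RL_left a \<alpha> f)" unfolding eq by (rule C1_from_integral(1)[OF c z])
  show "deriv (RL_left a \<alpha> f) = RL_left a \<alpha> (deriv f)" unfolding eq by (rule C1_from_integral(2)[OF c z])
qed

text \<open>\<open>J^(1-\<alpha>)\<close> applied to \<open>(J^\<alpha> f)' = J^\<alpha> f'\<close>
  is the primitive of \<open>f'\<close>. So any prescribed third argument in the class is realised
  by an explicit variation.\<close>

lemma caputo_left_RL_left:
  assumes "0 < \<alpha>" "\<alpha> < 1" "C1_from a f" "a \<le> x"
  shows "caputo_left a \<alpha> (RL_left a \<alpha> f) x = f x"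
proof (cases "a = x")
  case True
  then show ?thesis using C1_fromD(3)[OF assms(3), of a]
    by (simp add: caputo_left_def RL_left_self)
next
  case False
  then show ?thesis
    using RL_left_RL_left[of \<alpha> a x "deriv f"] assms C1_from_integral_deriv[OF assms(3,4)] C1_fromD(2)[OF assms(3)]
    by (simp add: caputo_left_def C1_from_RL_left(2))
qed

lemma continuous_on_caputo_left:
  assumes "0 < \<alpha>" "\<alpha> < 1" "C1_from a \<eta>"
  shows "continuous_on {a..b} (caputo_left a \<alpha> \<eta>)"
  unfolding caputo_left_def using assms by (intro continuous_on_RL_left C1_fromD) auto

lemma caputo_left_bound:
  assumes "0 < \<alpha>" "\<alpha> < 1" "C1_from a \<eta>" "a \<le> x" "x \<le> b" "\<And>u. a < u \<Longrightarrow> u < x \<Longrightarrow> \<bar>deriv \<eta> u\<bar> \<le> M" "0 \<le> M"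
  shows "\<bar>caputo_left a \<alpha> \<eta> x\<bar> \<le> M * ((b - a) powr (1 - \<alpha>) / ((1 - \<alpha>) * Gamma (1 - \<alpha>)))"
proof -
  have "\<bar>caputo_left a \<alpha> \<eta> x\<bar> \<le> M * (x - a) powr (1 - \<alpha>) / ((1 - \<alpha>) * Gamma (1 - \<alpha>))"
    unfolding caputo_left_def using assms by (intro RL_left_bound C1_fromD) auto
  also have "\<dots> = M * ((x - a) powr (1 - \<alpha>) / ((1 - \<alpha>) * Gamma (1 - \<alpha>)))" by simp
  also have "\<dots> \<le> M * ((b - a) powr (1 - \<alpha>) / ((1 - \<alpha>) * Gamma (1 - \<alpha>)))"
    using assms Gamma_real_pos[of "1 - \<alpha>"] by (intro mult_left_mono divide_right_mono powr_mono2) auto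
  finally show ?thesis .
qed

lemma caputo_left_cong:
  assumes "\<And>u. a < u \<Longrightarrow> u < x \<Longrightarrow> deriv f u = deriv g u"
  shows "caputo_left a \<alpha> f x = caputo_left a \<alpha> g x"
  unfolding caputo_left_def using assms by (rule RL_left_cong)

lemma caputo_left_add:
  assumes "\<alpha> < 1" "C1_from a f" "C1_from a g"
  shows "caputo_left a \<alpha> (\<lambda>x. f x + g x) x = caputo_left a \<alpha> f x + caputo_left a \<alpha> g x"
  using assms by (simp add: caputo_left_def C1_from_add(2) RL_left_add C1_fromD)

lemma caputo_left_cmult:
  assumes "C1_from a f"
  shows "caputo_left a \<alpha> (\<lambda>x. k * f x) x = k * caputo_left a \<alpha> f x"
  using assms by (simp add: caputo_left_def C1_from_cmult(2) RL_left_cmult)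

lemma C1_on_Icc_derivative:
  fixes y :: "real \<Rightarrow> real"
  assumes "C1_on {a..b} y"
  shows "\<exists>h. continuous_on {a..b} h \<and> (\<forall>u\<in>{a..b}. (y has_real_derivative h u) (at u within {a..b}))"
proof -
  obtain y' where y': "\<forall>p\<in>{a..b}. (y has_derivative blinfun_apply (y' p)) (at p within {a..b})"
    "continuous_on {a..b} y'" using assms unfolding C1_on_def by blast
  let ?h = "\<lambda>p. blinfun_apply (y' p) 1"
  have "blinfun_apply (y' p) = (*) (?h p)" for p
  proof
    fix t :: real show "blinfun_apply (y' p) t = ?h p * t"
      using blinfun.scaleR_right[of "y' p" t 1] by simp
  qed
  then have d: "(y has_real_derivative ?h u) (at u within {a..b})" if "u \<in> {a..b}" for u
    using y'(1) that by (simp add: has_field_derivative_def)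
  have "continuous_on {a..b} ?h" using y'(2) by (intro continuous_intros)
  with d show ?thesis by blast
qed

text \<open>\<open>deriv y\<close> may be arbitrary at \<open>a\<close> and \<open>b\<close>; it is
  replaced by the relative derivative \<open>h\<close>, which is continuous on all of
  \<open>[a,b]\<close> and has the same fractional integral.\<close>

lemma continuous_on_caputo_left_C1_on:
  assumes "0 < \<alpha>" "\<alpha> < 1" "C1_on {a..b} y"
  shows "continuous_on {a..b} (caputo_left a \<alpha> y)"
proof -
  obtain h where hc: "continuous_on {a..b} h"
    and hw: "\<forall>u\<in>{a..b}. (y has_real_derivative h u) (at u within {a..b})"
    using C1_on_Icc_derivative[OF assms(3)] by blast
  have hd: "(y has_real_derivative h u) (at u)" if "a < u" "u < b" for u
    using bspec[OF hw, of u] that by (simp add: at_within_Icc_at)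
  note h = hc hd
  have "continuous_on {a..b} (RL_left a (1 - \<alpha>) h)"
    using assms h by (intro continuous_on_RL_left) auto
  moreover have "caputo_left a \<alpha> y x = RL_left a (1 - \<alpha>) h x" if "x \<in> {a..b}" for x
    unfolding caputo_left_def using that h(2) by (intro RL_left_cong DERIV_imp_deriv) auto
  ultimately show ?thesis
    using continuous_on_cong[OF refl, of "{a..b}" "caputo_left a \<alpha> y" "RL_left a (1 - \<alpha>) h"] by simp
qed

lemma C1_on_add_C1_from:
  assumes "0 < \<alpha>" "\<alpha> < 1" "C1_on {a..b} y" "C1_from a \<eta>"
  shows "C1_on {a..b} (\<lambda>x. y x + \<eta> x)"
    and "x \<in> {a..b} \<Longrightarrow> caputo_left a \<alpha> (\<lambda>x. y x + \<eta> x) x = caputo_left a \<alpha> y x + caputo_left a \<alpha> \<eta> x"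
proof -
  obtain h where hc: "continuous_on {a..b} h"
    and hw: "\<forall>u\<in>{a..b}. (y has_real_derivative h u) (at u within {a..b})"
    using C1_on_Icc_derivative[OF assms(3)] by blast
  have hd: "(y has_real_derivative h u) (at u)" if "a < u" "u < b" for u
    using bspec[OF hw, of u] that by (simp add: at_within_Icc_at)
  note h = hc hd
  show "C1_on {a..b} (\<lambda>x. y x + \<eta> x)" unfolding C1_on_def
  proof (intro exI[of _ "\<lambda>p. blinfun_scaleR_left (h p + deriv \<eta> p)"] conjI ballI)
    fix p assume p: "p \<in> {a..b}"
    have "((\<lambda>x. y x + \<eta> x) has_real_derivative h p + deriv \<eta> p) (at p within {a..b})"
      using hw p C1_fromD(1)[OF assms(4)] by (intro DERIV_add) (auto intro: has_field_derivative_at_within)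
    then show "((\<lambda>x. y x + \<eta> x) has_derivative blinfun_apply (blinfun_scaleR_left (h p + deriv \<eta> p))) (at p within {a..b})"
      by (simp add: has_field_derivative_def mult_commute_abs)
  qed (intro continuous_intros h(1) C1_fromD(2)[OF assms(4)])
  assume x: "x \<in> {a..b}"
  have e1: "caputo_left a \<alpha> y x = RL_left a (1 - \<alpha>) h x"
    unfolding caputo_left_def using x h(2) by (intro RL_left_cong DERIV_imp_deriv) auto
  have e2: "caputo_left a \<alpha> (\<lambda>x. y x + \<eta> x) x = RL_left a (1 - \<alpha>) (\<lambda>u. h u + deriv \<eta> u) x"
    unfolding caputo_left_def
    using x h(2) C1_fromD(1)[OF assms(4)] by (intro RL_left_cong DERIV_imp_deriv DERIV_add) auto
  have "continuous_on {a..x} h" using h(1) x by (auto intro: continuous_on_subset)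
  then show "caputo_left a \<alpha> (\<lambda>x. y x + \<eta> x) x = caputo_left a \<alpha> y x + caputo_left a \<alpha> \<eta> x"
    unfolding e1 e2 using assms by (simp add: RL_left_add C1_fromD caputo_left_def)
qed

section \<open>Smallness of fractional integrals of oscillating functions\<close>

text \<open>In the manner of the second mean value theorem: against a monotone weight only the
  primitive \<open>F\<close> of \<open>f\<close> matters. The factor 3 counts the two boundary terms
  and the remaining integral, each at most \<open>\<Phi> * K d\<close>.\<close>

lemma by_parts_bound:
  fixes F f K K' :: "real \<Rightarrow> real"
  assumes "c \<le> d" "\<And>x. x \<in> {c..d} \<Longrightarrow> (F has_real_derivative f x) (at x)"
    "\<And>x. x \<in> {c..d} \<Longrightarrow> (K has_real_derivative K' x) (at x)"
    "continuous_on {c..d} f" "continuous_on {c..d} K'"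
    "\<And>x. x \<in> {c..d} \<Longrightarrow> 0 \<le> K' x" "0 \<le> K c" "\<And>x. x \<in> {c..d} \<Longrightarrow> \<bar>F x\<bar> \<le> \<Phi>"
  shows "\<bar>integral {c..d} (\<lambda>x. f x * K x)\<bar> \<le> 3 * \<Phi> * K d"
proof -
  have cF: "continuous_on {c..d} F" "continuous_on {c..d} K"
    using DERIV_isCont[OF assms(2)] DERIV_isCont[OF assms(3)] by (auto intro!: continuous_at_imp_continuous_on)
  have iK: "(K' has_integral K d - K c) {c..d}"
    using assms(1,3) by (intro fundamental_theorem_of_calculus)
      (auto simp: has_real_derivative_iff_has_vector_derivative[symmetric] intro: DERIV_subset)
  have Kcd: "K c \<le> K d" using has_integral_nonneg[OF iK] assms(6) by simp
  have iFK: "(\<lambda>x. F x * K' x) integrable_on {c..d}" "(\<lambda>x. f x * K x) integrable_on {c..d}"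
    using cF assms by (auto intro!: integrable_continuous_real continuous_intros)
  have "((\<lambda>x. f x * K x) has_integral (F d * K d - F c * K c - integral {c..d} (\<lambda>x. F x * K' x))) {c..d}"
    using assms(1) cF
  proof (rule integration_by_parts[where prod = "(*)" and f = F and g = K and g' = K' and f' = f, OF bounded_bilinear_mult])
    fix x assume "x \<in> {c..d}"
    then show "(F has_vector_derivative f x) (at x)" "(K has_vector_derivative K' x) (at x)"
      using assms(2,3) by (simp_all add: has_real_derivative_iff_has_vector_derivative)
  next
    show "((\<lambda>x. F x * K' x) has_integral F d * K d - F c * K c -
      (F d * K d - F c * K c - integral {c..d} (\<lambda>x. F x * K' x))) {c..d}"
      using iFK by (simp add: integrable_integral)
  qed
  then have e: "integral {c..d} (\<lambda>x. f x * K x) = F d * K d - F c * K c - integral {c..d} (\<lambda>x. F x * K' x)"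
    by (rule integral_unique)
  have "norm (integral {c..d} (\<lambda>x. F x * K' x)) \<le> integral {c..d} (\<lambda>x. \<Phi> * K' x)"
  proof (rule integral_norm_bound_integral)
    show "(\<lambda>x. \<Phi> * K' x) integrable_on {c..d}"
      using has_integral_mult_right[OF iK] by (rule has_integral_integrable)
    fix x assume "x \<in> {c..d}"
    then show "norm (F x * K' x) \<le> \<Phi> * K' x"
      using assms(6,8)[of x] by (simp add: abs_mult mult_right_mono)
  qed (fact iFK)
  also have "\<dots> = \<Phi> * (K d - K c)" using integral_unique[OF has_integral_mult_right[OF iK]] .
  finally have 1: "\<bar>integral {c..d} (\<lambda>x. F x * K' x)\<bar> \<le> \<Phi> * (K d - K c)" by simp
  have "\<bar>F d * K d\<bar> \<le> \<Phi> * K d" "\<bar>F c * K c\<bar> \<le> \<Phi> * K c"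
    using assms(1,7) assms(8)[of c] assms(8)[of d] Kcd by (simp_all add: abs_mult mult_right_mono)
  moreover have "\<Phi> * K c \<le> \<Phi> * K d" using Kcd assms(8)[of c] assms(1) by (intro mult_left_mono) auto
  ultimately show ?thesis using 1 unfolding e by (simp add: algebra_simps)
qed

text \<open>Within distance \<open>r\<close> of the singularity only the size \<open>A\<close> of
  \<open>f\<close> is used, farther away only its primitive, against a kernel of size at most
  \<open>r powr (\<alpha> - 1)\<close>. In applications \<open>r\<close> is fixed first and
  \<open>\<Phi>\<close> is made small afterwards.\<close>

lemma RL_left_small:
  assumes "0 < \<alpha>" "\<alpha> < 1" "C1_from a f" "a \<le> x" "0 < r"
    and A: "\<And>u. \<bar>f u\<bar> \<le> A" and \<Phi>: "\<And>u. a \<le> u \<Longrightarrow> \<bar>integral {a..u} f\<bar> \<le> \<Phi>"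
  shows "\<bar>RL_left a \<alpha> f x\<bar> \<le> (3 * \<Phi> * r powr (\<alpha> - 1) + A * (r powr \<alpha> / \<alpha>)) / Gamma \<alpha>"
proof -
  have c: "continuous_on S f" for S using assms(3) by (rule C1_fromD)
  have G: "Gamma \<alpha> > 0" using assms by (intro Gamma_real_pos)
  have A0: "0 \<le> A" using A[of a] by linarith
  have \<Phi>0: "0 \<le> \<Phi>" using \<Phi>[of a] by simp
  define m where "m = max a (x - r)"
  have m: "a \<le> m" "m \<le> x" "x - m \<le> r" using assms by (auto simp: m_def)
  let ?k = "\<lambda>u. (x - u) powr (\<alpha> - 1)"
  have "(\<lambda>u. f u * ?k u) integrable_on {a..x}"
    using kernel_mult_absolutely_integrable[OF assms(1) order_refl c] set_lebesgue_integral_eq_integral(1) by blast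
  from Henstock_Kurzweil_Integration.integral_combine[OF m(1,2) this]
  have "integral {a..x} (\<lambda>u. f u * ?k u) = integral {a..m} (\<lambda>u. f u * ?k u) + integral {m..x} (\<lambda>u. f u * ?k u)" by simp
  moreover have "\<bar>integral {m..x} (\<lambda>u. f u * ?k u)\<bar> \<le> A * (r powr \<alpha> / \<alpha>)"
  proof -
    have "\<bar>integral {m..x} (\<lambda>u. f u * ?k u)\<bar> \<le> A * (((x - m) powr \<alpha> - (x - x) powr \<alpha>) / \<alpha>)"
      using assms m c by (intro kernel_mult_bound) auto
    also have "\<dots> \<le> A * (r powr \<alpha> / \<alpha>)"
      using assms m A0 by (intro mult_left_mono divide_right_mono) (auto intro!: powr_mono2)
    finally show ?thesis .
  qed
  moreover have "\<bar>integral {a..m} (\<lambda>u. f u * ?k u)\<bar> \<le> 3 * \<Phi> * r powr (\<alpha> - 1)"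
  proof (cases "m = a")
    case True
    then show ?thesis using \<Phi>0 by simp
  next
    case False
    then have mr: "m = x - r" "a < m" by (auto simp: m_def max_def split: if_splits)
    have z: "f u = 0" if "u \<le> a" for u using C1_fromD(3)[OF assms(3) that] .
    have dF: "((\<lambda>x. integral {a..x} f) has_real_derivative f u) (at u)" for u
      using C1_fromD(1)[OF C1_from_integral(1)[of f a], of u] C1_from_integral(2)[of f a] c z by simp
    have "\<bar>integral {a..m} (\<lambda>u. f u * ?k u)\<bar> \<le> 3 * \<Phi> * ?k m"
    proof (rule by_parts_bound[where K' = "\<lambda>u. (1 - \<alpha>) * (x - u) powr (\<alpha> - 2)"])
      fix u assume "u \<in> {a..m}"
      then have u: "u < x" using mr assms by auto
      show "(?k has_real_derivative (1 - \<alpha>) * (x - u) powr (\<alpha> - 2)) (at u)"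
        using u by (auto intro!: derivative_eq_intros simp: algebra_simps)
      show "0 \<le> (1 - \<alpha>) * (x - u) powr (\<alpha> - 2)" using assms by simp
    next
      show "continuous_on {a..m} (\<lambda>u. (1 - \<alpha>) * (x - u) powr (\<alpha> - 2))"
        using mr assms by (intro continuous_intros) auto
    qed (use m dF c \<Phi> in auto)
    then show ?thesis using mr by simp
  qed
  ultimately have "\<bar>integral {a..x} (\<lambda>u. f u * ?k u)\<bar> \<le> 3 * \<Phi> * r powr (\<alpha> - 1) + A * (r powr \<alpha> / \<alpha>)" by linarith
  then show ?thesis using G assms c by (simp add: RL_left_eq_integral divide_right_mono)
qed

text \<open>The derivative of an oscillating \<open>f\<close> is not under control, but at distance
  \<open>g\<close> beyond its support the kernel is smooth: one integration by parts moves the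
  derivative to the kernel, a second one replaces \<open>f\<close> by its primitive.\<close>

lemma RL_left_deriv_small:
  assumes "0 < \<alpha>" "\<alpha> < 1" "C1_from a f" "a \<le> e" "e + g \<le> x" "0 < g"
    and supp: "\<And>u. e \<le> u \<Longrightarrow> f u = 0" and \<Phi>: "\<And>u. a \<le> u \<Longrightarrow> \<bar>integral {a..u} f\<bar> \<le> \<Phi>"
  shows "\<bar>RL_left a \<alpha> (deriv f) x\<bar> \<le> 3 * \<Phi> * ((1 - \<alpha>) * g powr (\<alpha> - 2)) / Gamma \<alpha>"
proof -
  have c: "continuous_on S f" "continuous_on S (deriv f)" for S using C1_fromD[OF assms(3)] by auto
  have G: "Gamma \<alpha> > 0" using assms by (intro Gamma_real_pos)
  have \<Phi>0: "0 \<le> \<Phi>" using \<Phi>[of a] by simp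
  have z: "f u = 0" if "u \<le> a" for u using C1_fromD(3)[OF assms(3) that] .
  have dF: "((\<lambda>x. integral {a..x} f) has_real_derivative f u) (at u)" for u
    using C1_fromD(1)[OF C1_from_integral(1)[of f a], of u] C1_from_integral(2)[of f a] c z by simp
  let ?k = "\<lambda>u. (x - u) powr (\<alpha> - 1)" and ?k' = "\<lambda>u. (1 - \<alpha>) * (x - u) powr (\<alpha> - 2)"
  have dk: "(?k has_real_derivative ?k' u) (at u)" if "u \<in> {a..e}" for u
    using that assms by (auto intro!: derivative_eq_intros simp: algebra_simps)
  have ck': "continuous_on {a..e} ?k'" "continuous_on {a..e} ?k" using assms by (auto intro!: continuous_intros)
  have "integral {a..x} (\<lambda>u. deriv f u * ?k u) = integral {a..e} (\<lambda>u. deriv f u * ?k u)"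
  proof -
    have "(\<lambda>u. deriv f u * ?k u) integrable_on {a..x}"
      using kernel_mult_absolutely_integrable[OF assms(1) order_refl c(2)] set_lebesgue_integral_eq_integral(1) by blast
    moreover have "integral {e..x} (\<lambda>u. deriv f u * ?k u) = integral {e..x} (\<lambda>u. 0)"
      by (rule integral_spike[of "{e}"]) (use C1_from_deriv_zero_right[OF assms(3) supp] in auto)
    ultimately show ?thesis
      using Henstock_Kurzweil_Integration.integral_combine[of a e x "\<lambda>u. deriv f u * ?k u"] assms by simp
  qed
  also have "((\<lambda>u. deriv f u * ?k u) has_integral - integral {a..e} (\<lambda>u. f u * ?k' u)) {a..e}"
  proof (rule integration_by_parts[where prod = "(*)" and f = f and g = ?k and g' = ?k', OF bounded_bilinear_mult])
    show "((\<lambda>u. f u * ?k' u) has_integral f e * ?k e - f a * ?k a - - integral {a..e} (\<lambda>u. f u * ?k' u)) {a..e}"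
    proof -
      have "(\<lambda>u. f u * ?k' u) integrable_on {a..e}"
        by (rule integrable_continuous_real[OF continuous_on_mult[OF c(1) ck'(1)]])
      then show ?thesis using supp[of e] z[of a] by (simp add: integrable_integral)
    qed
  qed (use assms c ck' dk C1_fromD(1)[OF assms(3)] in \<open>simp_all add: has_real_derivative_iff_has_vector_derivative\<close>)
  then have "integral {a..e} (\<lambda>u. deriv f u * ?k u) = - integral {a..e} (\<lambda>u. f u * ?k' u)"
    by (rule integral_unique)
  finally have "\<bar>integral {a..x} (\<lambda>u. deriv f u * ?k u)\<bar> = \<bar>integral {a..e} (\<lambda>u. f u * ?k' u)\<bar>" by simp
  also have "\<dots> \<le> 3 * \<Phi> * ?k' e"
  proof (rule by_parts_bound[where K' = "\<lambda>u. (1 - \<alpha>) * ((2 - \<alpha>) * (x - u) powr (\<alpha> - 3))"])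
    fix u assume "u \<in> {a..e}"
    then have u: "u < x" using assms by auto
    show "(?k' has_real_derivative (1 - \<alpha>) * ((2 - \<alpha>) * (x - u) powr (\<alpha> - 3))) (at u)"
      using u by (auto intro!: derivative_eq_intros simp: algebra_simps)
    show "0 \<le> (1 - \<alpha>) * ((2 - \<alpha>) * (x - u) powr (\<alpha> - 3))" using assms by simp
  qed (use assms c dF in \<open>auto intro!: continuous_intros\<close>)
  also have "\<dots> \<le> 3 * \<Phi> * ((1 - \<alpha>) * g powr (\<alpha> - 2))"
    using assms \<Phi>0 by (intro mult_left_mono powr_mono2') auto
  finally show ?thesis using G assms c by (simp add: RL_left_eq_integral divide_right_mono)
qed

section \<open>Cutoffs, bumps and the category argument\<close>

text \<open>The step is the primitive of the parabola \<open>(u - p) * (q - u)\<close>, normalised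
  by \<open>6 / (q - p) ^ 3\<close>. Its slope is at most \<open>3 / 2 / (q - p)\<close>; the
  explicit dependence on \<open>q - p\<close> is needed when the cutoff interval shrinks towards
  \<open>b\<close>.\<close>

lemma smooth_step:
  fixes p q :: real
  assumes "p < q"
  shows "\<exists>\<mu> \<mu>'. (\<forall>x. (\<mu> has_real_derivative \<mu>' x) (at x)) \<and> continuous_on UNIV \<mu>' \<and>
    (\<forall>x\<le>p. \<mu> x = 0) \<and> (\<forall>x\<ge>q. \<mu> x = 1) \<and>
    (\<forall>x. 0 \<le> \<mu> x) \<and> (\<forall>x. \<mu> x \<le> 1) \<and> (\<forall>x. \<bar>\<mu>' x\<bar> \<le> 2 / (q - p))"
proof -
  define g where "g u = 6 / (q - p) ^ 3 * max 0 ((u - p) * (q - u))" for u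
  define \<mu> where "\<mu> x = integral {p..x} g" for x
  have cg: "continuous_on S g" for S unfolding g_def by (intro continuous_intros)
  have g0: "0 \<le> g u" for u using assms by (simp add: g_def)
  have gz: "g u = 0" if "u \<le> p \<or> q \<le> u" for u
    using that assms by (auto simp: g_def max_def mult_le_0_iff zero_le_mult_iff)
  have C: "C1_from p \<mu>" "deriv \<mu> = g"
    using C1_from_integral[of g p] cg gz unfolding \<mu>_def by auto
  have one: "integral {p..q} g = 1"
  proof -
    define G where "G u = 6 / (q - p) ^ 3 * ((q - p) * (u - p)^2 / 2 - (u - p)^3 / 3)" for u
    have "(g has_integral G q - G p) {p..q}"
    proof (rule fundamental_theorem_of_calculus)
      fix u assume u: "u \<in> {p..q}"
      have "g u = 6 / (q - p) ^ 3 * ((u - p) * (q - u))" using u by (simp add: g_def)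
      moreover have "((\<lambda>u. (q - p) * (u - p)^2 / 2 - (u - p)^3 / 3) has_real_derivative (u - p) * (q - u)) (at u)"
        by (auto intro!: derivative_eq_intros simp: power2_eq_square field_simps)
      ultimately have "(G has_real_derivative g u) (at u)"
        unfolding G_def by (simp only: DERIV_cmult)
      then show "(G has_vector_derivative g u) (at u within {p..q})"
        by (auto simp: has_real_derivative_iff_has_vector_derivative[symmetric] intro: has_field_derivative_at_within)
    qed (use assms in auto)
    moreover have "G q - G p = 1"
    proof -
      have "(q - p) * (q - p)^2 / 2 - (q - p)^3 / 3 = (q - p)^3 / 6" by (simp add: power3_eq_cube power2_eq_square)
      then show ?thesis using assms by (simp add: G_def)
    qed
    ultimately show ?thesis by (simp add: integral_unique)
  qed
  have i: "g integrable_on {s..t}" for s t by (rule integrable_continuous_real[OF cg])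
  have m1: "\<mu> x = 1" if "q \<le> x" for x
  proof -
    have "integral {q..x} g = 0"
      using integral_cong[of "{q..x}" g "\<lambda>_. 0"] gz by simp
    then show ?thesis
      using Henstock_Kurzweil_Integration.integral_combine[of p q x g] i that assms one by (simp add: \<mu>_def)
  qed
  have p1: "(\<mu> has_real_derivative g x) (at x)" for x using C1_fromD(1)[OF C(1)] C(2) by simp
  have p2: "continuous_on UNIV g" by (rule cg)
  have p3: "\<mu> x = 0" if "x \<le> p" for x using C1_fromD(3)[OF C(1) that] .
  have p4: "\<mu> x = 1" if "q \<le> x" for x using m1 that .
  have p5: "0 \<le> \<mu> x" for x unfolding \<mu>_def using g0 by (intro integral_nonneg i)
  have p6: "\<mu> x \<le> 1" for x
  proof (cases "x \<le> q")
    case True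
    then have "integral {p..x} g \<le> integral {p..q} g" using g0 by (intro integral_subset_le i) auto
    then show ?thesis using one by (simp add: \<mu>_def)
  qed (use m1 in auto)
  have p7: "\<bar>g x\<bar> \<le> 2 / (q - p)" for x
  proof -
    have "(x - p) * (q - x) \<le> (q - p)^2 / 4"
      using zero_le_power2[of "(x - p) - (q - x)"] by (simp add: power2_eq_square algebra_simps)
    then have "max 0 ((x - p) * (q - x)) \<le> (q - p)^2 / 4" by (auto simp: max_def)
    then have "g x \<le> 6 / (q - p) ^ 3 * ((q - p)^2 / 4)"
      unfolding g_def using assms by (intro mult_left_mono) auto
    also have "\<dots> \<le> 2 / (q - p)" using assms by (simp add: power2_eq_square power3_eq_cube divide_simps)
    finally show ?thesis using g0[of x] by simp
  qed
  show ?thesis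
    by (intro exI[of _ \<mu>] exI[of _ g] conjI allI impI p1 p2 p3 p4 p5 p6 p7)
qed

lemma DERIV_max_0_power2: "((\<lambda>t::real. (max 0 t)^2) has_real_derivative 2 * max 0 t) (at t)"
proof (cases "t = 0")
  case True
  have "((\<lambda>h. ((max 0 (0 + h))^2 - (max 0 0)^2) / h) \<longlongrightarrow> (0::real)) (at 0)"
  proof (rule Lim_null_comparison)
    show "\<forall>\<^sub>F h in at 0. norm (((max 0 (0 + h))^2 - (max 0 0)^2) / h) \<le> \<bar>h::real\<bar>"
      by (rule always_eventually) (auto simp: max_def power2_eq_square)
    show "((\<lambda>h::real. \<bar>h\<bar>) \<longlongrightarrow> 0) (at 0)" by (rule tendsto_eq_intros | simp)+
  qed
  then show ?thesis using True by (simp add: DERIV_def)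
next
  case False
  then consider "t < 0" | "t > 0" by linarith
  then show ?thesis
  proof cases
    case 1
    show ?thesis
      by (rule has_field_derivative_transform_within_open[of "\<lambda>_. 0" _ _ "{..<0}"]) (use 1 in \<open>auto simp: max_def\<close>)
  next
    case 2
    have "((\<lambda>t. t^2) has_real_derivative 2 * max 0 t) (at t)"
      using 2 by (auto intro!: derivative_eq_intros)
    then show ?thesis
      by (rule has_field_derivative_transform_within_open[of _ _ _ "{0<..}"]) (use 2 in \<open>auto simp: max_def\<close>)
  qed
qed

text \<open>Squaring removes the corners of the truncated parabola at \<open>p\<close> and
  \<open>q\<close>. The factor \<open>p + q - 2 * x\<close> in the derivative displays the single
  change of sign at the midpoint.\<close>

lemma C1_bump:
  fixes p q :: real
  defines "\<phi> \<equiv> \<lambda>x. (max 0 ((x - p) * (q - x)))^2"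
  assumes "p < q"
  shows "C1_from p \<phi>" "deriv \<phi> = (\<lambda>x. 2 * max 0 ((x - p) * (q - x)) * (p + q - 2 * x))"
    "\<And>x. q \<le> x \<Longrightarrow> \<phi> x = 0" "\<And>x. 0 \<le> \<phi> x" "\<And>x. p < x \<Longrightarrow> x < q \<Longrightarrow> 0 < \<phi> x"
proof -
  have d: "(\<phi> has_real_derivative 2 * max 0 ((x - p) * (q - x)) * (p + q - 2 * x)) (at x)" for x
    unfolding \<phi>_def
    by (rule DERIV_chain2[OF DERIV_max_0_power2]) (auto intro!: derivative_eq_intros simp: algebra_simps)
  have c: "continuous_on UNIV (\<lambda>x. 2 * max 0 ((x - p) * (q - x)) * (p + q - 2 * x))" by (intro continuous_intros)
  have z: "\<phi> x = 0" if "x \<le> p \<or> q \<le> x" for x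
    using that assms by (auto simp: \<phi>_def max_def mult_le_0_iff zero_le_mult_iff)
  show "C1_from p \<phi>" by (rule C1_fromI(1)[OF d c]) (use z in auto)
  show "deriv \<phi> = (\<lambda>x. 2 * max 0 ((x - p) * (q - x)) * (p + q - 2 * x))"
    by (rule C1_fromI(2)[OF d c, of p]) (use z in auto)
qed (use assms in \<open>auto simp: \<phi>_def max_def mult_le_0_iff zero_le_mult_iff\<close>)

text \<open>The integrand changes sign from negative to positive at the midpoint of the bump, and the
  kernel is increasing.\<close>

lemma caputo_left_bump_pos:
  fixes a c x \<alpha> :: real
  assumes "0 < \<alpha>" "\<alpha> < 1" "a < c" "c < x"
  shows "0 < caputo_left a \<alpha> (\<lambda>x. - 1 * (max 0 ((x - a) * (c - x)))^2) x"
proof -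
  let ?\<phi> = "\<lambda>x. (max 0 ((x - a) * (c - x)))^2"
  note B = C1_bump[OF assms(3)]
  define h where "h u = 2 * max 0 ((u - a) * (c - u)) * (2 * u - (a + c))" for u
  have dh: "deriv (\<lambda>x. - 1 * ?\<phi> x) = h"
    unfolding C1_from_cmult(2)[OF B(1)] B(2) h_def by (simp add: fun_eq_iff algebra_simps)
  have C: "C1_from a (\<lambda>x. - 1 * ?\<phi> x)" by (rule C1_from_cmult(1)[OF B(1)])
  have ch: "continuous_on S h" for S unfolding h_def by (intro continuous_intros)
  define m where "m = (a + c) / 2"
  have m: "a < m" "m < c" using assms by (auto simp: m_def)
  let ?k = "\<lambda>u. (x - u) powr (- \<alpha>)"
  \<comment> \<open>As \<open>h\<close> has integral 0 over \<open>[a,c]\<close>, subtracting the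
    constant \<open>?k m\<close> from the kernel leaves the integral unchanged and makes the
    integrand nonnegative.\<close>
  define G where "G u = h u * (?k u - ?k m)" for u
  have km: "?k u < ?k v" if "u < v" "v < x" for u v
    using that assms by (intro powr_less_mono2_neg) auto
  have hs: "h u \<le> 0" if "u \<le> m" for u
    using that by (auto simp: h_def m_def mult_nonneg_nonpos)
  have hs': "0 \<le> h u" if "m \<le> u" for u
    using that by (auto simp: h_def m_def)
  have G0: "0 \<le> G u" if "u < x" for u
  proof (cases "u \<le> m")
    case True
    then have "?k u \<le> ?k m" using km[of u m] assms m by (cases "u = m") auto
    then show ?thesis using hs[OF True] by (simp add: G_def mult_nonpos_nonpos)
  next
    case False
    then have "?k m \<le> ?k u" using km[of m u] that by auto
    then show ?thesis using hs'[of u] False by (simp add: G_def)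
  qed
  have cG: "continuous_on {a..c} G"
    unfolding G_def using assms by (intro continuous_intros ch) auto
  have ih: "(h has_integral 0) {a..c}"
    using C1_from_integral_deriv[OF C, of c] B(3)[of c] assms integrable_integral[OF integrable_continuous_real[OF ch[of "{a..c}"]]]
    unfolding dh by simp
  have ck: "continuous_on {a..c} (\<lambda>u. h u * ?k u)"
    using assms by (intro continuous_intros ch) auto
  have "integral {a..c} G = integral {a..c} (\<lambda>u. h u * ?k u) - integral {a..c} (\<lambda>u. h u * ?k m)"
    unfolding G_def right_diff_distrib
    by (intro integral_diff integrable_continuous_real ck continuous_intros ch)
  also have "integral {a..c} (\<lambda>u. h u * ?k m) = 0"
    using integral_unique[OF has_integral_mult_left[OF ih, of "?k m"]] by simp
  finally have e: "integral {a..c} G = integral {a..c} (\<lambda>u. h u * ?k u)" by simp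
  have "0 < integral {a..c} G"
  proof -
    have "integral {a..c} G \<noteq> 0"
    proof
      assume "integral {a..c} G = 0"
      then have "(G has_integral 0) {a..c}"
        using integrable_integral[OF integrable_continuous_real[OF cG]] by simp
      then have z: "G u = 0" if "u \<in> {a..c}" for u
        using has_integral_0_cbox_imp_0[of a c G] cG G0 assms that by (auto simp: box_ne_empty)
      \<comment> \<open>A point strictly between the midpoint and \<open>c\<close>, where both
        factors of \<open>G\<close> are positive.\<close>
      define v where "v = (m + c) / 2"
      have v: "m < v" "v < c" "a < v" using m by (auto simp: v_def)
      then have "0 < h v" by (auto simp: h_def m_def max_def mult_le_0_iff)
      moreover have "?k m < ?k v" using km[of m v] v assms by auto
      ultimately have "0 < G v" by (simp add: G_def)
      with z[of v] v show False by simp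
    qed
    moreover have "0 \<le> integral {a..c} G"
      using G0 assms by (intro integral_nonneg integrable_continuous_real cG) auto
    ultimately show ?thesis by linarith
  qed
  moreover have "integral {a..x} (\<lambda>u. h u * (x - u) powr (1 - \<alpha> - 1)) = integral {a..c} (\<lambda>u. h u * ?k u)"
  proof -
    have i: "(\<lambda>u. h u * (x - u) powr (1 - \<alpha> - 1)) integrable_on {a..x}"
      using kernel_mult_absolutely_integrable[OF _ order_refl ch, of "1 - \<alpha>"] assms set_lebesgue_integral_eq_integral(1) by force
    have "integral {c..x} (\<lambda>u. h u * (x - u) powr (1 - \<alpha> - 1)) = integral {c..x} (\<lambda>u. 0)"
      using assms by (intro integral_cong) (auto simp: h_def max_def mult_le_0_iff zero_le_mult_iff)
    then show ?thesis
      using Henstock_Kurzweil_Integration.integral_combine[OF _ _ i, of c] assms by simp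
  qed
  ultimately show ?thesis
    using assms Gamma_real_pos[of "1 - \<alpha>"] ch unfolding caputo_left_def dh
    by (subst RL_left_eq_integral) (auto simp: e)
qed

text \<open>If no \<open>F k\<close> contained an interval, every complement in \<open>[p,q]\<close>
  would be relatively open and dense; by Baire their intersection would be dense, whereas the
  covering makes it empty.\<close>

lemma Baire_interval:
  fixes F :: "nat \<Rightarrow> real set"
  assumes "p < q" "\<And>k. closed (F k)" "{p..q} \<subseteq> (\<Union>k. F k)"
  obtains k l r where "p \<le> l" "l < r" "r \<le> q" "{l..r} \<subseteq> F k"
proof -
  have "\<exists>k l r. p \<le> l \<and> l < r \<and> r \<le> q \<and> {l..r} \<subseteq> F k"
  proof (rule ccontr)
    assume no: "\<not> ?thesis"
    have "{p..q} \<subseteq> closure (\<Inter>(range (\<lambda>k. {p..q} - F k)))"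
    proof (rule Baire)
      fix T assume "T \<in> range (\<lambda>k. {p..q} - F k)"
      then obtain k where T: "T = {p..q} - F k" by auto
      show "openin (top_of_set {p..q}) T \<and> {p..q} \<subseteq> closure T"
      proof
        show "openin (top_of_set {p..q}) T"
          unfolding T Diff_eq using assms(2) by (intro openin_open_Int) auto
        show "{p..q} \<subseteq> closure T"
        proof
          fix x assume x: "x \<in> {p..q}"
          show "x \<in> closure T"
          proof (rule ccontr)
            assume "x \<notin> closure T"
            then obtain e where e: "e > 0" "\<And>t. t \<in> T \<Longrightarrow> e \<le> dist t x"
              unfolding closure_approachable by (meson not_le)
            define l where "l = max p (x - e / 2)"
            define r where "r = min q (x + e / 2)"
            have lr: "p \<le> l" "l < r" "r \<le> q" using x e(1) assms(1) by (auto simp: l_def r_def)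
            moreover have "{l..r} \<subseteq> F k"
            proof
              fix t assume t: "t \<in> {l..r}"
              then have "dist t x < e" using e(1) by (auto simp: l_def r_def dist_real_def)
              then have "t \<notin> T" using e(2) by force
              moreover have "t \<in> {p..q}" using t lr by auto
              ultimately show "t \<in> F k" unfolding T by blast
            qed
            ultimately show False using no by blast
          qed
        qed
      qed
    qed auto
    moreover have e: "\<Inter>(range (\<lambda>k. {p..q} - F k)) = {}" using assms(3) by auto
    ultimately have "{p..q} \<subseteq> {}" unfolding e by simp
    then show False using assms(1) by auto
  qed
  then show ?thesis using that by blast
qed

section \<open>Chattering\<close>

lemma has_integral_bound_Icc:
  fixes f :: "real \<Rightarrow> 'a::euclidean_space"
  assumes "0 \<le> B" "p \<le> x" "(f has_integral i) {p..x}" "\<And>u. u \<in> {p..x} \<Longrightarrow> norm (f u) \<le> B"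
  shows "norm i \<le> B * (x - p)"
  using has_integral_bound_real[OF assms(1) finite.emptyI assms(3)] assms(2,4) by simp

lemma indicator_mult_integrable:
  fixes G :: "real \<Rightarrow> 'a::euclidean_space"
  assumes "A \<in> sets lebesgue" "continuous_on {p..x} G"
  shows "(\<lambda>u. indicat_real A u *\<^sub>R G u) absolutely_integrable_on {p..x}"
proof -
  have "G absolutely_integrable_on {p..x}" using assms(2) by (rule absolutely_integrable_continuous_real)
  then have "integrable lebesgue (\<lambda>u. indicat_real A u *\<^sub>R (indicat_real {p..x} u *\<^sub>R G u))"
    unfolding set_integrable_def by (rule integrable_mult_indicator[OF assms(1)])
  then show ?thesis unfolding set_integrable_def by (simp add: mult.commute)
qed

text \<open>The indicator of \<open>A\<close> imitates the density \<open>\<rho>\<close> weakly,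
  uniformly over all initial intervals: on each short piece \<open>A\<close> occupies an initial
  fraction \<open>\<rho> x\<close>. The pieces are assembled by the Bolzano bisection principle.
  \<open>G\<close> is vector valued so that several weights can share one set.\<close>

lemma weak_chatter:
  fixes G :: "real \<Rightarrow> 'a::euclidean_space"
  assumes "c \<le> e" and cl: "continuous_on {c..e} \<rho>" and cG: "continuous_on {c..e} G"
    and l01: "\<And>x. x \<in> {c..e} \<Longrightarrow> 0 \<le> \<rho> x \<and> \<rho> x \<le> 1" and tau: "0 < \<tau>"
  shows "\<exists>A\<in>sets lebesgue. \<forall>x\<in>{c..e}. norm (integral {c..x} (\<lambda>u. (indicat_real A u - \<rho> u) *\<^sub>R G u)) \<le> \<tau>"
proof -
  define I where "I A p x = integral {p..x} (\<lambda>u. (indicat_real A u - \<rho> u) *\<^sub>R G u)" for A p x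
  define L where "L = e - c + 1"
  have L: "0 < L" using assms(1) by (simp add: L_def)
  define \<sigma> where "\<sigma> = \<tau> / (2 * L)"
  have \<sigma>: "0 < \<sigma>" using tau L by (simp add: \<sigma>_def)
  have int: "(\<lambda>u. (indicat_real A u - \<rho> u) *\<^sub>R G u) integrable_on {p..x}"
    if "A \<in> sets lebesgue" "c \<le> p" "x \<le> e" for A p x
  proof -
    have "continuous_on {p..x} G" "continuous_on {p..x} \<rho>"
      using that cl cG by (auto intro: continuous_on_subset)
    then have "continuous_on {p..x} (\<lambda>u. \<rho> u *\<^sub>R G u)" "continuous_on {p..x} G" by (auto intro!: continuous_intros)
    then have "(\<lambda>u. indicat_real A u *\<^sub>R G u) integrable_on {p..x}" "(\<lambda>u. \<rho> u *\<^sub>R G u) integrable_on {p..x}"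
      using set_lebesgue_integral_eq_integral(1)[OF indicator_mult_integrable[OF that(1)]] integrable_continuous_real
      by blast+
    then show ?thesis unfolding scaleR_left_diff_distrib by (rule integrable_diff)
  qed
  obtain M where M: "0 \<le> M" "\<And>x. x \<in> {c..e} \<Longrightarrow> norm (G x) \<le> M"
  proof -
    have "bounded (G ` {c..e})" using cG by (intro compact_imp_bounded compact_continuous_image) auto
    then obtain M where "\<forall>z\<in>G ` {c..e}. norm z \<le> M" unfolding bounded_iff by blast
    then show ?thesis using that[of "max 0 M"] by (auto simp: max.coboundedI2)
  qed
  \<comment> \<open>Two defects are recorded. The one over a whole piece is proportional to its
    length, hence additive under concatenation; the running one inside a piece may exceed this by
    \<open>\<tau> / 2\<close>, an allowance charged only to the last, unfinished piece.\<close>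
  define P where "P p s \<longleftrightarrow> (c \<le> p \<and> p \<le> s \<and> s \<le> e \<longrightarrow>
      (\<exists>A\<in>sets lebesgue. norm (I A p s) \<le> \<sigma> * (s - p) \<and> (\<forall>x\<in>{p..s}. norm (I A p x) \<le> \<sigma> * (x - p) + \<tau> / 2)))" for p s
  have "P c e" using assms(1)
  proof (induction rule: Bolzano)
    case (trans p q s)
    show ?case unfolding P_def
    proof
      assume *: "c \<le> p \<and> p \<le> s \<and> s \<le> e"
      obtain A1 where A1: "A1 \<in> sets lebesgue" "norm (I A1 p q) \<le> \<sigma> * (q - p)"
          "\<And>x. x \<in> {p..q} \<Longrightarrow> norm (I A1 p x) \<le> \<sigma> * (x - p) + \<tau> / 2"
        using trans * unfolding P_def by auto
      obtain A2 where A2: "A2 \<in> sets lebesgue" "norm (I A2 q s) \<le> \<sigma> * (s - q)"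
          "\<And>x. x \<in> {q..s} \<Longrightarrow> norm (I A2 q x) \<le> \<sigma> * (x - q) + \<tau> / 2"
        using trans * unfolding P_def by auto
      \<comment> \<open>Cutting at \<open>q\<close> lets each half keep its own set; the overlap is
        a single point.\<close>
      define A where "A = (A1 \<inter> {..q}) \<union> (A2 \<inter> {q<..})"
      have A: "A \<in> sets lebesgue"
      proof -
        have "{..q} \<in> sets lebesgue" "{q<..} \<in> sets lebesgue" by (auto intro: sets_completionI_sets)
        then show ?thesis unfolding A_def using A1(1) A2(1) by (intro sets.Un sets.Int)
      qed
      have e1: "I A p x = I A1 p x" if "x \<le> q" for x
        unfolding I_def by (intro integral_cong) (use that in \<open>auto simp: A_def indicator_def\<close>)
      have e2: "I A q x = I A2 q x" for x
        unfolding I_def by (rule integral_spike[of "{q}"]) (auto simp: A_def indicator_def)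
      have e3: "I A p x = I A1 p q + I A2 q x" if "q \<le> x" "x \<le> s" for x
      proof -
        have "I A p x = I A p q + I A q x" unfolding I_def
          using that trans * by (intro Henstock_Kurzweil_Integration.integral_combine[symmetric] int A) auto
        then show ?thesis using e1[of q] e2 by simp
      qed
      have "norm (I A p s) \<le> \<sigma> * (s - p)"
        using e3[of s] trans A1(2) A2(2) norm_triangle_ineq[of "I A1 p q" "I A2 q s"] by (simp add: algebra_simps)
      moreover have "norm (I A p x) \<le> \<sigma> * (x - p) + \<tau> / 2" if "x \<in> {p..s}" for x
      proof (cases "x \<le> q")
        case True
        then show ?thesis using A1(3)[of x] e1 that by simp
      next
        case False
        then show ?thesis
          using e3[of x] that A1(2) A2(3)[of x] norm_triangle_ineq[of "I A1 p q" "I A2 q x"] by (simp add: algebra_simps)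
      qed
      ultimately show "\<exists>A\<in>sets lebesgue. norm (I A p s) \<le> \<sigma> * (s - p) \<and> (\<forall>x\<in>{p..s}. norm (I A p x) \<le> \<sigma> * (x - p) + \<tau> / 2)"
        using A by blast
    qed
  next
    case (local x)
    \<comment> \<open>Freezing \<open>\<rho>\<close> and \<open>G\<close> at \<open>x\<close> costs
      at most \<open>\<delta> * M + \<delta> = \<sigma>\<close> per unit length.\<close>
    define \<delta> where "\<delta> = \<sigma> / (1 + M)"
    have \<delta>: "0 < \<delta>" "\<delta> * (1 + M) = \<sigma>" using \<sigma> M by (auto simp: \<delta>_def)
    obtain d1 where d1: "d1 > 0" "\<And>u. u \<in> {c..e} \<Longrightarrow> dist u x < d1 \<Longrightarrow> dist (\<rho> u) (\<rho> x) < \<delta>"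
      using cl local \<delta>(1) unfolding continuous_on_iff by (metis atLeastAtMost_iff)
    obtain d2 where d2: "d2 > 0" "\<And>u. u \<in> {c..e} \<Longrightarrow> dist u x < d2 \<Longrightarrow> dist (G u) (G x) < \<delta>"
      using cG local \<delta>(1) unfolding continuous_on_iff by (metis atLeastAtMost_iff)
    \<comment> \<open>The last entry keeps the running defect on one piece, at most \<open>M\<close>
      times its length, below \<open>\<tau> / 2\<close>.\<close>
    define d where "d = min (min d1 d2) (\<tau> / (2 * (M + 1)))"
    have d: "0 < d" "d \<le> d1" "d \<le> d2" "M * d \<le> \<tau> / 2"
    proof -
      show "0 < d" "d \<le> d1" "d \<le> d2" using d1 d2 tau M by (auto simp: d_def)
      have "M * d \<le> M * (\<tau> / (2 * (M + 1)))" using M by (intro mult_left_mono) (auto simp: d_def)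
      also have "\<dots> \<le> \<tau> / 2" using M tau by (simp add: field_simps)
      finally show "M * d \<le> \<tau> / 2" .
    qed
    have "P p s" if *: "p \<le> x" "x \<le> s" "s - p < d" for p s
      unfolding P_def
    proof
      assume ps: "c \<le> p \<and> p \<le> s \<and> s \<le> e"
      define m where "m = p + \<rho> x * (s - p)"
      have lx: "0 \<le> \<rho> x" "\<rho> x \<le> 1" using l01[of x] local by auto
      have m: "p \<le> m" "m \<le> s"
        using lx * mult_right_mono[OF lx(2), of "s - p"] by (auto simp: m_def)
      define A where "A = {p..m}"
      have A: "A \<in> sets lebesgue" unfolding A_def by simp
      have near: "norm (\<rho> u - \<rho> x) \<le> \<delta>" "norm (G u - G x) \<le> \<delta>" if "u \<in> {p..s}" for u
      proof -
        have "\<bar>u - x\<bar> < d" using that * by auto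
        then have "dist u x < d1" "dist u x < d2" "u \<in> {c..e}" using d ps that by (auto simp: dist_real_def)
        then show "norm (\<rho> u - \<rho> x) \<le> \<delta>" "norm (G u - G x) \<le> \<delta>"
          using d1(2)[of u] d2(2)[of u] by (simp_all add: dist_norm less_imp_le)
      qed
      have z: "((\<lambda>u. (indicat_real A u - \<rho> x) *\<^sub>R G x) has_integral 0) {p..s}"
      proof -
        have "((\<lambda>u. indicat_real A u *\<^sub>R G x) has_integral (m - p) *\<^sub>R G x) {p..s}"
        proof -
          have "((\<lambda>u. G x) has_integral (m - p) *\<^sub>R G x) {p..m}"
            using has_integral_const_real[of "G x" p m] m by simp
          then have "((\<lambda>u. if u \<in> {p..m} then G x else 0) has_integral (m - p) *\<^sub>R G x) {p..s}"
            by (subst has_integral_restrict) (use m in auto)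
          then show ?thesis by (rule has_integral_eq[rotated]) (auto simp: A_def indicator_def)
        qed
        from has_integral_diff[OF this has_integral_const_real[of "\<rho> x *\<^sub>R G x" p s]]
        show ?thesis using * by (simp add: m_def scaleR_left_diff_distrib mult.commute)
      qed
      have "norm (I A p s) \<le> \<sigma> * (s - p)"
      proof (rule has_integral_bound_Icc)
        show "((\<lambda>u. (indicat_real A u - \<rho> u) *\<^sub>R G u - (indicat_real A u - \<rho> x) *\<^sub>R G x) has_integral I A p s) {p..s}"
          using has_integral_diff[OF integrable_integral[OF int[OF A]] z] ps by (auto simp: I_def)
        fix u assume u: "u \<in> {p..s}"
        have "(indicat_real A u - \<rho> u) *\<^sub>R G u - (indicat_real A u - \<rho> x) *\<^sub>R G x
            = (\<rho> x - \<rho> u) *\<^sub>R G u + (indicat_real A u - \<rho> x) *\<^sub>R (G u - G x)"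
          by (simp add: algebra_simps)
        also have "norm \<dots> \<le> \<bar>\<rho> x - \<rho> u\<bar> * norm (G u) + \<bar>indicat_real A u - \<rho> x\<bar> * norm (G u - G x)"
          by (rule norm_triangle_le) simp
        also have "\<dots> \<le> \<delta> * M + 1 * \<delta>"
        proof (intro add_mono mult_mono)
          show "\<bar>\<rho> x - \<rho> u\<bar> \<le> \<delta>" "norm (G u - G x) \<le> \<delta>" using near[of u] u by auto
          show "norm (G u) \<le> M" using M(2)[of u] u ps by auto
          show "\<bar>indicat_real A u - \<rho> x\<bar> \<le> 1" using lx by (auto simp: indicator_def)
        qed (use \<delta> in auto)
        also have "\<dots> = \<sigma>" using \<delta>(2) by (simp add: algebra_simps)
        finally show "norm ((indicat_real A u - \<rho> u) *\<^sub>R G u - (indicat_real A u - \<rho> x) *\<^sub>R G x) \<le> \<sigma>" .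
      qed (use \<sigma> * in auto)
      then have 1: "norm (I A p s) \<le> \<sigma> * (s - p)" using * by simp
      have 2: "norm (I A p t) \<le> \<sigma> * (t - p) + \<tau> / 2" if t: "t \<in> {p..s}" for t
      proof -
        have "norm (I A p t) \<le> M * (t - p)"
        proof (rule has_integral_bound_Icc)
          show "((\<lambda>u. (indicat_real A u - \<rho> u) *\<^sub>R G u) has_integral I A p t) {p..t}"
            unfolding I_def using t ps by (intro integrable_integral int[OF A]) auto
          fix u assume u: "u \<in> {p..t}"
          then have "u \<in> {c..e}" using t ps by auto
          then have "\<bar>indicat_real A u - \<rho> u\<bar> * norm (G u) \<le> 1 * M"
            using l01[of u] M by (intro mult_mono) (auto simp: indicator_def)
          then show "norm ((indicat_real A u - \<rho> u) *\<^sub>R G u) \<le> M" by simp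
        qed (use M t in auto)
        also have "\<dots> \<le> M * d" using t * M by (intro mult_left_mono) auto
        finally show ?thesis using d(4) \<sigma> t by (smt (verit) atLeastAtMost_iff mult_nonneg_nonneg)
      qed
      show "\<exists>A\<in>sets lebesgue. norm (I A p s) \<le> \<sigma> * (s - p) \<and> (\<forall>x\<in>{p..s}. norm (I A p x) \<le> \<sigma> * (x - p) + \<tau> / 2)"
        using A 1 2 by blast
    qed
    then show ?case using d(1) by blast
  qed
  then obtain A where A: "A \<in> sets lebesgue" "\<And>x. x \<in> {c..e} \<Longrightarrow> norm (I A c x) \<le> \<sigma> * (x - c) + \<tau> / 2"
    unfolding P_def using assms(1) by auto
  have half: "\<sigma> * (x - c) \<le> \<tau> / 2" if "x \<in> {c..e}" for x
  proof -
    have "\<sigma> * (x - c) \<le> \<sigma> * L" using that \<sigma> by (intro mult_left_mono) (auto simp: L_def)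
    also have "\<dots> = \<tau> / 2" using L by (simp add: \<sigma>_def)
    finally show ?thesis .
  qed
  show ?thesis
  proof (intro bexI[OF _ A(1)] ballI)
    fix x assume "x \<in> {c..e}"
    from A(2)[OF this] half[OF this]
    show "norm (integral {c..x} (\<lambda>u. (indicat_real A u - \<rho> u) *\<^sub>R G u)) \<le> \<tau>"
      unfolding I_def by linarith
  qed
qed

text \<open>A measurable function is an almost everywhere limit of continuous ones. Clipping these
  to \<open>[-A,A]\<close> and multiplying by a plateau \<open>\<kappa>\<close> preserves the limit
  \<open>f\<close>, and dominated convergence gives the \<open>L1\<close> estimate. A moving average
  then makes the approximant \<open>C1\<close> without increasing the sup bound.\<close>

lemma C1_approximation_L1:
  fixes f :: "real \<Rightarrow> real"
  assumes f: "f \<in> borel_measurable lebesgue" and A: "\<And>x. \<bar>f x\<bar> \<le> A"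
    and supp: "\<And>x. x \<notin> {c..e} \<Longrightarrow> f x = 0" and ord: "c1 < c" "c \<le> e" "e < e1" and tau: "0 < \<tau>"
  shows "\<exists>g. C1_from c1 g \<and> (\<forall>x\<ge>e1. g x = 0) \<and> (\<forall>x. \<bar>g x\<bar> \<le> A) \<and> integral {c1..e1} (\<lambda>x. \<bar>g x - f x\<bar>) \<le> \<tau>"
proof -
  have A0: "0 \<le> A" using A[of 0] by linarith
  define c2 where "c2 = (c1 + c) / 2"
  define e2 where "e2 = (e + e1) / 2"
  have ce: "c1 < c2" "c2 < c" "e < e2" "e2 < e1" using ord by (auto simp: c2_def e2_def)
  define \<kappa> where "\<kappa> x = max 0 (min 1 (min ((x - c2) / (c - c2)) ((e2 - x) / (e2 - e))))" for x
  have ck: "continuous_on UNIV \<kappa>" unfolding \<kappa>_def using ce by (intro continuous_intros) auto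
  have k1: "\<kappa> x = 1" if "x \<in> {c..e}" for x
    using that ce by (auto simp: \<kappa>_def min_def max_def field_simps)
  have k0: "\<kappa> x = 0" if "x \<le> c2 \<or> e2 \<le> x" for x
  proof -
    have "(x - c2) / (c - c2) \<le> 0 \<or> (e2 - x) / (e2 - e) \<le> 0"
      using that ce by (auto simp: divide_nonpos_pos)
    then show ?thesis by (auto simp: \<kappa>_def min_le_iff_disj max_absorb1)
  qed
  have k: "0 \<le> \<kappa> x" "\<kappa> x \<le> 1" for x by (auto simp: \<kappa>_def)
  obtain N g where N: "negligible N" and g: "\<And>n. continuous_on UNIV (g n)"
      and lim: "\<And>x. x \<notin> N \<Longrightarrow> (\<lambda>n. g n x) \<longlonglongrightarrow> f x"
    using lebesgue_measurable_imp_measurable_on[OF f, of UNIV] unfolding measurable_on_def by auto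
  define H where "H n x = \<kappa> x * max (- A) (min A (g n x))" for n x
  have cH: "continuous_on S (H n)" for n S
  proof -
    have "continuous_on UNIV (H n)" unfolding H_def by (intro continuous_intros ck g)
    then show ?thesis by (rule continuous_on_subset) auto
  qed
  have HA: "\<bar>H n x\<bar> \<le> A" for n x
  proof -
    have "\<bar>\<kappa> x\<bar> * \<bar>max (- A) (min A (g n x))\<bar> \<le> 1 * A"
      using k[of x] A0 by (intro mult_mono) auto
    then show ?thesis by (simp add: H_def abs_mult)
  qed
  have H0: "H n x = 0" if "x \<le> c2 \<or> e2 \<le> x" for n x using k0[OF that] by (simp add: H_def)
  have limH: "(\<lambda>n. H n x) \<longlonglongrightarrow> f x" if "x \<notin> N" for x
  proof -
    have "(\<lambda>n. H n x) \<longlonglongrightarrow> \<kappa> x * max (- A) (min A (f x))"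
      unfolding H_def by (intro tendsto_intros lim that)
    moreover have "max (- A) (min A (f x)) = f x" using A[of x] by auto
    moreover have "\<kappa> x * f x = f x" using k1[of x] supp[of x] by (cases "x \<in> {c..e}") auto
    ultimately show ?thesis by simp
  qed
  have fi: "f absolutely_integrable_on {c1..e1}"
  proof (rule measurable_bounded_by_integrable_imp_absolutely_integrable)
    show "(\<lambda>_. A) integrable_on {c1..e1}" by (rule integrable_continuous_real[OF continuous_on_const])
  qed (use f A in \<open>auto intro: measurable_restrict_space1\<close>)
  have Hi: "H n absolutely_integrable_on {c1..e1}" for n by (rule absolutely_integrable_continuous_real[OF cH])
  \<comment> \<open>Dominated convergence is applied where convergence holds at every point, so the
    null set is removed from the domain.\<close>
  define S where "S = {c1..e1} - N"
  have ns: "negligible (S - {c1..e1} \<union> ({c1..e1} - S))"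
    using N by (auto simp: S_def intro: negligible_subset)
  have conv: "(\<lambda>n. integral S (\<lambda>x. \<bar>H n x - f x\<bar>)) \<longlonglongrightarrow> integral S (\<lambda>x. 0)"
  proof (rule dominated_convergence(2)[where h = "\<lambda>_. 2 * A"])
    fix n
    have "(\<lambda>x. \<bar>H n x - f x\<bar>) integrable_on {c1..e1}"
      using absolutely_integrable_norm[OF set_integral_diff(1)[OF Hi fi]] set_lebesgue_integral_eq_integral(1)
      by (force simp: o_def)
    then show "(\<lambda>x. \<bar>H n x - f x\<bar>) integrable_on S"
      by (rule integrable_spike_set) (auto simp: S_def intro: negligible_subset[OF N])
    fix x
    show "norm \<bar>H n x - f x\<bar> \<le> 2 * A" using HA[of n x] A[of x] by simp
  next
    have "(\<lambda>_. 2 * A) integrable_on {c1..e1}" by (rule integrable_continuous_real[OF continuous_on_const])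
    then show "(\<lambda>_. 2 * A) integrable_on S"
      by (rule integrable_spike_set) (auto simp: S_def intro: negligible_subset[OF N])
    fix x assume "x \<in> S"
    then have "(\<lambda>n. \<bar>H n x - f x\<bar>) \<longlonglongrightarrow> \<bar>f x - f x\<bar>"
      by (intro tendsto_intros limH) (auto simp: S_def)
    then show "(\<lambda>n. \<bar>H n x - f x\<bar>) \<longlonglongrightarrow> 0" by simp
  qed
  have "integral S (\<lambda>x. \<bar>H n x - f x\<bar>) = integral {c1..e1} (\<lambda>x. \<bar>H n x - f x\<bar>)" for n
    by (rule integral_spike_set) (auto simp: S_def intro: negligible_subset[OF N])
  with conv have "(\<lambda>n. integral {c1..e1} (\<lambda>x. \<bar>H n x - f x\<bar>)) \<longlonglongrightarrow> 0" by simp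
  then have "\<forall>\<^sub>F n in sequentially. integral {c1..e1} (\<lambda>x. \<bar>H n x - f x\<bar>) < \<tau> / 2"
    using tau by (intro order_tendstoD) auto
  then obtain n where n: "integral {c1..e1} (\<lambda>x. \<bar>H n x - f x\<bar>) < \<tau> / 2"
    by (auto simp: eventually_sequentially)
  define h0 where "h0 = H n"
  define P where "P x = integral {c2..x} h0" for x
  have P: "C1_from c2 P" "deriv P = h0"
    using C1_from_integral[of h0 c2] cH H0 unfolding P_def h0_def by auto
  have dP: "(P has_real_derivative h0 x) (at x)" for x using C1_fromD(1)[OF P(1)] P(2) by simp
  have ch: "continuous_on S h0" for S unfolding h0_def by (rule cH)
  define L where "L = e1 - c1"
  have L: "0 < L" using ord by (simp add: L_def)
  define \<sigma> where "\<sigma> = \<tau> / (2 * L)"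
  have sig: "0 < \<sigma>" using tau L by (simp add: \<sigma>_def)
  have "uniformly_continuous_on {c1..e1 + 1} h0" by (rule compact_uniformly_continuous[OF ch]) auto
  then obtain d where d: "d > 0" "\<And>x x'. x \<in> {c1..e1 + 1} \<Longrightarrow> x' \<in> {c1..e1 + 1} \<Longrightarrow> dist x' x < d \<Longrightarrow> dist (h0 x') (h0 x) < \<sigma>"
    using sig unfolding uniformly_continuous_on_def by metis
  \<comment> \<open>The forward average spreads the support to the left by \<open>h\<close>, hence
    \<open>h \<le> c2 - c1\<close>; \<open>h < d\<close> makes the average uniformly close to
    \<open>h0\<close>.\<close>
  define h where "h = min (d / 2) (min 1 (c2 - c1))"
  have h: "0 < h" "h < d" "h \<le> 1" "h \<le> c2 - c1" using d ce by (auto simp: h_def)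
  have hi: "(h0 has_integral P (x + h) - P x) {x..x + h}" for x
    using h dP by (intro fundamental_theorem_of_calculus)
      (auto simp: has_real_derivative_iff_has_vector_derivative[symmetric] intro: has_field_derivative_at_within)
  define G where "G x = (P (x + h) - P x) / h" for x
  have dG: "(G has_real_derivative (h0 (x + h) - h0 x) / h) (at x)" for x
  proof -
    have "((\<lambda>x. P (x + h)) has_real_derivative h0 (x + h)) (at x)"
      using dP[of "x + h"] by (simp add: DERIV_shift)
    then show ?thesis unfolding G_def by (intro DERIV_cdivide DERIV_diff dP)
  qed
  have cdG: "continuous_on UNIV (\<lambda>x. (h0 (x + h) - h0 x) / h)"
  proof -
    have "continuous_on UNIV (\<lambda>x. h0 (x + h))"
      by (rule continuous_on_compose2[OF ch[of UNIV]]) (auto intro: continuous_intros)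
    then show ?thesis using h by (intro continuous_intros ch) auto
  qed
  have "C1_from c1 G"
    by (rule C1_fromI(1)[OF dG cdG]) (use h C1_fromD(3)[OF P(1)] ce in \<open>auto simp: G_def\<close>)
  moreover have "G x = 0" if "e1 \<le> x" for x
  proof -
    have "(h0 has_integral 0) {x..x + h}"
      by (rule has_integral_is_0) (use H0 that ce in \<open>auto simp: h0_def\<close>)
    then have "P (x + h) - P x = 0" using hi[of x] has_integral_unique by blast
    then show ?thesis by (simp add: G_def)
  qed
  moreover have "\<bar>G x\<bar> \<le> A" for x
  proof -
    have "norm (P (x + h) - P x) \<le> A * (x + h - x)"
      by (rule has_integral_bound_Icc[OF A0 _ hi]) (use HA h in \<open>auto simp: h0_def\<close>)
    then show ?thesis using h by (simp add: G_def field_simps)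
  qed
  moreover have "integral {c1..e1} (\<lambda>x. \<bar>G x - f x\<bar>) \<le> \<tau>"
  proof -
    have cG: "continuous_on {c1..e1} G" using dG by (auto intro!: continuous_at_imp_continuous_on DERIV_isCont)
    have b: "\<bar>G x - h0 x\<bar> \<le> \<sigma>" if x: "x \<in> {c1..e1}" for x
    proof -
      have "norm (P (x + h) - P x - h * h0 x) \<le> \<sigma> * (x + h - x)"
      proof (rule has_integral_bound_Icc)
        show "((\<lambda>u. h0 u - h0 x) has_integral P (x + h) - P x - h * h0 x) {x..x + h}"
          using has_integral_diff[OF hi has_integral_const_real[of "h0 x" x "x + h"]] h by simp
        fix u assume u: "u \<in> {x..x + h}"
        have "dist (h0 u) (h0 x) < \<sigma>"
          by (rule d(2)) (use u x h in \<open>auto simp: dist_real_def\<close>)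
        then show "norm (h0 u - h0 x) \<le> \<sigma>" by (simp add: dist_norm)
      qed (use sig h in auto)
      then have "\<bar>P (x + h) - P x - h * h0 x\<bar> \<le> \<sigma> * h" using h by simp
      moreover have "P (x + h) - P x - h * h0 x = h * (G x - h0 x)"
        using h nonzero_mult_div_cancel_left[of h "P (x + h) - P x"] unfolding G_def right_diff_distrib[of h _ "h0 x"] by simp
      ultimately show ?thesis using h by (simp add: abs_mult)
    qed
    have Gi: "G absolutely_integrable_on {c1..e1}" by (rule absolutely_integrable_continuous_real[OF cG])
    have i1: "(\<lambda>x. \<bar>G x - f x\<bar>) integrable_on {c1..e1}"
      using absolutely_integrable_norm[OF set_integral_diff(1)[OF Gi fi]] set_lebesgue_integral_eq_integral(1)
      by (force simp: o_def)
    have i2: "(\<lambda>x. \<bar>H n x - f x\<bar>) integrable_on {c1..e1}"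
      using absolutely_integrable_norm[OF set_integral_diff(1)[OF Hi fi]] set_lebesgue_integral_eq_integral(1)
      by (force simp: o_def)
    have "integral {c1..e1} (\<lambda>x. \<bar>G x - f x\<bar>) \<le> integral {c1..e1} (\<lambda>x. \<sigma> + \<bar>H n x - f x\<bar>)"
    proof (rule integral_le[OF i1])
      fix x assume "x \<in> {c1..e1}"
      then show "\<bar>G x - f x\<bar> \<le> \<sigma> + \<bar>H n x - f x\<bar>" using b[of x] by (simp add: h0_def)
    qed (use i2 in \<open>auto intro: integrable_add\<close>)
    also have "\<dots> = \<sigma> * (e1 - c1) + integral {c1..e1} (\<lambda>x. \<bar>H n x - f x\<bar>)"
      using i2 ord by (subst integral_add) auto
    also have "\<sigma> * (e1 - c1) = \<tau> / 2" using L by (simp add: \<sigma>_def flip: L_def)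
    finally show ?thesis using n by simp
  qed
  ultimately show ?thesis by blast
qed

text \<open>\<open>weak_chatter\<close> is applied to the pair \<open>(q, K)\<close>. The first
  component gives \<open>(1_A - \<rho>) * q\<close> a small primitive; the second says that
  \<open>A\<close> weighs the cost \<open>K\<close> as the density \<open>\<rho> \<le> p\<close>
  does. Smoothing in \<open>L1\<close> keeps the primitive small, and the bound \<open>Q\<close>
  persists because \<open>|1_A - \<rho>| \<le> 1\<close>.\<close>

lemma chatter:
  fixes \<rho> q K :: "real \<Rightarrow> real"
  assumes ord: "c1 < c" "c \<le> e" "e < e1" and tau: "0 < \<tau>"
    and cont: "continuous_on {c..e} \<rho>" "continuous_on {c..e} q" "continuous_on {c..e} K"
    and rho: "\<And>x. x \<in> {c..e} \<Longrightarrow> 0 \<le> \<rho> x \<and> \<rho> x \<le> p" and p: "p \<le> 1"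
    and K0: "\<And>x. x \<in> {c..e} \<Longrightarrow> 0 \<le> K x" and Q: "\<And>x. x \<in> {c..e} \<Longrightarrow> \<bar>q x\<bar> \<le> Q"
  shows "\<exists>A f. A \<in> sets lebesgue \<and> C1_from c1 f \<and> (\<forall>x\<ge>e1. f x = 0) \<and> (\<forall>x. \<bar>f x\<bar> \<le> Q) \<and>
    (\<forall>x\<ge>c1. \<bar>integral {c1..x} f\<bar> \<le> \<tau>) \<and>
    (\<lambda>x. \<bar>f x - (if x \<in> {c..e} then (indicat_real A x - \<rho> x) * q x else 0)\<bar>) integrable_on {c1..e1} \<and>
    integral {c1..e1} (\<lambda>x. \<bar>f x - (if x \<in> {c..e} then (indicat_real A x - \<rho> x) * q x else 0)\<bar>) \<le> \<tau> \<and>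
    integral {c..e} (\<lambda>x. indicat_real A x * K x) \<le> p * integral {c..e} K + \<tau>"
proof -
  have Q0: "0 \<le> Q" using Q[of c] ord by auto
  obtain A where A: "A \<in> sets lebesgue"
    "\<And>x. x \<in> {c..e} \<Longrightarrow> norm (integral {c..x} (\<lambda>u. (indicat_real A u - \<rho> u) *\<^sub>R (q u, K u))) \<le> \<tau> / 2"
    using weak_chatter[of c e \<rho> "\<lambda>u. (q u, K u)" "\<tau> / 2"] ord tau cont rho p
    by (force intro!: continuous_intros)
  have int: "(\<lambda>u. (indicat_real A u - \<rho> u) *\<^sub>R G u) absolutely_integrable_on {c..x}"
    if "x \<in> {c..e}" "continuous_on {c..e} G" for x and G :: "real \<Rightarrow> 'b::euclidean_space"
  proof -
    have "continuous_on {c..x} \<rho>" "continuous_on {c..x} G"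
      using that cont by (auto intro: continuous_on_subset)
    then show ?thesis unfolding scaleR_left_diff_distrib
      by (intro set_integral_diff(1) indicator_mult_integrable A absolutely_integrable_continuous_real continuous_intros)
  qed
  have nfst: "\<bar>fst Z\<bar> \<le> norm Z" and nsnd: "\<bar>snd Z\<bar> \<le> norm Z" for Z :: "real \<times> real"
    using norm_fst_le[of "fst Z" "snd Z"] norm_snd_le[of "snd Z" "fst Z"] by simp_all
  have fstb: "\<bar>integral {c..x} (\<lambda>u. (indicat_real A u - \<rho> u) * q u)\<bar> \<le> \<tau> / 2"
    and sndb: "\<bar>integral {c..x} (\<lambda>u. (indicat_real A u - \<rho> u) * K u)\<bar> \<le> \<tau> / 2" if x: "x \<in> {c..e}" for x
  proof -
    have i: "(\<lambda>u. (indicat_real A u - \<rho> u) *\<^sub>R (q u, K u)) integrable_on {c..x}"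
      by (rule set_lebesgue_integral_eq_integral(1)[OF int[OF x]]) (intro continuous_intros cont)
    have "integral {c..x} (\<lambda>u. (indicat_real A u - \<rho> u) * q u) = fst (integral {c..x} (\<lambda>u. (indicat_real A u - \<rho> u) *\<^sub>R (q u, K u)))"
      using integral_linear[OF i bounded_linear_fst] by (simp add: o_def)
    then show "\<bar>integral {c..x} (\<lambda>u. (indicat_real A u - \<rho> u) * q u)\<bar> \<le> \<tau> / 2"
      using A(2)[OF x] nfst[of "integral {c..x} (\<lambda>u. (indicat_real A u - \<rho> u) *\<^sub>R (q u, K u))"] by simp
    have "integral {c..x} (\<lambda>u. (indicat_real A u - \<rho> u) * K u) = snd (integral {c..x} (\<lambda>u. (indicat_real A u - \<rho> u) *\<^sub>R (q u, K u)))"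
      using integral_linear[OF i bounded_linear_snd] by (simp add: o_def)
    then show "\<bar>integral {c..x} (\<lambda>u. (indicat_real A u - \<rho> u) * K u)\<bar> \<le> \<tau> / 2"
      using A(2)[OF x] nsnd[of "integral {c..x} (\<lambda>u. (indicat_real A u - \<rho> u) *\<^sub>R (q u, K u))"] by simp
  qed
  define fs where "fs x = (if x \<in> {c..e} then (indicat_real A x - \<rho> x) * q x else 0)" for x
  have e_in: "e \<in> {c..e}" using ord by simp
  have fse: "fs = (\<lambda>x. indicat_real {c..e} x *\<^sub>R ((indicat_real A x - \<rho> x) * q x))"
    by (auto simp: fs_def indicator_def)
  have "integrable lebesgue fs"
    unfolding fse using int[OF e_in cont(2)] by (simp add: set_integrable_def)
  then have fsm: "fs \<in> borel_measurable lebesgue" by (rule borel_measurable_integrable)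
  have fsQ: "\<bar>fs x\<bar> \<le> Q" for x
  proof (cases "x \<in> {c..e}")
    case True
    then have "\<bar>indicat_real A x - \<rho> x\<bar> * \<bar>q x\<bar> \<le> 1 * Q"
      using rho[OF True] p Q[OF True] by (intro mult_mono) (auto simp: indicator_def)
    then show ?thesis using True by (simp add: fs_def abs_mult)
  qed (use Q0 in \<open>auto simp: fs_def\<close>)
  obtain f where f: "C1_from c1 f" "\<And>x. e1 \<le> x \<Longrightarrow> f x = 0" "\<And>x. \<bar>f x\<bar> \<le> Q"
      "integral {c1..e1} (\<lambda>x. \<bar>f x - fs x\<bar>) \<le> \<tau> / 2"
  proof -
    have "fs x = 0" if "x \<notin> {c..e}" for x using that by (auto simp: fs_def)
    from C1_approximation_L1[OF fsm fsQ this ord half_gt_zero[OF tau]] show ?thesis using that by blast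
  qed
  have cf: "continuous_on S f" for S using C1_fromD(4)[OF f(1)] .
  have fsa: "fs absolutely_integrable_on {c1..t}" for t
  proof (rule measurable_bounded_by_integrable_imp_absolutely_integrable)
    show "(\<lambda>_. Q) integrable_on {c1..t}" by (rule integrable_continuous_real[OF continuous_on_const])
  qed (use fsm fsQ in \<open>auto intro: measurable_restrict_space1\<close>)
  have ia: "(\<lambda>x. f x - fs x) absolutely_integrable_on {c1..t}" for t
    by (rule set_integral_diff(1)[OF absolutely_integrable_continuous_real[OF cf] fsa])
  have ii: "(\<lambda>x. f x - fs x) integrable_on {c1..t}" "(\<lambda>x. \<bar>f x - fs x\<bar>) integrable_on {c1..t}" for t
    using set_lebesgue_integral_eq_integral(1)[OF ia] set_lebesgue_integral_eq_integral(1)[OF absolutely_integrable_norm[OF ia]]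
    by (simp_all add: o_def)
  have prim: "\<bar>integral {c1..x} f\<bar> \<le> \<tau>" if x: "c1 \<le> x" "x \<le> e1" for x
  proof -
    have "integral {c1..x} f = integral {c1..x} (\<lambda>x. f x - fs x) + integral {c1..x} fs"
      using integral_add[OF ii(1) set_lebesgue_integral_eq_integral(1)[OF fsa], of x] by simp
    moreover have "\<bar>integral {c1..x} (\<lambda>x. f x - fs x)\<bar> \<le> \<tau> / 2"
    proof -
      have "norm (integral {c1..x} (\<lambda>x. f x - fs x)) \<le> integral {c1..x} (\<lambda>x. \<bar>f x - fs x\<bar>)"
        by (rule integral_norm_bound_integral[OF ii]) auto
      also have "\<dots> \<le> integral {c1..e1} (\<lambda>x. \<bar>f x - fs x\<bar>)"
        using x by (intro integral_subset_le ii) auto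
      finally show ?thesis using f(4) by simp
    qed
    moreover have "\<bar>integral {c1..x} fs\<bar> \<le> \<tau> / 2"
    proof -
      have "integral {c1..x} fs = integral ({c1..x} \<inter> {c..e}) (\<lambda>u. (indicat_real A u - \<rho> u) * q u)"
        unfolding fs_def using integral_restrict_Int[of "{c1..x}" "{c..e}"] by (simp add: Int_commute)
      also have "{c1..x} \<inter> {c..e} = {c..min x e}" using ord by auto
      finally show ?thesis using fstb[of "min x e"] tau by (cases "c \<le> min x e") auto
    qed
    ultimately show ?thesis by linarith
  qed
  have prim': "\<bar>integral {c1..x} f\<bar> \<le> \<tau>" if x: "c1 \<le> x" for x
  proof (cases "x \<le> e1")
    case False
    have "integral {e1..x} f = 0" using integral_cong[of "{e1..x}" f "\<lambda>_. 0"] f(2) by simp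
    then have "integral {c1..x} f = integral {c1..e1} f"
      using Henstock_Kurzweil_Integration.integral_combine[OF _ _ integrable_continuous_real[OF cf], of c1 e1 x] False ord by simp
    then show ?thesis using prim[of e1] ord by simp
  qed (use prim x in auto)
  have cost: "integral {c..e} (\<lambda>x. indicat_real A x * K x) \<le> p * integral {c..e} K + \<tau>"
  proof -
    have i1: "(\<lambda>u. (indicat_real A u - \<rho> u) * K u) integrable_on {c..e}"
      using set_lebesgue_integral_eq_integral(1)[OF int[OF e_in cont(3)]] by simp
    have i2: "(\<lambda>u. \<rho> u * K u) integrable_on {c..e}" "(\<lambda>u. p * K u) integrable_on {c..e}"
      by (intro integrable_continuous_real continuous_intros cont)+
    have "integral {c..e} (\<lambda>x. indicat_real A x * K x)
        = integral {c..e} (\<lambda>u. (indicat_real A u - \<rho> u) * K u) + integral {c..e} (\<lambda>u. \<rho> u * K u)"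
      using integral_add[OF i1 i2(1)] by (simp add: algebra_simps)
    moreover have "integral {c..e} (\<lambda>u. \<rho> u * K u) \<le> integral {c..e} (\<lambda>u. p * K u)"
      using rho K0 by (intro integral_le i2 mult_right_mono) auto
    ultimately show ?thesis using sndb[OF e_in] tau by (simp add: abs_le_iff)
  qed
  show ?thesis
    by (intro exI[of _ A] exI[of _ f] conjI allI impI A(1) f(1-3) prim' cost ii(2)[unfolded fs_def])
      (use f(4)[unfolded fs_def] tau in auto)
qed

lemma integral_le_open:
  fixes f g :: "real \<Rightarrow> real"
  assumes "f integrable_on {p..q}" "g integrable_on {p..q}" "\<And>x. p < x \<Longrightarrow> x < q \<Longrightarrow> f x \<le> g x"
  shows "integral {p..q} f \<le> integral {p..q} g"
proof -
  have "integral {p<..<q} f \<le> integral {p<..<q} g"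
    using assms by (intro integral_le) (auto simp: integrable_on_Icc_iff_Ioo)
  then show ?thesis by (simp add: integral_open_interval_real)
qed

text \<open>\<open>\<zeta> = J^\<alpha> f\<close> has Caputo derivative \<open>f\<close> and is
  uniformly small, since the primitive of \<open>f\<close> is, but it does not vanish near
  \<open>b\<close>. It is cut off beyond the support of \<open>f\<close>, where
  \<open>\<zeta>\<close> and its derivative are both small, so that the correction has a small
  Caputo derivative.\<close>

lemma chatter_perturbation:
  fixes \<rho> q K :: "real \<Rightarrow> real"
  assumes \<alpha>: "0 < \<alpha>" "\<alpha> < 1" and ord: "a < c" "c \<le> e" "e < e2" "e2 < b" and sig: "0 < \<sigma>"
    and cont: "continuous_on {c..e} \<rho>" "continuous_on {c..e} q" "continuous_on {c..e} K"
    and rho: "\<And>x. x \<in> {c..e} \<Longrightarrow> 0 \<le> \<rho> x \<and> \<rho> x \<le> p" and p: "p \<le> 1"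
    and K0: "\<And>x. x \<in> {c..e} \<Longrightarrow> 0 \<le> K x" and Q: "\<And>x. x \<in> {c..e} \<Longrightarrow> \<bar>q x\<bar> \<le> Q"
  shows "\<exists>A f \<xi>. A \<in> sets lebesgue \<and> C1_from a \<xi> \<and> (\<forall>x\<ge>e2. \<xi> x = 0) \<and> (\<forall>x\<in>{a..b}. \<bar>\<xi> x\<bar> \<le> \<sigma>) \<and>
    (\<forall>x\<ge>e2. f x = 0) \<and> (\<forall>x. \<bar>f x\<bar> \<le> Q) \<and> (\<forall>x\<in>{a..b}. \<bar>caputo_left a \<alpha> \<xi> x - f x\<bar> \<le> \<sigma>) \<and>
    (\<lambda>x. \<bar>f x - (if x \<in> {c..e} then (indicat_real A x - \<rho> x) * q x else 0)\<bar>) integrable_on {a..e2} \<and>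
    integral {a..e2} (\<lambda>x. \<bar>f x - (if x \<in> {c..e} then (indicat_real A x - \<rho> x) * q x else 0)\<bar>) \<le> \<sigma> \<and>
    integral {c..e} (\<lambda>x. indicat_real A x * K x) \<le> p * integral {c..e} K + \<sigma>"
proof -
  have G: "0 < Gamma \<alpha>" "0 < Gamma (1 - \<alpha>)" using \<alpha> by (auto intro: Gamma_real_pos)
  have Q0: "0 \<le> Q" using Q[of c] ord by auto
  define c1 where "c1 = (a + c) / 2"
  \<comment> \<open>Three equal parts of \<open>[e,e2]\<close>: \<open>f\<close> dies out in the
    first, the second is the distance that keeps the kernel regular, the cutoff takes place in the
    third.\<close>
  define g where "g = (e2 - e) / 3"
  define e1 where "e1 = e + g"
  define e1' where "e1' = e + 2 * g"
  have g: "0 < g" using ord by (simp add: g_def)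
  have pts: "a < c1" "c1 < c" "e < e1" "e1 + g = e1'" "e1' < e2" "a \<le> e1" "e2 - e1' = g"
  proof -
    have "e2 = e + 3 * g" by (simp add: g_def field_simps)
    then show "a < c1" "c1 < c" "e < e1" "e1 + g = e1'" "e1' < e2" "a \<le> e1" "e2 - e1' = g"
      using ord g by (auto simp: c1_def e1_def e1'_def)
  qed
  obtain \<mu> \<mu>' where mu: "\<forall>x. (\<mu> has_real_derivative \<mu>' x) (at x)" "continuous_on UNIV \<mu>'"
    "\<forall>x\<le>e1'. \<mu> x = 0" "\<forall>x\<ge>e2. \<mu> x = 1"
    "\<forall>x. 0 \<le> \<mu> x" "\<forall>x. \<mu> x \<le> 1" "\<forall>x. \<bar>\<mu>' x\<bar> \<le> 2 / (e2 - e1')"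
    using smooth_step[OF pts(5)] by blast
  note \<mu> = mu(1)[rule_format] mu(2) mu(3-7)[rule_format]
  \<comment> \<open>If \<open>|\<zeta>|\<close> and \<open>|\<zeta>'|\<close> are at most
    \<open>s\<close>, then \<open>(2 / g + 1) * s\<close> bounds the derivative of the correction,
    and hence \<open>s * C\<close> its Caputo derivative.\<close>
  define C where "C = (2 / g + 1) * ((b - a) powr (1 - \<alpha>) / ((1 - \<alpha>) * Gamma (1 - \<alpha>)))"
  have C: "0 \<le> C" using g \<alpha> G by (simp add: C_def)
  define s where "s = \<sigma> / (C + 1)"
  have s: "0 < s" "s \<le> \<sigma>" "s * C \<le> \<sigma>" using C sig by (auto simp: s_def field_simps)
  \<comment> \<open>\<open>r\<close> solves \<open>r powr \<alpha> = X\<close>, which makes the near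
    part \<open>Q * r powr \<alpha> / \<alpha>\<close> at most half of
    \<open>s * Gamma \<alpha>\<close>. Only afterwards is \<open>\<tau>\<close> chosen, depending on
    \<open>r\<close>, to handle the far part and the derivative.\<close>
  define X where "X = s * \<alpha> * Gamma \<alpha> / (2 * (Q + 1))"
  define r where "r = X powr (1 / \<alpha>)"
  have rb: "0 < X"
    unfolding X_def using s(1) \<alpha>(1) G(1) Q0 by (intro divide_pos_pos mult_pos_pos) auto
  then have r: "0 < r" unfolding r_def by simp
  have ra: "r powr \<alpha> = X" using rb \<alpha>(1) by (simp add: r_def powr_powr)
  define \<tau> where "\<tau> = min \<sigma> (min (s * Gamma \<alpha> / (6 * r powr (\<alpha> - 1))) (s * Gamma \<alpha> / (3 * ((1 - \<alpha>) * g powr (\<alpha> - 2)))))"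
  have tau: "0 < \<tau>"
    unfolding \<tau>_def min_less_iff_conj using sig s(1) G(1) r g \<alpha> by (intro conjI divide_pos_pos mult_pos_pos) auto
  have t1: "\<tau> \<le> \<sigma>" by (simp add: \<tau>_def)
  have t2: "3 * \<tau> * r powr (\<alpha> - 1) \<le> s * Gamma \<alpha> / 2"
  proof -
    have "\<tau> \<le> s * Gamma \<alpha> / (6 * r powr (\<alpha> - 1))" by (simp add: \<tau>_def)
    then show ?thesis using r by (simp add: pos_le_divide_eq mult_ac)
  qed
  have t3: "3 * \<tau> * ((1 - \<alpha>) * g powr (\<alpha> - 2)) \<le> s * Gamma \<alpha>"
  proof -
    have "\<tau> \<le> s * Gamma \<alpha> / (3 * ((1 - \<alpha>) * g powr (\<alpha> - 2)))" by (simp add: \<tau>_def)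
    moreover have "0 < 3 * ((1 - \<alpha>) * g powr (\<alpha> - 2))" using g \<alpha> by simp
    ultimately have "\<tau> * (3 * ((1 - \<alpha>) * g powr (\<alpha> - 2))) \<le> s * Gamma \<alpha>" by (simp only: pos_le_divide_eq)
    then show ?thesis by (simp only: mult_ac)
  qed
  obtain A f where A: "A \<in> sets lebesgue" and f: "C1_from c1 f" "\<forall>x\<ge>e1. f x = 0" "\<forall>x. \<bar>f x\<bar> \<le> Q"
      "\<forall>x\<ge>c1. \<bar>integral {c1..x} f\<bar> \<le> \<tau>"
    and fi: "(\<lambda>x. \<bar>f x - (if x \<in> {c..e} then (indicat_real A x - \<rho> x) * q x else 0)\<bar>) integrable_on {c1..e1}"
      "integral {c1..e1} (\<lambda>x. \<bar>f x - (if x \<in> {c..e} then (indicat_real A x - \<rho> x) * q x else 0)\<bar>) \<le> \<tau>"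
    and cost: "integral {c..e} (\<lambda>x. indicat_real A x * K x) \<le> p * integral {c..e} K + \<tau>"
    using chatter[OF pts(2) ord(2) pts(3) tau cont rho p K0 Q] by blast
  have fa: "C1_from a f" using C1_from_antimono[OF f(1)] pts by simp
  have cf: "continuous_on S f" for S using C1_fromD(4)[OF f(1)] .
  have prim: "\<bar>integral {a..x} f\<bar> \<le> \<tau>" if "a \<le> x" for x
  proof -
    have z: "integral {a..t} f = 0" if "t \<le> c1" for t
      using integral_cong[of "{a..t}" f "\<lambda>_. 0"] C1_fromD(3)[OF f(1)] that by simp
    show ?thesis
    proof (cases "c1 \<le> x")
      case True
      then have "integral {a..x} f = integral {c1..x} f"
        using Henstock_Kurzweil_Integration.integral_combine[OF _ True integrable_continuous_real[OF cf], of a] pts z[of c1] by simp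
      then show ?thesis using f(4) True by simp
    qed (use z tau in auto)
  qed
  define \<zeta> where "\<zeta> = RL_left a \<alpha> f"
  have \<zeta>: "C1_from a \<zeta>" "deriv \<zeta> = RL_left a \<alpha> (deriv f)"
    unfolding \<zeta>_def by (rule C1_from_RL_left[OF \<alpha> fa])+
  have z1: "\<bar>\<zeta> x\<bar> \<le> s" if "a \<le> x" for x
  proof -
    have "\<bar>\<zeta> x\<bar> \<le> (3 * \<tau> * r powr (\<alpha> - 1) + Q * (r powr \<alpha> / \<alpha>)) / Gamma \<alpha>"
      unfolding \<zeta>_def using f(3) prim by (intro RL_left_small \<alpha> fa that r) auto
    also have "\<dots> \<le> (s * Gamma \<alpha> / 2 + s * Gamma \<alpha> / 2) / Gamma \<alpha>"
    proof (intro divide_right_mono add_mono t2)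
      have "Q * (r powr \<alpha> / \<alpha>) = s * Gamma \<alpha> / 2 * (Q / (Q + 1))"
        unfolding ra X_def using \<alpha>(1) by (simp add: times_divide_times_eq mult_ac del: distrib_left_numeral)
      also have "\<dots> \<le> s * Gamma \<alpha> / 2 * 1" using s G Q0 by (intro mult_left_mono) auto
      finally show "Q * (r powr \<alpha> / \<alpha>) \<le> s * Gamma \<alpha> / 2" by simp
    qed (use G in auto)
    finally show ?thesis using G by simp
  qed
  have z2: "\<bar>deriv \<zeta> x\<bar> \<le> s" if "e1' \<le> x" for x
  proof -
    have "\<bar>deriv \<zeta> x\<bar> \<le> 3 * \<tau> * ((1 - \<alpha>) * g powr (\<alpha> - 2)) / Gamma \<alpha>"
      unfolding \<zeta>(2) using f(2) prim that pts g by (intro RL_left_deriv_small[OF \<alpha> fa, of e1]) auto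
    also have "\<dots> \<le> s * Gamma \<alpha> / Gamma \<alpha>" using t3 G by (intro divide_right_mono) auto
    finally show ?thesis using G by simp
  qed
  define \<psi> where "\<psi> x = - \<mu> x * \<zeta> x" for x
  have dmu: "((\<lambda>x. - \<mu> x) has_real_derivative - \<mu>' x) (at x)" for x by (rule DERIV_minus[OF \<mu>(1)])
  have cmu: "continuous_on UNIV (\<lambda>x. - \<mu>' x)" by (intro continuous_on_minus \<mu>(2))
  have \<psi>: "C1_from a \<psi>" "deriv \<psi> = (\<lambda>x. - \<mu>' x * \<zeta> x + - \<mu> x * deriv \<zeta> x)"
    using C1_from_mult[OF \<zeta>(1) dmu cmu] unfolding \<psi>_def[abs_def] by auto
  define \<xi> where "\<xi> x = \<zeta> x + \<psi> x" for x
  have \<xi>: "C1_from a \<xi>" unfolding \<xi>_def[abs_def] by (rule C1_from_add(1)[OF \<zeta>(1) \<psi>(1)])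
  \<comment> \<open>The deviation of \<open>D \<xi>\<close> from \<open>f\<close> is exactly the
    Caputo derivative of the cutoff correction \<open>\<psi>\<close>.\<close>
  have Dchi: "caputo_left a \<alpha> \<xi> x - f x = caputo_left a \<alpha> \<psi> x" if "a \<le> x" for x
    using caputo_left_add[OF \<alpha>(2) \<zeta>(1) \<psi>(1), of x] caputo_left_RL_left[OF \<alpha> fa that]
    unfolding \<xi>_def[abs_def] \<zeta>_def by simp
  have dpi: "\<bar>deriv \<psi> x\<bar> \<le> (2 / g + 1) * s" if "a \<le> x" for x
  proof (cases "x < e1'")
    case True
    have "(\<mu> has_real_derivative 0) (at x)"
      by (rule has_field_derivative_transform_within_open[of "\<lambda>_. 0" _ _ "{..<e1'}"]) (use True \<mu>(3) in auto)
    then have "\<mu>' x = 0" using \<mu>(1) DERIV_unique by blast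
    then show ?thesis using \<mu>(3)[of x] True s g by (simp add: \<psi>(2))
  next
    case False
    have "\<bar>- \<mu>' x * \<zeta> x + - \<mu> x * deriv \<zeta> x\<bar> \<le> \<bar>\<mu>' x\<bar> * \<bar>\<zeta> x\<bar> + \<bar>\<mu> x\<bar> * \<bar>deriv \<zeta> x\<bar>"
      using abs_triangle_ineq[of "- \<mu>' x * \<zeta> x" "- \<mu> x * deriv \<zeta> x"] by (simp add: abs_mult)
    also have "\<dots> \<le> 2 / g * s + 1 * s"
      using \<mu>(5-7)[of x] z1[OF that] z2[of x] False pts(7) s g by (intro add_mono mult_mono) auto
    finally show ?thesis by (simp add: \<psi>(2) algebra_simps)
  qed
  have d: "\<bar>caputo_left a \<alpha> \<xi> x - f x\<bar> \<le> \<sigma>" if x: "x \<in> {a..b}" for x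
  proof -
    have "\<bar>caputo_left a \<alpha> \<psi> x\<bar> \<le> (2 / g + 1) * s * ((b - a) powr (1 - \<alpha>) / ((1 - \<alpha>) * Gamma (1 - \<alpha>)))"
      using x dpi s g by (intro caputo_left_bound \<alpha> \<psi>(1)) auto
    also have "\<dots> = s * C" by (simp add: C_def)
    finally show ?thesis using Dchi[of x] x s(3) by simp
  qed
  have chi_le: "\<bar>\<xi> x\<bar> \<le> \<sigma>" if x: "x \<in> {a..b}" for x
  proof -
    have "\<xi> x = (1 - \<mu> x) * \<zeta> x" by (simp add: \<xi>_def \<psi>_def algebra_simps)
    then have "\<bar>\<xi> x\<bar> = \<bar>1 - \<mu> x\<bar> * \<bar>\<zeta> x\<bar>" by (simp add: abs_mult)
    also have "\<dots> \<le> 1 * s" using \<mu>(5,6)[of x] z1[of x] x by (intro mult_mono) auto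
    finally show ?thesis using s(2) by simp
  qed
  have chi0: "\<xi> x = 0" if "e2 \<le> x" for x using \<mu>(4)[OF that] by (simp add: \<xi>_def \<psi>_def)
  let ?F = "\<lambda>x. \<bar>f x - (if x \<in> {c..e} then (indicat_real A x - \<rho> x) * q x else 0)\<bar>"
  have hF: "(?F has_integral integral {c1..e1} ?F) {a..e2}"
  proof (rule has_integral_on_superset[OF integrable_integral[OF fi(1)]])
    show "?F x = 0" if "x \<notin> {c1..e1}" for x
      using that f(2) C1_fromD(3)[OF f(1), of x] pts by auto
    show "{c1..e1} \<subseteq> {a..e2}" using pts g by auto
  qed
  have f0: "f x = 0" if "e2 \<le> x" for x using f(2) that pts g by auto
  show ?thesis
    by (intro exI[of _ A] exI[of _ f] exI[of _ \<xi>] conjI allI impI ballI A \<xi> chi0 chi_le f0 f(3)[rule_format] d has_integral_integrable[OF hF])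
       (use integral_unique[OF hF] fi(2) t1 cost in auto)
qed

section \<open>Averaging over the parameter\<close>

lemma nn_integral_eq_integral_Icc:
  fixes h :: "real \<Rightarrow> real"
  assumes "h absolutely_integrable_on {p..b}" "(\<lambda>x. indicat_real {p..<b} x * h x) \<in> borel_measurable borel"
  shows "(\<integral>\<^sup>+ x. ennreal (indicat_real {p..<b} x * \<bar>h x\<bar>) \<partial>lborel) = ennreal (integral {p..b} (\<lambda>x. \<bar>h x\<bar>))"
proof (rule nn_integral_has_integral_lborel)
  have "(\<lambda>x. \<bar>indicat_real {p..<b} x * h x\<bar>) \<in> borel_measurable borel" using assms(2) by measurable
  then show "(\<lambda>x. indicat_real {p..<b} x * \<bar>h x\<bar>) \<in> borel_measurable borel" by (simp add: abs_mult)
  have "((\<lambda>x. \<bar>h x\<bar>) has_integral integral {p..b} (\<lambda>x. \<bar>h x\<bar>)) {p..b}"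
    using set_lebesgue_integral_eq_integral(1)[OF absolutely_integrable_norm[OF assms(1)]]
    by (simp add: o_def integrable_integral)
  then have "((\<lambda>x. if x \<in> {p..b} then \<bar>h x\<bar> else 0) has_integral integral {p..b} (\<lambda>x. \<bar>h x\<bar>)) UNIV"
    by (simp only: has_integral_restrict_UNIV)
  then show "((\<lambda>x. indicat_real {p..<b} x * \<bar>h x\<bar>) has_integral integral {p..b} (\<lambda>x. \<bar>h x\<bar>)) UNIV"
    by (rule has_integral_spike[of "{b}", rotated 2]) (auto simp: indicator_def)
qed auto

text \<open>Averaging over \<open>\<epsilon>\<close> absorbs the shift \<open>d\<close>: on each vertical line it is a translation of \<open>\<epsilon>\<close>
  by \<open>d x / w x\<close>, so no continuity of the integral near \<open>b\<close> is required.\<close>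

lemma tail_average:
  fixes g :: "real \<times> real \<Rightarrow> real" and w d :: "real \<Rightarrow> real"
  assumes cg: "continuous_on ({p..<b} \<times> UNIV) g"
    and cw: "continuous_on {p..<b} w" and cd: "continuous_on {p..<b} d"
    and r: "0 < r" and s: "0 < s"
    and wd: "\<And>x. x \<in> {p..<b} \<Longrightarrow> w x \<noteq> 0 \<and> \<bar>d x\<bar> \<le> r * \<bar>w x\<bar>"
    and int1: "\<And>\<epsilon>. \<epsilon> \<in> {\<epsilon>0 - 2 * r..\<epsilon>0 + 2 * r} \<Longrightarrow> (\<lambda>x. g (x, \<epsilon> * w x)) absolutely_integrable_on {p..b}"
      "\<And>\<epsilon>. \<epsilon> \<in> {\<epsilon>0 - 2 * r..\<epsilon>0 + 2 * r} \<Longrightarrow> integral {p..b} (\<lambda>x. \<bar>g (x, \<epsilon> * w x)\<bar>) \<le> s"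
    and int2: "\<And>\<epsilon>. \<epsilon> \<in> {\<epsilon>0 - r..\<epsilon>0 + r} \<Longrightarrow> (\<lambda>x. g (x, \<epsilon> * w x + d x)) absolutely_integrable_on {p..b}"
  shows "\<exists>\<epsilon>\<in>{\<epsilon>0 - r..\<epsilon>0 + r}. integral {p..b} (\<lambda>x. \<bar>g (x, \<epsilon> * w x + d x)\<bar>) \<le> 3 * s"
proof (rule ccontr)
  assume no: "\<not> ?thesis"
  define G where "G d \<epsilon> x = indicat_real {p..<b} x * g (x, \<epsilon> * w x + d x)" for d \<epsilon> x
  have Gm: "(\<lambda>(\<epsilon>, x). G d \<epsilon> x) \<in> borel_measurable (borel \<Otimes>\<^sub>M borel)" if "continuous_on {p..<b} d" for d
  proof -
    have "continuous_on (UNIV \<times> {p..<b}) (\<lambda>z. g (snd z, fst z * w (snd z) + d (snd z)))"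
      by (rule continuous_on_compose2[OF cg])
         (auto intro!: continuous_intros continuous_on_compose2[OF cw] continuous_on_compose2[OF that])
    moreover have "UNIV \<times> {p..<b} \<in> sets (borel :: (real \<times> real) measure)"
      unfolding borel_prod[symmetric] by (intro pair_measureI) auto
    ultimately have "(\<lambda>z. indicat_real (UNIV \<times> {p..<b}) z *\<^sub>R g (snd z, fst z * w (snd z) + d (snd z))) \<in> borel_measurable borel"
      by (rule borel_measurable_continuous_on_indicator[rotated])
    moreover have "(\<lambda>z. indicat_real (UNIV \<times> {p..<b}) z *\<^sub>R g (snd z, fst z * w (snd z) + d (snd z))) = (\<lambda>(\<epsilon>, x). G d \<epsilon> x)"
      by (auto simp: G_def indicator_def fun_eq_iff)
    ultimately show ?thesis by (simp add: borel_prod)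
  qed
  have c0: "continuous_on {p..<b} (\<lambda>_. 0::real)" by simp
  note [measurable] = Gm[OF cd] Gm[OF c0]
  let ?I = "{\<epsilon>0 - r..\<epsilon>0 + r}" and ?I2 = "{\<epsilon>0 - 2 * r..\<epsilon>0 + 2 * r}"
  have inner1: "(\<integral>\<^sup>+ x. ennreal \<bar>G d \<epsilon> x\<bar> \<partial>lborel) = ennreal (integral {p..b} (\<lambda>x. \<bar>g (x, \<epsilon> * w x + d x)\<bar>))" if "\<epsilon> \<in> ?I" for \<epsilon>
  proof -
    have "(\<lambda>x. G d \<epsilon> x) \<in> borel_measurable borel" by measurable
    then show ?thesis
      using nn_integral_eq_integral_Icc[OF int2[OF that]] by (simp add: G_def abs_mult)
  qed
  have inner2: "(\<integral>\<^sup>+ x. ennreal \<bar>G (\<lambda>_. 0) \<epsilon> x\<bar> \<partial>lborel) \<le> ennreal s" if "\<epsilon> \<in> ?I2" for \<epsilon>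
  proof -
    have "(\<lambda>x. G (\<lambda>_. 0) \<epsilon> x) \<in> borel_measurable borel" by measurable
    then have "(\<integral>\<^sup>+ x. ennreal \<bar>G (\<lambda>_. 0) \<epsilon> x\<bar> \<partial>lborel) = ennreal (integral {p..b} (\<lambda>x. \<bar>g (x, \<epsilon> * w x)\<bar>))"
      using nn_integral_eq_integral_Icc[OF int1(1)[OF that]] by (simp add: G_def abs_mult)
    then show ?thesis using int1(2)[OF that] by (simp add: ennreal_leI)
  qed
  \<comment> \<open>If every \<open>\<epsilon>\<close> in \<open>?I\<close>, of length
    \<open>2 * r\<close>, were bad, the double integral would be at least \<open>6 * r * s\<close>.
    After the translation it is at most the unshifted one over \<open>?I2\<close>, of length
    \<open>4 * r\<close>, hence at most \<open>4 * r * s\<close>.\<close>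
  have "ennreal (6 * r * s) = (\<integral>\<^sup>+ \<epsilon>. ennreal (3 * s) * indicator ?I \<epsilon> \<partial>lborel)"
    using r s by (simp add: nn_integral_cmult_indicator ennreal_mult[symmetric])
  also have "\<dots> \<le> (\<integral>\<^sup>+ \<epsilon>. (\<integral>\<^sup>+ x. indicator ?I \<epsilon> * ennreal \<bar>G d \<epsilon> x\<bar> \<partial>lborel) \<partial>lborel)"
  proof (rule nn_integral_mono)
    fix \<epsilon>
    show "ennreal (3 * s) * indicator ?I \<epsilon> \<le> (\<integral>\<^sup>+ x. indicator ?I \<epsilon> * ennreal \<bar>G d \<epsilon> x\<bar> \<partial>lborel)"
    proof (cases "\<epsilon> \<in> ?I")
      case True
      then have "3 * s < integral {p..b} (\<lambda>x. \<bar>g (x, \<epsilon> * w x + d x)\<bar>)" using no by (meson not_le)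
      then show ?thesis using True inner1[OF True] by (simp add: ennreal_leI)
    qed simp
  qed
  also have "\<dots> = (\<integral>\<^sup>+ x. (\<integral>\<^sup>+ \<epsilon>. indicator ?I \<epsilon> * ennreal \<bar>G d \<epsilon> x\<bar> \<partial>lborel) \<partial>lborel)"
    by (rule lborel_pair.Fubini') measurable
  also have "\<dots> \<le> (\<integral>\<^sup>+ x. (\<integral>\<^sup>+ \<epsilon>. indicator ?I2 \<epsilon> * ennreal \<bar>G (\<lambda>_. 0) \<epsilon> x\<bar> \<partial>lborel) \<partial>lborel)"
  proof (rule nn_integral_mono)
    fix x
    show "(\<integral>\<^sup>+ \<epsilon>. indicator ?I \<epsilon> * ennreal \<bar>G d \<epsilon> x\<bar> \<partial>lborel) \<le> (\<integral>\<^sup>+ \<epsilon>. indicator ?I2 \<epsilon> * ennreal \<bar>G (\<lambda>_. 0) \<epsilon> x\<bar> \<partial>lborel)"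
    proof (cases "x \<in> {p..<b}")
      case True
      define t where "t = d x / w x"
      have wx: "w x \<noteq> 0" "\<bar>t\<bar> \<le> r" using wd[OF True] by (auto simp: t_def divide_le_eq)
      have "(\<integral>\<^sup>+ \<epsilon>. indicator ?I2 \<epsilon> * ennreal \<bar>G (\<lambda>_. 0) \<epsilon> x\<bar> \<partial>lborel)
          = (\<integral>\<^sup>+ \<epsilon>. indicator ?I2 (t + 1 * \<epsilon>) * ennreal \<bar>G (\<lambda>_. 0) (t + 1 * \<epsilon>) x\<bar> \<partial>lborel)"
        by (subst nn_integral_real_affine[where c = 1 and t = t]) auto
      also have "\<dots> \<ge> (\<integral>\<^sup>+ \<epsilon>. indicator ?I \<epsilon> * ennreal \<bar>G d \<epsilon> x\<bar> \<partial>lborel)"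
      proof (rule nn_integral_mono)
        fix \<epsilon>
        have "(t + 1 * \<epsilon>) * w x = \<epsilon> * w x + d x" using wx by (simp add: t_def algebra_simps)
        then have "G (\<lambda>_. 0) (t + 1 * \<epsilon>) x = G d \<epsilon> x" by (simp add: G_def)
        moreover have "\<epsilon> \<in> ?I \<Longrightarrow> t + 1 * \<epsilon> \<in> ?I2" using wx(2) by auto
        ultimately show "indicator ?I \<epsilon> * ennreal \<bar>G d \<epsilon> x\<bar> \<le> indicator ?I2 (t + 1 * \<epsilon>) * ennreal \<bar>G (\<lambda>_. 0) (t + 1 * \<epsilon>) x\<bar>"
          by (auto simp: indicator_def)
      qed
      finally show ?thesis .
    qed (simp add: G_def)
  qed
  also have "\<dots> = (\<integral>\<^sup>+ \<epsilon>. (\<integral>\<^sup>+ x. indicator ?I2 \<epsilon> * ennreal \<bar>G (\<lambda>_. 0) \<epsilon> x\<bar> \<partial>lborel) \<partial>lborel)"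
    by (rule lborel_pair.Fubini'[symmetric]) measurable
  also have "\<dots> \<le> (\<integral>\<^sup>+ \<epsilon>. ennreal s * indicator ?I2 \<epsilon> \<partial>lborel)"
  proof (rule nn_integral_mono)
    fix \<epsilon> show "(\<integral>\<^sup>+ x. indicator ?I2 \<epsilon> * ennreal \<bar>G (\<lambda>_. 0) \<epsilon> x\<bar> \<partial>lborel) \<le> ennreal s * indicator ?I2 \<epsilon>"
      by (cases "\<epsilon> \<in> ?I2") (use inner2 in auto)
  qed
  also have "\<dots> = ennreal (4 * r * s)"
    using r s by (simp add: nn_integral_cmult_indicator ennreal_mult[symmetric])
  finally have "6 * r * s \<le> 4 * r * s" using r s by (simp add: ennreal_le_iff)
  then show False using r s by simp
qed

section \<open>The functional near a minimizer\<close>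

lemma integral_tail_small:
  fixes f :: "real \<Rightarrow> real"
  assumes "p < b" "f integrable_on {p..b}" "0 < s"
  shows "\<exists>d. p \<le> d \<and> d < b \<and> (\<forall>e\<in>{d..b}. \<bar>integral {e..b} f\<bar> \<le> s)"
proof -
  have "continuous_on {p..b} (\<lambda>x. integral {x..b} f)"
    by (rule indefinite_integral_continuous_1'[OF assms(2)])
  then obtain \<delta> where \<delta>: "\<delta> > 0" "\<And>x. x \<in> {p..b} \<Longrightarrow> dist x b < \<delta> \<Longrightarrow> dist (integral {x..b} f) (integral {b..b} f) < s"
    using assms(1,3) unfolding continuous_on_iff by (metis atLeastAtMost_iff less_imp_le order_refl)
  define d where "d = max p (b - \<delta> / 2)"
  have d: "p \<le> d" "d < b" "b - d < \<delta>" using assms(1) \<delta>(1) by (auto simp: d_def)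
  have "\<bar>integral {e..b} f\<bar> \<le> s" if "e \<in> {d..b}" for e
  proof -
    have "e \<in> {p..b}" "dist e b < \<delta>" using that d by (auto simp: dist_real_def)
    from \<delta>(2)[OF this] show ?thesis by (simp add: dist_real_def)
  qed
  then show ?thesis using d by blast
qed

text \<open>The tail integral need not be continuous in \<open>\<epsilon>\<close>, but its
  truncations away from \<open>b\<close> are, by the local Lipschitz condition. So "tail beyond
  \<open>E k\<close> at most \<open>s\<close>" is written as infinitely many closed conditions on
  truncations. Integrability for each single \<open>\<epsilon>\<close> provides the
  covering.\<close>

lemma Baire_tail:
  fixes h :: "real \<Rightarrow> real \<Rightarrow> real"
  assumes pb: "p < b" and lu: "l < u" and s: "0 < s"
    and hi: "\<And>\<epsilon>. \<epsilon> \<in> {l..u} \<Longrightarrow> h \<epsilon> absolutely_integrable_on {p..b}"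
    and Lip: "\<And>e. p \<le> e \<Longrightarrow> e < b \<Longrightarrow>
      \<exists>N. \<forall>x\<in>{p..e}. \<forall>\<epsilon>\<in>{l..u}. \<forall>\<epsilon>'\<in>{l..u}. \<bar>h \<epsilon> x - h \<epsilon>' x\<bar> \<le> N * \<bar>\<epsilon> - \<epsilon>'\<bar>"
  shows "\<exists>l' u' e. l \<le> l' \<and> l' < u' \<and> u' \<le> u \<and> p \<le> e \<and> e < b \<and> (\<forall>\<epsilon>\<in>{l'..u'}. integral {e..b} (\<lambda>x. \<bar>h \<epsilon> x\<bar>) \<le> s)"
proof -
  have i: "(\<lambda>x. \<bar>h \<epsilon> x\<bar>) integrable_on {x..y}" if "\<epsilon> \<in> {l..u}" "p \<le> x" "y \<le> b" for \<epsilon> x y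
  proof -
    have "(\<lambda>x. \<bar>h \<epsilon> x\<bar>) integrable_on {p..b}"
      using set_lebesgue_integral_eq_integral(1)[OF absolutely_integrable_norm[OF hi[OF that(1)]]] by (simp add: o_def)
    then show ?thesis by (rule integrable_subinterval_real) (use that in auto)
  qed
  define E where "E k = b - (b - p) / (real k + 1)" for k :: nat
  have E: "p \<le> E k" "E k < b" for k
  proof -
    have "(b - p) / (real k + 1) \<le> (b - p) / 1" using pb by (intro divide_left_mono) auto
    then show "p \<le> E k" by (simp add: E_def)
    show "E k < b" using pb by (simp add: E_def)
  qed
  have Emono: "E k \<le> E j" if "k \<le> j" for k j
    unfolding E_def using pb that by (intro diff_left_mono divide_left_mono) auto
  have Elim: "\<exists>k. d \<le> E k" if "d < b" for d
  proof -
    obtain k :: nat where "(b - p) / (b - d) < real k" using reals_Archimedean2 by blast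
    then have "(b - p) / (real k + 1) \<le> b - d" using that pb by (simp add: field_simps)
    then show ?thesis unfolding E_def by (intro exI[of _ k]) simp
  qed
  define T where "T k j \<epsilon> = integral {E k..E j} (\<lambda>x. \<bar>h \<epsilon> x\<bar>)" for k j \<epsilon>
  have Tc: "continuous_on {l..u} (T k j)" for k j
  proof -
    obtain N where N: "\<forall>x\<in>{p..E j}. \<forall>\<epsilon>\<in>{l..u}. \<forall>\<epsilon>'\<in>{l..u}. \<bar>h \<epsilon> x - h \<epsilon>' x\<bar> \<le> N * \<bar>\<epsilon> - \<epsilon>'\<bar>"
      using Lip E by blast
    have "\<bar>T k j \<epsilon> - T k j \<epsilon>'\<bar> \<le> \<bar>N\<bar> * (b - p) * \<bar>\<epsilon> - \<epsilon>'\<bar>" if e: "\<epsilon> \<in> {l..u}" "\<epsilon>' \<in> {l..u}" for \<epsilon> \<epsilon>'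
    proof (cases "E k \<le> E j")
      case True
      have "norm (T k j \<epsilon> - T k j \<epsilon>') \<le> \<bar>N\<bar> * \<bar>\<epsilon> - \<epsilon>'\<bar> * (E j - E k)"
      proof (rule has_integral_bound_Icc[OF _ True])
        show "((\<lambda>x. \<bar>h \<epsilon> x\<bar> - \<bar>h \<epsilon>' x\<bar>) has_integral T k j \<epsilon> - T k j \<epsilon>') {E k..E j}"
          unfolding T_def using e E less_imp_le[OF E(2)] by (intro has_integral_diff integrable_integral i) auto
        fix x assume "x \<in> {E k..E j}"
        then have "x \<in> {p..E j}" using E(1)[of k] by auto
        then have "\<bar>h \<epsilon> x - h \<epsilon>' x\<bar> \<le> N * \<bar>\<epsilon> - \<epsilon>'\<bar>" using N e by blast
        also have "\<dots> \<le> \<bar>N\<bar> * \<bar>\<epsilon> - \<epsilon>'\<bar>" by (intro mult_right_mono) auto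
        finally show "norm (\<bar>h \<epsilon> x\<bar> - \<bar>h \<epsilon>' x\<bar>) \<le> \<bar>N\<bar> * \<bar>\<epsilon> - \<epsilon>'\<bar>" by simp
      qed simp
      also have "\<dots> \<le> \<bar>N\<bar> * \<bar>\<epsilon> - \<epsilon>'\<bar> * (b - p)"
        using E(1)[of k] E(2)[of j] by (intro mult_left_mono) auto
      finally show ?thesis by (simp add: mult_ac)
    qed (use pb in \<open>simp add: T_def\<close>)
    then have "(\<bar>N\<bar> * (b - p))-lipschitz_on {l..u} (T k j)"
      using pb by (intro lipschitz_onI) (auto simp: dist_real_def)
    then show ?thesis by (rule lipschitz_on_continuous_on)
  qed
  define F where "F k = (\<Inter>j. {\<epsilon>\<in>{l..u}. T k j \<epsilon> \<le> s})" for k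
  have Fc: "closed (F k)" for k unfolding F_def
    by (intro closed_INT ballI continuous_on_closed_Collect_le Tc continuous_on_const closed_atLeastAtMost)
  have cover: "{l..u} \<subseteq> (\<Union>k. F k)"
  proof
    fix \<epsilon> assume e: "\<epsilon> \<in> {l..u}"
    obtain d where d: "d < b" "\<forall>e\<in>{d..b}. \<bar>integral {e..b} (\<lambda>x. \<bar>h \<epsilon> x\<bar>)\<bar> \<le> s"
      using integral_tail_small[OF pb i[OF e order_refl order_refl] s] by blast
    obtain k where k: "d \<le> E k" using Elim[OF d(1)] by blast
    have "T k j \<epsilon> \<le> s" for j
    proof -
      have "T k j \<epsilon> \<le> integral {E k..b} (\<lambda>x. \<bar>h \<epsilon> x\<bar>)"
        unfolding T_def using E[of k] E[of j] e by (intro integral_subset_le i) auto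
      also have "\<dots> \<le> \<bar>integral {E k..b} (\<lambda>x. \<bar>h \<epsilon> x\<bar>)\<bar>" by simp
      also have "\<dots> \<le> s" using d(2) k E(2)[of k] by auto
      finally show ?thesis .
    qed
    then show "\<epsilon> \<in> (\<Union>k. F k)" using e by (auto simp: F_def)
  qed
  obtain k l' u' where B: "l \<le> l'" "l' < u'" "u' \<le> u" "{l'..u'} \<subseteq> F k"
    by (rule Baire_interval[OF lu Fc cover])
  \<comment> \<open>The whole tail is recovered from its truncations: the part beyond
    \<open>E j\<close> is smaller than any given \<open>t\<close> for large
    \<open>j\<close>.\<close>
  have "integral {E k..b} (\<lambda>x. \<bar>h \<epsilon> x\<bar>) \<le> s" if e': "\<epsilon> \<in> {l'..u'}" for \<epsilon>
  proof (rule field_le_epsilon)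
    fix t :: real assume t: "0 < t"
    have e: "\<epsilon> \<in> {l..u}" using e' B by auto
    obtain d where d: "d < b" "\<forall>e\<in>{d..b}. \<bar>integral {e..b} (\<lambda>x. \<bar>h \<epsilon> x\<bar>)\<bar> \<le> t"
      using integral_tail_small[OF pb i[OF e order_refl order_refl] t] by blast
    obtain j0 where j0: "d \<le> E j0" using Elim[OF d(1)] by blast
    define j where "j = max k j0"
    have j: "E k \<le> E j" "d \<le> E j" using Emono[of k j] Emono[of j0 j] j0 by (auto simp: j_def)
    have "integral {E k..b} (\<lambda>x. \<bar>h \<epsilon> x\<bar>) = T k j \<epsilon> + integral {E j..b} (\<lambda>x. \<bar>h \<epsilon> x\<bar>)"
      unfolding T_def using j E less_imp_le[OF E(2)] e
      by (intro Henstock_Kurzweil_Integration.integral_combine[symmetric] i) auto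
    moreover have "T k j \<epsilon> \<le> s" using B(4) e' by (auto simp: F_def)
    moreover have "\<bar>integral {E j..b} (\<lambda>x. \<bar>h \<epsilon> x\<bar>)\<bar> \<le> t" using d(2) j(2) E(2)[of j] by auto
    ultimately show "integral {E k..b} (\<lambda>x. \<bar>h \<epsilon> x\<bar>) \<le> s + t" by linarith
  qed
  then show ?thesis using B E by blast
qed

text \<open>For fixed \<open>x\<close> the lines in the \<open>y\<close> and \<open>v\<close>
  directions lie entirely in the strip, so the relative derivative restricts to two-sided partial
  derivatives, also at \<open>x = a\<close>.\<close>

lemma C1_on_partial_derivatives:
  fixes L :: "real \<times> real \<times> real \<Rightarrow> real"
  assumes "C1_on ({a..<b} \<times> UNIV) L"
  shows "x \<in> {a..<b} \<Longrightarrow> ((\<lambda>t. L (x, t, v)) has_real_derivative partial_y L (x, u, v)) (at u)"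
    and "x \<in> {a..<b} \<Longrightarrow> ((\<lambda>t. L (x, u, t)) has_real_derivative partial_v L (x, u, v)) (at v)"
    and "continuous_on ({a..<b} \<times> UNIV) (partial_y L)" "continuous_on ({a..<b} \<times> UNIV) (partial_v L)"
    and "continuous_on ({a..<b} \<times> UNIV) L"
proof -
  let ?S = "{a..<b} \<times> (UNIV :: (real \<times> real) set)"
  obtain L' where L': "\<forall>p\<in>?S. (L has_derivative blinfun_apply (L' p)) (at p within ?S)" "continuous_on ?S L'"
    using assms unfolding C1_on_def by blast
  have d1: "((\<lambda>t. L (x, t, v)) has_real_derivative blinfun_apply (L' (x, u, v)) (0, 1, 0)) (at u)"
    if x: "x \<in> {a..<b}" for x u v
  proof -
    have "((\<lambda>t. (x, t, v)) has_derivative (\<lambda>h. (0, h, 0))) (at u)"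
      by (intro has_derivative_Pair has_derivative_const has_derivative_ident)
    moreover have "(L has_derivative blinfun_apply (L' (x, u, v))) (at (x, u, v) within range (\<lambda>t. (x, t, v)))"
    proof (rule has_derivative_subset)
      show "(L has_derivative blinfun_apply (L' (x, u, v))) (at (x, u, v) within ?S)"
        using L'(1) x by blast
    qed (use x in auto)
    ultimately have "((\<lambda>t. L (x, t, v)) has_derivative (\<lambda>h. blinfun_apply (L' (x, u, v)) (0, h, 0))) (at u)"
      by (rule has_derivative_in_compose)
    moreover have "(\<lambda>h. blinfun_apply (L' (x, u, v)) (0, h, 0)) = (*) (blinfun_apply (L' (x, u, v)) (0, 1, 0))"
    proof
      fix h show "blinfun_apply (L' (x, u, v)) (0, h, 0) = blinfun_apply (L' (x, u, v)) (0, 1, 0) * h"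
        using blinfun.scaleR_right[of "L' (x, u, v)" h "(0, 1, 0)"] by simp
    qed
    ultimately show ?thesis by (simp only: has_field_derivative_def)
  qed
  have d2: "((\<lambda>t. L (x, u, t)) has_real_derivative blinfun_apply (L' (x, u, v)) (0, 0, 1)) (at v)"
    if x: "x \<in> {a..<b}" for x u v
  proof -
    have "((\<lambda>t. (x, u, t)) has_derivative (\<lambda>h. (0, 0, h))) (at v)"
      by (intro has_derivative_Pair has_derivative_const has_derivative_ident)
    moreover have "(L has_derivative blinfun_apply (L' (x, u, v))) (at (x, u, v) within range (\<lambda>t. (x, u, t)))"
    proof (rule has_derivative_subset)
      show "(L has_derivative blinfun_apply (L' (x, u, v))) (at (x, u, v) within ?S)"
        using L'(1) x by blast
    qed (use x in auto)
    ultimately have "((\<lambda>t. L (x, u, t)) has_derivative (\<lambda>h. blinfun_apply (L' (x, u, v)) (0, 0, h))) (at v)"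
      by (rule has_derivative_in_compose)
    moreover have "(\<lambda>h. blinfun_apply (L' (x, u, v)) (0, 0, h)) = (*) (blinfun_apply (L' (x, u, v)) (0, 0, 1))"
    proof
      fix h show "blinfun_apply (L' (x, u, v)) (0, 0, h) = blinfun_apply (L' (x, u, v)) (0, 0, 1) * h"
        using blinfun.scaleR_right[of "L' (x, u, v)" h "(0, 0, 1)"] by simp
    qed
    ultimately show ?thesis by (simp only: has_field_derivative_def)
  qed
  have e1: "partial_y L (x, u, v) = blinfun_apply (L' (x, u, v)) (0, 1, 0)" if "x \<in> {a..<b}" for x u v
    using DERIV_imp_deriv[OF d1[OF that]] by (simp add: partial_y_def)
  have e2: "partial_v L (x, u, v) = blinfun_apply (L' (x, u, v)) (0, 0, 1)" if "x \<in> {a..<b}" for x u v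
    using DERIV_imp_deriv[OF d2[OF that]] by (simp add: partial_v_def)
  show "((\<lambda>t. L (x, t, v)) has_real_derivative partial_y L (x, u, v)) (at u)" if "x \<in> {a..<b}"
    unfolding e1[OF that] by (rule d1[OF that])
  show "((\<lambda>t. L (x, u, t)) has_real_derivative partial_v L (x, u, v)) (at v)" if "x \<in> {a..<b}"
    unfolding e2[OF that] by (rule d2[OF that])
  have "continuous_on ?S (\<lambda>p. blinfun_apply (L' p) (0, 1, 0))" "continuous_on ?S (\<lambda>p. blinfun_apply (L' p) (0, 0, 1))"
    using L'(2) by (auto intro!: continuous_intros)
  moreover have "blinfun_apply (L' p) (0, 1, 0) = partial_y L p" "blinfun_apply (L' p) (0, 0, 1) = partial_v L p"
    if "p \<in> ?S" for p
    using that e1[of "fst p" "fst (snd p)" "snd (snd p)"] e2[of "fst p" "fst (snd p)" "snd (snd p)"]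
    by (simp_all add: mem_Times_iff)
  ultimately show "continuous_on ?S (partial_y L)" "continuous_on ?S (partial_v L)"
    by (blast intro: continuous_on_eq)+
  show "continuous_on ?S L"
    by (rule differentiable_imp_continuous_on) (use L'(1) in \<open>auto simp: differentiable_on_def intro: differentiableI\<close>)
qed

text \<open>Maximizers are reduced to this setting by negating \<open>L\<close>. The existence of
  \<open>J\<close> on the whole admissible class is used substantially: it yields integrability of
  the tails of all perturbed integrands.\<close>

locale fractional_minimizer =
  fixes a b \<alpha> ya yb :: real
    and L :: "real \<times> real \<times> real \<Rightarrow> real"
    and y :: "real \<Rightarrow> real"
  assumes ab: "a < b" and \<alpha>0: "0 < \<alpha>" and \<alpha>1: "\<alpha> < 1"
    and L_C1: "C1_on ({a..<b} \<times> UNIV) L"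
    and J_defined: "\<And>z. z \<in> admissible a b ya yb \<Longrightarrow> set_integrable lebesgue {a..b} (along a \<alpha> L z)"
    and y_admissible: "y \<in> admissible a b ya yb"
    and minimal: "\<And>z. z \<in> admissible a b ya yb \<Longrightarrow> J_functional a b \<alpha> L y \<le> J_functional a b \<alpha> L z"
begin

abbreviation D :: "(real \<Rightarrow> real) \<Rightarrow> real \<Rightarrow> real" where "D \<equiv> caputo_left a \<alpha>"

text \<open>By additivity of the Caputo derivative the integrand of \<open>J\<close> at
  \<open>y + \<eta>\<close> is \<open>P x (\<eta> x) (D \<eta> x)\<close>; the origin corresponds to
  \<open>y\<close>.\<close>

definition P :: "real \<Rightarrow> real \<Rightarrow> real \<Rightarrow> real" where
  "P x u v = L (x, y x + u, D y x + v)"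

abbreviation "Py \<equiv> along a \<alpha> (partial_y L) y"
abbreviation "Pv \<equiv> along a \<alpha> (partial_v L) y"

lemma y_C1: "C1_on {a..b} y"
  using y_admissible by (simp add: admissible_def)

lemma continuous_on_y: "continuous_on {a..b} y" "continuous_on {a..b} (D y)"
proof -
  obtain h where "\<forall>u\<in>{a..b}. (y has_real_derivative h u) (at u within {a..b})"
    using C1_on_Icc_derivative[OF y_C1] by blast
  then show "continuous_on {a..b} y" by (intro DERIV_continuous_on[of _ _ h]) blast
  show "continuous_on {a..b} (D y)"
    by (rule continuous_on_caputo_left_C1_on[OF \<alpha>0 \<alpha>1 y_C1])
qed

lemma continuous_on_shift:
  assumes "continuous_on ({a..<b} \<times> UNIV) F"
  shows "continuous_on ({a..<b} \<times> UNIV) (\<lambda>(x, u, v). F (x, y x + u, D y x + v) :: real)"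
proof -
  have "continuous_on ({a..<b} \<times> UNIV) (\<lambda>p :: real \<times> real \<times> real. y (fst p))"
    "continuous_on ({a..<b} \<times> UNIV) (\<lambda>p :: real \<times> real \<times> real. D y (fst p))"
    by (rule continuous_on_compose2[OF continuous_on_y(1)] continuous_on_compose2[OF continuous_on_y(2)],
        auto intro: continuous_intros)+
  then have "continuous_on ({a..<b} \<times> UNIV) (\<lambda>p. (fst p, y (fst p) + fst (snd p), D y (fst p) + snd (snd p)))"
    by (intro continuous_intros)
  then have "continuous_on ({a..<b} \<times> UNIV) (\<lambda>p. F (fst p, y (fst p) + fst (snd p), D y (fst p) + snd (snd p)))"
    by (rule continuous_on_compose2[OF assms]) auto
  then show ?thesis by (simp add: case_prod_unfold)
qed

lemma continuous_on_along:
  assumes "continuous_on ({a..<b} \<times> UNIV) F" "S \<subseteq> {a..<b}" "continuous_on S f" "continuous_on S g"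
  shows "continuous_on S (\<lambda>x. F (x, y x + f x, D y x + g x) :: real)"
proof -
  have "continuous_on S (\<lambda>x. (x, f x, g x))" using assms(3,4) by (intro continuous_intros)
  moreover have "(\<lambda>x. (x, f x, g x)) ` S \<subseteq> {a..<b} \<times> UNIV" using assms(2) by auto
  ultimately show ?thesis
    using continuous_on_compose2[OF continuous_on_shift[OF assms(1)], of S "\<lambda>x. (x, f x, g x)"] by simp
qed

lemma continuous_on_P:
  assumes "S \<subseteq> {a..<b}" "continuous_on S f" "continuous_on S g"
  shows "continuous_on S (\<lambda>x. P x (f x) (g x))"
  unfolding P_def by (rule continuous_on_along[OF C1_on_partial_derivatives(5)[OF L_C1] assms])

lemma continuous_on_Py: "S \<subseteq> {a..<b} \<Longrightarrow> continuous_on S Py"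
  using continuous_on_along[OF C1_on_partial_derivatives(3)[OF L_C1], of S "\<lambda>_. 0" "\<lambda>_. 0"]
  by (simp add: along_def[abs_def])

lemma continuous_on_Pv: "S \<subseteq> {a..<b} \<Longrightarrow> continuous_on S Pv"
  using continuous_on_along[OF C1_on_partial_derivatives(4)[OF L_C1], of S "\<lambda>_. 0" "\<lambda>_. 0"]
  by (simp add: along_def[abs_def])

lemma P_derivatives:
  assumes "x \<in> {a..<b}"
  shows "((\<lambda>u. P x u v) has_real_derivative partial_y L (x, y x + u, D y x + v)) (at u)"
    and "((\<lambda>v. P x u v) has_real_derivative partial_v L (x, y x + u, D y x + v)) (at v)"
proof -
  show "((\<lambda>u. P x u v) has_real_derivative partial_y L (x, y x + u, D y x + v)) (at u)"
    using C1_on_partial_derivatives(1)[OF L_C1 assms, of "D y x + v" "u + y x"]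
      DERIV_shift[of "\<lambda>t. L (x, t, D y x + v)" "partial_y L (x, u + y x, D y x + v)" u "y x"]
    by (simp add: P_def[abs_def] add.commute)
  show "((\<lambda>v. P x u v) has_real_derivative partial_v L (x, y x + u, D y x + v)) (at v)"
    using C1_on_partial_derivatives(2)[OF L_C1 assms, of "y x + u" "v + D y x"]
      DERIV_shift[of "\<lambda>t. L (x, y x + u, t)" "partial_v L (x, y x + u, v + D y x)" v "D y x"]
    by (simp add: P_def[abs_def] add.commute)
qed

text \<open>The partial derivatives are bounded on compact sets. \<open>N\<close> depends on
  \<open>e\<close> and may blow up as \<open>e\<close> tends to \<open>b\<close>, so it must never
  be applied to a full tail.\<close>

lemma P_Lipschitz:
  assumes "e < b"
  shows "\<exists>N\<ge>0. \<forall>x\<in>{a..e}. \<forall>u u' v v'. \<bar>u\<bar> \<le> R \<longrightarrow> \<bar>u'\<bar> \<le> R \<longrightarrow> \<bar>v\<bar> \<le> R \<longrightarrow> \<bar>v'\<bar> \<le> R \<longrightarrow>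
    \<bar>P x u v - P x u' v'\<bar> \<le> N * (\<bar>u - u'\<bar> + \<bar>v - v'\<bar>)"
proof -
  let ?K = "{a..e} \<times> {-R..R} \<times> {-R..R}"
  have K: "compact ?K" "?K \<subseteq> {a..<b} \<times> UNIV" using assms by (auto intro!: compact_Times)
  define Ry where "Ry = (\<lambda>(x, u, v). partial_y L (x, y x + u, D y x + v))"
  define Rv where "Rv = (\<lambda>(x, u, v). partial_v L (x, y x + u, D y x + v))"
  have c: "continuous_on ?K Ry" "continuous_on ?K Rv"
    unfolding Ry_def Rv_def
    using continuous_on_shift[OF C1_on_partial_derivatives(3)[OF L_C1]] continuous_on_shift[OF C1_on_partial_derivatives(4)[OF L_C1]] K(2)
    by (auto intro: continuous_on_subset)
  have "bounded (Ry ` ?K)" "bounded (Rv ` ?K)"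
    using c K(1) by (auto intro!: compact_imp_bounded compact_continuous_image)
  then obtain N1 N2 where N1: "\<forall>z\<in>Ry ` ?K. norm z \<le> N1" and N2: "\<forall>z\<in>Rv ` ?K. norm z \<le> N2"
    unfolding bounded_iff by blast
  define N where "N = max 0 (max N1 N2)"
  have N: "0 \<le> N" "N1 \<le> N" "N2 \<le> N" by (auto simp: N_def)
  have "\<bar>P x u v - P x u' v'\<bar> \<le> N * (\<bar>u - u'\<bar> + \<bar>v - v'\<bar>)"
    if x: "x \<in> {a..e}" and b: "\<bar>u\<bar> \<le> R" "\<bar>u'\<bar> \<le> R" "\<bar>v\<bar> \<le> R" "\<bar>v'\<bar> \<le> R" for x u u' v v'
  proof -
    have xb: "x \<in> {a..<b}" using x assms by auto
    have "norm (P x u v - P x u' v) \<le> N * norm (u - u')"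
    proof (rule field_differentiable_bound[of "{-R..R}" "\<lambda>u. P x u v" "\<lambda>u. Ry (x, u, v)"])
      fix t assume t: "t \<in> {-R..R}"
      show "((\<lambda>u. P x u v) has_field_derivative Ry (x, t, v)) (at t within {-R..R})"
        using P_derivatives(1)[OF xb] by (auto simp: Ry_def intro: has_field_derivative_at_within)
      have "(x, t, v) \<in> ?K" using t x b by auto
      then show "norm (Ry (x, t, v)) \<le> N" using N1 N(2) by (meson image_eqI order_trans)
    qed (use b in auto)
    moreover have "norm (P x u' v - P x u' v') \<le> N * norm (v - v')"
    proof (rule field_differentiable_bound[of "{-R..R}" "\<lambda>v. P x u' v" "\<lambda>v. Rv (x, u', v)"])
      fix t assume t: "t \<in> {-R..R}"
      show "((\<lambda>v. P x u' v) has_field_derivative Rv (x, u', t)) (at t within {-R..R})"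
        using P_derivatives(2)[OF xb] by (auto simp: Rv_def intro: has_field_derivative_at_within)
      have "(x, u', t) \<in> ?K" using t x b by auto
      then show "norm (Rv (x, u', t)) \<le> N" using N2 N(3) by (meson image_eqI order_trans)
    qed (use b in auto)
    ultimately show ?thesis by (simp add: distrib_left)
  qed
  then show ?thesis using N(1) by blast
qed

text \<open>After subtracting the linear part, the derivatives are at most \<open>\<kappa>\<close>
  near the origin by uniform continuity on a compact set; the mean value inequality is applied in
  one variable after the other.\<close>

lemma P_first_order:
  assumes "e < b" "0 < \<kappa>"
  shows "\<exists>\<delta>>0. \<forall>x\<in>{a..e}. \<forall>u v. \<bar>u\<bar> \<le> \<delta> \<longrightarrow> \<bar>v\<bar> \<le> \<delta> \<longrightarrow>
    \<bar>P x u v - P x 0 0 - (Py x * u + Pv x * v)\<bar> \<le> \<kappa> * (\<bar>u\<bar> + \<bar>v\<bar>)"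
proof -
  let ?K = "{a..e} \<times> {-1..1::real} \<times> {-1..1::real}"
  have K: "compact ?K" "?K \<subseteq> {a..<b} \<times> UNIV" using assms by (auto intro!: compact_Times)
  define Ry where "Ry = (\<lambda>(x, u, v). partial_y L (x, y x + u, D y x + v))"
  define Rv where "Rv = (\<lambda>(x, u, v). partial_v L (x, y x + u, D y x + v))"
  have c: "continuous_on ?K Ry" "continuous_on ?K Rv"
    unfolding Ry_def Rv_def
    using continuous_on_shift[OF C1_on_partial_derivatives(3)[OF L_C1]] continuous_on_shift[OF C1_on_partial_derivatives(4)[OF L_C1]] K(2)
    by (auto intro: continuous_on_subset)
  obtain d1 where d1: "d1 > 0" "\<forall>p\<in>?K. \<forall>p'\<in>?K. dist p' p < d1 \<longrightarrow> dist (Ry p') (Ry p) < \<kappa>"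
    using compact_uniformly_continuous[OF c(1) K(1)] assms(2) unfolding uniformly_continuous_on_def by blast
  obtain d2 where d2: "d2 > 0" "\<forall>p\<in>?K. \<forall>p'\<in>?K. dist p' p < d2 \<longrightarrow> dist (Rv p') (Rv p) < \<kappa>"
    using compact_uniformly_continuous[OF c(2) K(1)] assms(2) unfolding uniformly_continuous_on_def by blast
  define \<delta> where "\<delta> = min 1 (min (d1 / 3) (d2 / 3))"
  have \<delta>: "0 < \<delta>" "\<delta> \<le> 1" "3 * \<delta> \<le> d1" "3 * \<delta> \<le> d2" using d1 d2 by (auto simp: \<delta>_def)
  have near: "\<bar>Ry (x, t, t') - Py x\<bar> \<le> \<kappa>" "\<bar>Rv (x, t, t') - Pv x\<bar> \<le> \<kappa>"
    if "x \<in> {a..e}" "\<bar>t\<bar> \<le> \<delta>" "\<bar>t'\<bar> \<le> \<delta>" for x t t'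
  proof -
    have k: "(x, t, t') \<in> ?K" "(x, 0, 0) \<in> ?K" using that \<delta> by auto
    have "dist (x, t, t') (x, 0, 0) \<le> \<bar>t\<bar> + \<bar>t'\<bar>"
      using sqrt_sum_squares_le_sum_abs[of t t'] by (simp add: dist_Pair_Pair dist_real_def)
    then have "dist (x, t, t') (x, 0, 0) < d1" "dist (x, t, t') (x, 0, 0) < d2" using that \<delta> by linarith+
    then have "dist (Ry (x, t, t')) (Ry (x, 0, 0)) < \<kappa>" "dist (Rv (x, t, t')) (Rv (x, 0, 0)) < \<kappa>"
      using d1(2) d2(2) k by blast+
    then show "\<bar>Ry (x, t, t') - Py x\<bar> \<le> \<kappa>" "\<bar>Rv (x, t, t') - Pv x\<bar> \<le> \<kappa>"
      by (simp_all add: Ry_def Rv_def along_def dist_real_def)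
  qed
  have "\<bar>P x u v - P x 0 0 - (Py x * u + Pv x * v)\<bar> \<le> \<kappa> * (\<bar>u\<bar> + \<bar>v\<bar>)"
    if x: "x \<in> {a..e}" and uv: "\<bar>u\<bar> \<le> \<delta>" "\<bar>v\<bar> \<le> \<delta>" for x u v
  proof -
    have xb: "x \<in> {a..<b}" using x assms by auto
    have "norm ((P x u v - Py x * u) - (P x 0 v - Py x * 0)) \<le> \<kappa> * norm (u - 0)"
    proof (rule field_differentiable_bound[of "{-\<delta>..\<delta>}" "\<lambda>u. P x u v - Py x * u" "\<lambda>u. Ry (x, u, v) - Py x"])
      fix t assume t: "t \<in> {-\<delta>..\<delta>}"
      have "((\<lambda>u. P x u v) has_real_derivative Ry (x, t, v)) (at t)"
        using P_derivatives(1)[OF xb] by (simp add: Ry_def)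
      then show "((\<lambda>u. P x u v - Py x * u) has_field_derivative Ry (x, t, v) - Py x) (at t within {-\<delta>..\<delta>})"
        by (auto intro!: derivative_eq_intros intro: has_field_derivative_at_within)
      show "norm (Ry (x, t, v) - Py x) \<le> \<kappa>" using near(1)[OF x, of t v] t uv by auto
    qed (use uv \<delta> in auto)
    moreover have "norm ((P x 0 v - Pv x * v) - (P x 0 0 - Pv x * 0)) \<le> \<kappa> * norm (v - 0)"
    proof (rule field_differentiable_bound[of "{-\<delta>..\<delta>}" "\<lambda>v. P x 0 v - Pv x * v" "\<lambda>v. Rv (x, 0, v) - Pv x"])
      fix t assume t: "t \<in> {-\<delta>..\<delta>}"
      have "((\<lambda>v. P x 0 v) has_real_derivative Rv (x, 0, t)) (at t)"
        using P_derivatives(2)[OF xb, of 0 t] by (simp add: Rv_def)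
      then show "((\<lambda>v. P x 0 v - Pv x * v) has_field_derivative Rv (x, 0, t) - Pv x) (at t within {-\<delta>..\<delta>})"
        by (auto intro!: derivative_eq_intros intro: has_field_derivative_at_within)
      show "norm (Rv (x, 0, t) - Pv x) \<le> \<kappa>" using near(2)[OF x, of 0 t] t \<delta> by auto
    qed (use uv \<delta> in auto)
    ultimately show ?thesis by (simp add: distrib_left)
  qed
  then show ?thesis using \<delta>(1) by blast
qed

lemma perturbation_admissible:
  assumes "C1_from a \<eta>" "\<eta> b = 0"
  shows "(\<lambda>x. P x (\<eta> x) (D \<eta> x)) absolutely_integrable_on {a..b}"
    and "integral {a..b} (\<lambda>x. P x 0 0) \<le> integral {a..b} (\<lambda>x. P x (\<eta> x) (D \<eta> x))"
proof -
  let ?z = "\<lambda>x. y x + \<eta> x"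
  have z: "?z \<in> admissible a b ya yb"
    using y_admissible C1_on_add_C1_from(1)[OF \<alpha>0 \<alpha>1 y_C1 assms(1)] assms(2) C1_fromD(3)[OF assms(1), of a]
    by (simp add: admissible_def)
  have e: "along a \<alpha> L ?z x = P x (\<eta> x) (D \<eta> x)" if "x \<in> {a..b}" for x
    using C1_on_add_C1_from(2)[OF \<alpha>0 \<alpha>1 y_C1 assms(1) that] by (simp add: along_def P_def)
  have e0: "along a \<alpha> L y x = P x 0 0" for x by (simp add: along_def P_def)
  have i: "along a \<alpha> L ?z absolutely_integrable_on {a..b}" by (rule J_defined[OF z])
  show "(\<lambda>x. P x (\<eta> x) (D \<eta> x)) absolutely_integrable_on {a..b}"
    by (rule absolutely_integrable_spike[OF i negligible_empty]) (use e in auto)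
  have "integral {a..b} (along a \<alpha> L y) \<le> integral {a..b} (along a \<alpha> L ?z)"
    using minimal[OF z] set_lebesgue_integral_eq_integral(2)[OF i]
      set_lebesgue_integral_eq_integral(2)[OF J_defined[OF y_admissible]]
    by (simp add: J_functional_def)
  also have "integral {a..b} (along a \<alpha> L ?z) = integral {a..b} (\<lambda>x. P x (\<eta> x) (D \<eta> x))"
    by (rule integral_cong) (use e in auto)
  finally show "integral {a..b} (\<lambda>x. P x 0 0) \<le> integral {a..b} (\<lambda>x. P x (\<eta> x) (D \<eta> x))"
    unfolding e0 .
qed

lemma P00_absolutely_integrable: "(\<lambda>x. P x 0 0) absolutely_integrable_on {a..b}"
  using J_defined[OF y_admissible] by (simp add: along_def[abs_def] P_def)


text \<open>The estimate is \<open>J z \<ge> J y\<close> for \<open>z\<close> which follows \<open>y + \<epsilon> \<eta>\<close> up to \<open>c\<close>, while from \<open>c\<close> on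
  the value \<open>\<epsilon> D \<eta>\<close> of the third argument is realised in the mean by jumping between \<open>0\<close> and
  \<open>D \<theta>\<close>. The cost of the jumps is of the order \<open>\<epsilon>\<close> times a tail of the integral of a fixed integrable
  function, although nothing is known about the derivative of \<open>L\<close> near \<open>b\<close>.\<close>

lemma key_inequality_aux:
  assumes \<eta>: "C1_from a \<eta>" and \<theta>: "C1_from a \<theta>" and ord: "a < c" "c < e0" "e0 < b"
    and \<theta>0: "\<And>x. c \<le> x \<Longrightarrow> \<theta> x = 0" and \<eta>0: "\<And>x. e0 \<le> x \<Longrightarrow> \<eta> x = 0"
    and q0: "\<And>x. x \<in> {c..b} \<Longrightarrow> D \<theta> x \<noteq> 0"
    and wq: "\<And>x. x \<in> {c..b} \<Longrightarrow> 1 \<le> D \<eta> x / D \<theta> x \<and> D \<eta> x / D \<theta> x \<le> B"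
    and \<kappa>: "0 < \<kappa>" "\<kappa> < 1"
    and M1: "1 \<le> M" and M: "\<And>x. x \<in> {a..b} \<Longrightarrow> \<bar>\<eta> x\<bar> \<le> M \<and> \<bar>D \<eta> x\<bar> \<le> M \<and> \<bar>D \<theta> x\<bar> \<le> M"
  shows "- B * integral {c..b} (\<lambda>x. \<bar>P x 0 (D \<theta> x) - P x 0 0\<bar>) - \<kappa> * (3 * M * (b - a) + B + 7)
    \<le> integral {a..c} (\<lambda>x. Py x * \<eta> x + Pv x * D \<eta> x) + integral {c..e0} (\<lambda>x. Py x * \<eta> x)"
proof -
  define w where "w = D \<eta>"
  define q where "q = D \<theta>"
  have cw: "continuous_on {a..b} w" and cq: "continuous_on {a..b} q"
    unfolding w_def q_def by (rule continuous_on_caputo_left[OF \<alpha>0 \<alpha>1 \<eta>] continuous_on_caputo_left[OF \<alpha>0 \<alpha>1 \<theta>])+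
  have cw': "continuous_on S w" and cq': "continuous_on S q" if "S \<subseteq> {a..b}" for S
    using continuous_on_subset[OF cw that] continuous_on_subset[OF cq that] by auto
  have ceta: "continuous_on S \<eta>" for S by (rule C1_fromD(4)[OF \<eta>])
  have B1: "1 \<le> B" using wq[of c] ord by auto
  have Mw: "\<bar>\<eta> x\<bar> \<le> M" "\<bar>w x\<bar> \<le> M" "\<bar>q x\<bar> \<le> M" if "x \<in> {a..b}" for x
    using M[OF that] by (auto simp: w_def q_def)
  have q0': "q x \<noteq> 0" if "x \<in> {c..b}" for x using q0[OF that] by (simp add: q_def)
  have wq': "1 \<le> w x / q x" "w x / q x \<le> B" if "x \<in> {c..b}" for x
    using wq[OF that] by (auto simp: w_def q_def)
  have wn0: "w x \<noteq> 0" if "x \<in> {c..b}" for x using wq'(1)[OF that] by auto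
  define T where "T = integral {c..b} (\<lambda>x. \<bar>P x 0 (q x) - P x 0 0\<bar>)"
  define \<Lambda> where "\<Lambda> = integral {a..c} (\<lambda>x. Py x * \<eta> x + Pv x * w x) + integral {c..e0} (\<lambda>x. Py x * \<eta> x)"
  obtain \<omega> where \<omega>: "0 < \<omega>" "\<And>x. x \<in> {c..b} \<Longrightarrow> \<omega> \<le> \<bar>w x\<bar>"
  proof -
    have "continuous_on {c..b} (\<lambda>x. \<bar>w x\<bar>)" using ord by (intro continuous_intros cw') auto
    then obtain x0 where "x0 \<in> {c..b}" "\<forall>x\<in>{c..b}. \<bar>w x0\<bar> \<le> \<bar>w x\<bar>"
      using continuous_attains_inf[of "{c..b}" "\<lambda>x. \<bar>w x\<bar>"] ord by auto
    then show ?thesis using that[of "\<bar>w x0\<bar>"] wn0[of x0] by auto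
  qed
  have P00: "(\<lambda>x. P x 0 0) integrable_on {s..t}" if "a \<le> s" "t \<le> b" for s t
    by (rule integrable_subinterval_real[OF set_lebesgue_integral_eq_integral(1)[OF P00_absolutely_integrable]]) (use that in auto)
  have aP00: "(\<lambda>x. P x 0 0) absolutely_integrable_on {s..t}" if "a \<le> s" "t \<le> b" for s t
    by (rule set_integrable_subset[OF P00_absolutely_integrable]) (use that in auto)
  \<comment> \<open>Near \<open>b\<close>, where no growth condition on \<open>L\<close> is
    available, the only source of integrability is that \<open>y + \<theta>\<close> is admissible
    and \<open>\<theta> = 0\<close> beyond \<open>c\<close>.\<close>
  have aPq: "(\<lambda>x. P x 0 (q x)) absolutely_integrable_on {c..b}"
  proof -
    have i: "(\<lambda>x. P x (\<theta> x) (D \<theta> x)) absolutely_integrable_on {a..b}"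
      by (rule perturbation_admissible(1)[OF \<theta>]) (use \<theta>0[of b] ord in auto)
    have "(\<lambda>x. P x (\<theta> x) (D \<theta> x)) absolutely_integrable_on {c..b}"
      by (rule set_integrable_subset[OF i]) (use ord in auto)
    then show ?thesis
      by (rule absolutely_integrable_spike[OF _ negligible_empty]) (use \<theta>0 in \<open>auto simp: q_def\<close>)
  qed
  have iT: "(\<lambda>x. \<bar>P x 0 (q x) - P x 0 0\<bar>) integrable_on {c..b}"
    using set_lebesgue_integral_eq_integral(1)[OF absolutely_integrable_norm[OF set_integral_diff(1)[OF aPq aP00]]] ord
    by (simp add: o_def)
  have h_abs: "(\<lambda>x. P x 0 (\<epsilon> * w x)) absolutely_integrable_on {s..b}" if "e0 \<le> s" for \<epsilon> s
  proof -
    have i: "(\<lambda>x. P x (\<epsilon> * \<eta> x) (D (\<lambda>x. \<epsilon> * \<eta> x) x)) absolutely_integrable_on {a..b}"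
      by (rule perturbation_admissible(1)[OF C1_from_cmult(1)[OF \<eta>]]) (use \<eta>0[of b] ord in auto)
    have "(\<lambda>x. P x (\<epsilon> * \<eta> x) (D (\<lambda>x. \<epsilon> * \<eta> x) x)) absolutely_integrable_on {s..b}"
      by (rule set_integrable_subset[OF i]) (use ord that in auto)
    then show ?thesis
      by (rule absolutely_integrable_spike[OF _ negligible_empty])
         (use \<eta>0 that in \<open>auto simp: w_def caputo_left_cmult[OF \<eta>]\<close>)
  qed
  obtain \<delta>1 where \<delta>1: "\<delta>1 > 0" "\<forall>x\<in>{a..e0}. \<forall>u v. \<bar>u\<bar> \<le> \<delta>1 \<longrightarrow> \<bar>v\<bar> \<le> \<delta>1 \<longrightarrow>
      \<bar>P x u v - P x 0 0 - (Py x * u + Pv x * v)\<bar> \<le> \<kappa> * (\<bar>u\<bar> + \<bar>v\<bar>)"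
    using P_first_order[OF ord(3) \<kappa>(1)] by blast
  obtain N0 where N0: "0 \<le> N0" "\<forall>x\<in>{a..e0}. \<forall>u u' v v'. \<bar>u\<bar> \<le> M \<longrightarrow> \<bar>u'\<bar> \<le> M \<longrightarrow> \<bar>v\<bar> \<le> M \<longrightarrow> \<bar>v'\<bar> \<le> M \<longrightarrow>
      \<bar>P x u v - P x u' v'\<bar> \<le> N0 * (\<bar>u - u'\<bar> + \<bar>v - v'\<bar>)"
    using P_Lipschitz[OF ord(3), of M] by blast
  define Z0 where "Z0 = 2 * N0 * M * (b - a)"
  have Z0: "0 \<le> Z0" using N0(1) M1 ab by (simp add: Z0_def)
  \<comment> \<open>The entries ensure in turn \<open>\<epsilon> \<le> 1\<close>, a chattering
    density at most 1, the range of the first order expansion, and a negligible effect of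
    \<open>\<epsilon> * \<eta>\<close> on the cost of a jump.\<close>
  define \<epsilon>1 where "\<epsilon>1 = min 1 (min (1 / B) (min (\<delta>1 / M) (\<kappa> / (Z0 + 1))))"
  have \<epsilon>1: "0 < \<epsilon>1" "\<epsilon>1 \<le> 1" "\<epsilon>1 \<le> 1 / B" "\<epsilon>1 \<le> \<delta>1 / M" "\<epsilon>1 \<le> \<kappa> / (Z0 + 1)"
    using B1 M1 \<delta>1(1) \<kappa> Z0 by (auto simp: \<epsilon>1_def)
  have small: "\<epsilon> \<le> 1" "\<epsilon> * B \<le> 1" "\<epsilon> * M \<le> \<delta>1" "\<epsilon> * Z0 \<le> \<kappa>" if "0 < \<epsilon>" "\<epsilon> \<le> \<epsilon>1" for \<epsilon>
  proof -
    show "\<epsilon> \<le> 1" using that \<epsilon>1 by linarith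
    have "\<epsilon> \<le> 1 / B" "\<epsilon> \<le> \<delta>1 / M" "\<epsilon> \<le> \<kappa> / (Z0 + 1)" using that \<epsilon>1 by linarith+
    then show "\<epsilon> * B \<le> 1" "\<epsilon> * M \<le> \<delta>1" using B1 M1 by (simp_all add: pos_le_divide_eq)
    have "\<epsilon> * Z0 \<le> \<epsilon> * (Z0 + 1)" using that by simp
    also have "\<dots> \<le> \<kappa>" using \<open>\<epsilon> \<le> \<kappa> / (Z0 + 1)\<close> Z0 by (simp add: pos_le_divide_eq)
    finally show "\<epsilon> * Z0 \<le> \<kappa>" .
  qed
  \<comment> \<open>The tolerance for each tail. The parameters are confined to
    \<open>[\<epsilon>1 / 2, \<epsilon>1]\<close>, so \<open>s\<close> is at most
    \<open>\<kappa>\<close> times the parameter finally used and survives the division by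
    it.\<close>
  define s where "s = \<kappa> * \<epsilon>1 / 2"
  have s: "0 < s" using \<kappa> \<epsilon>1 by (simp add: s_def)
  have "\<exists>l' u' e. \<epsilon>1 / 2 \<le> l' \<and> l' < u' \<and> u' \<le> \<epsilon>1 \<and> e0 \<le> e \<and> e < b \<and>
      (\<forall>\<epsilon>\<in>{l'..u'}. integral {e..b} (\<lambda>x. \<bar>P x 0 (\<epsilon> * w x)\<bar>) \<le> s)"
  proof (rule Baire_tail[OF ord(3) _ s h_abs[OF order_refl]])
    show "\<epsilon>1 / 2 < \<epsilon>1" using \<epsilon>1 by simp
    fix e assume e: "e0 \<le> e" "e < b"
    obtain N where N: "0 \<le> N" "\<forall>x\<in>{a..e}. \<forall>u u' v v'. \<bar>u\<bar> \<le> M \<longrightarrow> \<bar>u'\<bar> \<le> M \<longrightarrow> \<bar>v\<bar> \<le> M \<longrightarrow> \<bar>v'\<bar> \<le> M \<longrightarrow>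
        \<bar>P x u v - P x u' v'\<bar> \<le> N * (\<bar>u - u'\<bar> + \<bar>v - v'\<bar>)"
      using P_Lipschitz[OF e(2), of M] by blast
    have "\<bar>P x 0 (\<epsilon> * w x) - P x 0 (\<epsilon>' * w x)\<bar> \<le> N * M * \<bar>\<epsilon> - \<epsilon>'\<bar>"
      if x: "x \<in> {e0..e}" and ee: "\<epsilon> \<in> {\<epsilon>1 / 2..\<epsilon>1}" "\<epsilon>' \<in> {\<epsilon>1 / 2..\<epsilon>1}" for x \<epsilon> \<epsilon>'
    proof -
      have xab: "x \<in> {a..b}" "x \<in> {a..e}" using x e ord by auto
      have b: "\<bar>\<epsilon>'' * w x\<bar> \<le> M" if "\<epsilon>'' \<in> {\<epsilon>1 / 2..\<epsilon>1}" for \<epsilon>''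
        using mult_mono[of "\<bar>\<epsilon>''\<bar>" 1 "\<bar>w x\<bar>" M] that \<epsilon>1 Mw(2)[OF xab(1)] by (auto simp: abs_mult)
      have "\<bar>P x 0 (\<epsilon> * w x) - P x 0 (\<epsilon>' * w x)\<bar> \<le> N * (\<bar>0 - 0\<bar> + \<bar>\<epsilon> * w x - \<epsilon>' * w x\<bar>)"
        using N(2)[rule_format, OF xab(2), of 0 0 "\<epsilon> * w x" "\<epsilon>' * w x"] b[OF ee(1)] b[OF ee(2)] M1 by simp
      also have "\<bar>\<epsilon> * w x - \<epsilon>' * w x\<bar> = \<bar>\<epsilon> - \<epsilon>'\<bar> * \<bar>w x\<bar>" by (simp add: abs_mult[symmetric] left_diff_distrib)
      also have "N * (\<bar>0 - 0\<bar> + \<bar>\<epsilon> - \<epsilon>'\<bar> * \<bar>w x\<bar>) \<le> N * (\<bar>\<epsilon> - \<epsilon>'\<bar> * M)"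
        using Mw(2)[OF xab(1)] N(1) by (auto intro!: mult_left_mono)
      finally show ?thesis by (simp add: mult_ac)
    qed
    then show "\<exists>N. \<forall>x\<in>{e0..e}. \<forall>\<epsilon>\<in>{\<epsilon>1 / 2..\<epsilon>1}. \<forall>\<epsilon>'\<in>{\<epsilon>1 / 2..\<epsilon>1}.
        \<bar>P x 0 (\<epsilon> * w x) - P x 0 (\<epsilon>' * w x)\<bar> \<le> N * \<bar>\<epsilon> - \<epsilon>'\<bar>" by blast
  qed
  then obtain l' u' e' where e': "\<epsilon>1 / 2 \<le> l'" "l' < u'" "u' \<le> \<epsilon>1" "e0 \<le> e'" "e' < b"
      "\<forall>\<epsilon>\<in>{l'..u'}. integral {e'..b} (\<lambda>x. \<bar>P x 0 (\<epsilon> * w x)\<bar>) \<le> s" by blast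
  have iabs: "(\<lambda>x. \<bar>f x\<bar>) integrable_on S" if "f absolutely_integrable_on S" for f :: "real \<Rightarrow> real" and S
    using set_lebesgue_integral_eq_integral(1)[OF absolutely_integrable_norm[OF that]] by (simp add: o_def)
  obtain d where d: "a \<le> d" "d < b" "\<forall>e\<in>{d..b}. \<bar>integral {e..b} (\<lambda>x. \<bar>P x 0 0\<bar>)\<bar> \<le> s"
    using integral_tail_small[OF ab iabs[OF P00_absolutely_integrable] s] by blast
  \<comment> \<open>Chattering stops at \<open>e\<close>: beyond it both the integrand of
    \<open>y\<close> and the one perturbed by any \<open>\<epsilon>\<close> of the Baire interval
    have small integral.\<close>
  define e where "e = max e' d"
  have e: "e0 \<le> e" "e < b" "e' \<le> e" "c \<le> e" "a \<le> e" using e' d ord by (auto simp: e_def)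
  have tail_h: "integral {e..b} (\<lambda>x. \<bar>P x 0 (\<epsilon> * w x)\<bar>) \<le> s" if "\<epsilon> \<in> {l'..u'}" for \<epsilon>
  proof -
    have "integral {e..b} (\<lambda>x. \<bar>P x 0 (\<epsilon> * w x)\<bar>) \<le> integral {e'..b} (\<lambda>x. \<bar>P x 0 (\<epsilon> * w x)\<bar>)"
      using e e' by (intro integral_subset_le iabs h_abs) auto
    then show ?thesis using e'(6) that by force
  qed
  define e2 where "e2 = (e + b) / 2"
  have e2: "e < e2" "e2 < b" "a \<le> e2" using e by (auto simp: e2_def)
  have tail_sub: "\<bar>integral {s'..t} (\<lambda>x. P x 0 0)\<bar> \<le> s" if "e \<le> s'" "s' \<le> t" "t \<le> b" for s' t
  proof -
    have "norm (integral {s'..t} (\<lambda>x. P x 0 0)) \<le> integral {s'..t} (\<lambda>x. \<bar>P x 0 0\<bar>)"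
      using that e by (intro integral_norm_bound_integral P00 iabs aP00) auto
    also have "\<dots> \<le> integral {e..b} (\<lambda>x. \<bar>P x 0 0\<bar>)"
      using that e by (intro integral_subset_le iabs aP00) auto
    also have "\<dots> \<le> s" using bspec[OF d(3), of e] e unfolding e_def by simp
    finally show ?thesis by simp
  qed
  \<comment> \<open>Fixed once \<open>e2 < b\<close> is known and before \<open>r\<close> and
    \<open>\<sigma>\<close>, which may then depend on it. The range \<open>3 * M + 1\<close> covers
    all arguments that occur, including \<open>f\<close> of size \<open>M\<close> and an error of
    size 1.\<close>
  obtain N where N: "0 \<le> N" "\<forall>x\<in>{a..e2}. \<forall>u u' v v'. \<bar>u\<bar> \<le> 3 * M + 1 \<longrightarrow> \<bar>u'\<bar> \<le> 3 * M + 1 \<longrightarrow> \<bar>v\<bar> \<le> 3 * M + 1 \<longrightarrow> \<bar>v'\<bar> \<le> 3 * M + 1 \<longrightarrow>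
      \<bar>P x u v - P x u' v'\<bar> \<le> N * (\<bar>u - u'\<bar> + \<bar>v - v'\<bar>)"
    using P_Lipschitz[OF e2(2), of "3 * M + 1"] by blast
  define \<epsilon>0 where "\<epsilon>0 = (l' + u') / 2"
  define Z1 where "Z1 = N * ((b - a) * (2 * M))"
  have Z1: "0 \<le> Z1" using N(1) M1 ab by (simp add: Z1_def)
  \<comment> \<open>Keeps \<open>\<epsilon>0 - 2 * r\<close> and \<open>\<epsilon>0 + 2 * r\<close>
    in the Baire interval, and makes the replacement of \<open>\<epsilon>\<close> by
    \<open>\<epsilon>0\<close> cost at most \<open>s / 2\<close> on \<open>[a,e2]\<close>.\<close>
  define r where "r = min ((u' - l') / 4) (min 1 (s / (2 * (Z1 + 1))))"
  have r: "0 < r" "r \<le> 1" "r \<le> (u' - l') / 4" "r * Z1 \<le> s / 2"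
  proof -
    show "0 < r" using e' s Z1 by (simp add: r_def)
    show "r \<le> 1" by (simp add: r_def)
    show "r \<le> (u' - l') / 4" unfolding r_def by (rule min.cobounded1)
    have "r * Z1 \<le> s / (2 * (Z1 + 1)) * Z1" using Z1 by (intro mult_right_mono) (auto simp: r_def)
    also have "\<dots> = s / 2 * (Z1 / (Z1 + 1))" by (simp add: times_divide_times_eq)
    also have "\<dots> \<le> s / 2 * 1" using s Z1 by (intro mult_left_mono) auto
    finally show "r * Z1 \<le> s / 2" by simp
  qed
  have epsr: "\<epsilon>0 - 2 * r \<ge> l'" "\<epsilon>0 + 2 * r \<le> u'" using r(3) unfolding \<epsilon>0_def by (simp_all add: field_simps)
  have \<epsilon>0: "0 < \<epsilon>0" "\<epsilon>0 \<le> \<epsilon>1" "\<epsilon>1 / 2 \<le> \<epsilon>0" using e' \<epsilon>1 by (auto simp: \<epsilon>0_def)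
  note sm0 = small[OF \<epsilon>0(1,2)]
  define Z2 where "Z2 = N * ((b - a) * 2 + 1) + 1"
  have Z2: "0 < Z2" using N(1) ab by (simp add: Z2_def add_nonneg_pos)
  \<comment> \<open>The fineness of the chattering: \<open>r * \<omega>\<close> limits the shift
    that averaging has to absorb, the last entry limits the Lipschitz error on
    \<open>[a,e2]\<close>.\<close>
  define \<sigma> where "\<sigma> = min 1 (min (r * \<omega>) (s / (2 * Z2)))"
  have \<sigma>: "0 < \<sigma>" "\<sigma> \<le> 1" "\<sigma> \<le> r * \<omega>" "\<sigma> * Z2 \<le> s / 2"
  proof -
    show "0 < \<sigma>" using r \<omega> s Z2 by (simp add: \<sigma>_def)
    show "\<sigma> \<le> 1" "\<sigma> \<le> r * \<omega>" by (simp_all add: \<sigma>_def)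
    have "\<sigma> * Z2 \<le> s / (2 * Z2) * Z2" using Z2 by (intro mult_right_mono) (auto simp: \<sigma>_def)
    then show "\<sigma> * Z2 \<le> s / 2" using Z2 by simp
  qed
  \<comment> \<open>Exactly the density for which
    \<open>\<epsilon>0 * w + (1_A - \<rho>) * q\<close> equals \<open>1_A * q\<close>: the intended
    small value disappears and only the jumps remain.\<close>
  define \<rho> where "\<rho> x = \<epsilon>0 * (w x / q x)" for x
  define K where "K x = \<bar>P x (\<epsilon>0 * \<eta> x) (q x) - P x (\<epsilon>0 * \<eta> x) 0\<bar>" for x
  have ce: "{c..e} \<subseteq> {a..b}" "{c..e} \<subseteq> {a..<b}" "{c..e} \<subseteq> {c..b}" using ord e by auto
  have crho: "continuous_on {c..e} \<rho>"
    unfolding \<rho>_def using q0' ce by (intro continuous_intros cw' cq') auto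
  have cK: "continuous_on {c..e} K"
    unfolding K_def using ce by (intro continuous_intros continuous_on_P ceta cq') auto
  have rhob: "0 \<le> \<rho> x \<and> \<rho> x \<le> \<epsilon>0 * B" if "x \<in> {c..e}" for x
  proof -
    have "x \<in> {c..b}" using that ce by auto
    from wq'[OF this] show ?thesis
      unfolding \<rho>_def using \<epsilon>0(1) by (intro conjI mult_left_mono mult_nonneg_nonneg) linarith+
  qed
  have p1: "\<epsilon>0 * B \<le> 1" by (rule sm0(2))
  have Qb: "\<bar>q x\<bar> \<le> M" if "x \<in> {c..e}" for x using Mw(3)[of x] that ce by auto
  have K0: "0 \<le> K x" for x by (simp add: K_def)
  define fs where "fs A x = (if x \<in> {c..e} then (indicat_real A x - \<rho> x) * q x else 0)" for A x
  obtain A f X where A: "A \<in> sets lebesgue" and X: "C1_from a X" "\<forall>x\<ge>e2. X x = 0" "\<forall>x\<in>{a..b}. \<bar>X x\<bar> \<le> \<sigma>"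
    and f: "\<forall>x\<ge>e2. f x = 0" "\<forall>x. \<bar>f x\<bar> \<le> M" and DX: "\<forall>x\<in>{a..b}. \<bar>D X x - f x\<bar> \<le> \<sigma>"
    and fi: "(\<lambda>x. \<bar>f x - fs A x\<bar>) integrable_on {a..e2}" "integral {a..e2} (\<lambda>x. \<bar>f x - fs A x\<bar>) \<le> \<sigma>"
    and cost: "integral {c..e} (\<lambda>x. indicat_real A x * K x) \<le> \<epsilon>0 * B * integral {c..e} K + \<sigma>"
    using chatter_perturbation[OF \<alpha>0 \<alpha>1 ord(1) e(4) e2(1,2) \<sigma>(1) crho cq'[OF ce(1)] cK rhob p1 K0 Qb]
    unfolding fs_def by blast
  have cDX: "continuous_on {a..b} (D X)" by (rule continuous_on_caputo_left[OF \<alpha>0 \<alpha>1 X(1)])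
  \<comment> \<open>The chattering \<open>X\<close> is built for \<open>\<epsilon>0\<close>, but the
    multiple of \<open>\<eta>\<close> stays free so that averaging can select it within
    \<open>r\<close> of \<open>\<epsilon>0\<close>.\<close>
  define Z where "Z \<epsilon> x = P x (\<epsilon> * \<eta> x + X x) (\<epsilon> * w x + D X x)" for \<epsilon> x
  have Zadm: "Z \<epsilon> absolutely_integrable_on {a..b}" "integral {a..b} (\<lambda>x. P x 0 0) \<le> integral {a..b} (Z \<epsilon>)" for \<epsilon>
  proof -
    have C: "C1_from a (\<lambda>x. \<epsilon> * \<eta> x + X x)" by (rule C1_from_add(1)[OF C1_from_cmult(1)[OF \<eta>] X(1)])
    have "D (\<lambda>x. \<epsilon> * \<eta> x + X x) x = \<epsilon> * w x + D X x" for x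
      using caputo_left_add[OF \<alpha>1 C1_from_cmult(1)[OF \<eta>] X(1)] caputo_left_cmult[OF \<eta>] by (simp add: w_def)
    then have eq: "(\<lambda>x. P x (\<epsilon> * \<eta> x + X x) (D (\<lambda>x. \<epsilon> * \<eta> x + X x) x)) = Z \<epsilon>" by (simp add: Z_def fun_eq_iff)
    have b0: "\<epsilon> * \<eta> b + X b = 0" using \<eta>0[of b] X(2) ord e2 by auto
    show "Z \<epsilon> absolutely_integrable_on {a..b}" "integral {a..b} (\<lambda>x. P x 0 0) \<le> integral {a..b} (Z \<epsilon>)"
      using perturbation_admissible[OF C b0] unfolding eq by auto
  qed
  have "\<exists>\<epsilon>\<in>{\<epsilon>0 - r..\<epsilon>0 + r}. integral {e2..b} (\<lambda>x. \<bar>(\<lambda>(x, v). P x 0 v) (x, \<epsilon> * w x + D X x)\<bar>) \<le> 3 * s"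
  proof (rule tail_average[OF _ _ _ r(1) s])
    have "continuous_on ({e2..<b} \<times> UNIV) (\<lambda>z :: real \<times> real. L (fst z, y (fst z) + 0, D y (fst z) + snd z))"
    proof -
      have "continuous_on ({e2..<b} \<times> UNIV) (\<lambda>z :: real \<times> real. (fst z, 0::real, snd z))" by (intro continuous_intros)
      moreover have "(\<lambda>z :: real \<times> real. (fst z, 0::real, snd z)) ` ({e2..<b} \<times> UNIV) \<subseteq> {a..<b} \<times> UNIV" using e2 by auto
      ultimately show ?thesis
        using continuous_on_compose2[OF continuous_on_shift[OF C1_on_partial_derivatives(5)[OF L_C1]]] by fastforce
    qed
    then show "continuous_on ({e2..<b} \<times> UNIV) (\<lambda>(x, v). P x 0 v)" by (simp add: P_def case_prod_unfold)
    show "continuous_on {e2..<b} w" "continuous_on {e2..<b} (D X)"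
    proof -
      have sub: "{e2..<b} \<subseteq> {a..b}" using e2 by auto
      show "continuous_on {e2..<b} w" "continuous_on {e2..<b} (D X)"
        using cw'[OF sub] continuous_on_subset[OF cDX sub] by auto
    qed
    show "w x \<noteq> 0 \<and> \<bar>D X x\<bar> \<le> r * \<bar>w x\<bar>" if x: "x \<in> {e2..<b}" for x
    proof
      have x': "x \<in> {c..b}" "x \<in> {a..b}" using x e2 e ord by auto
      show "w x \<noteq> 0" by (rule wn0[OF x'(1)])
      have "\<bar>D X x\<bar> \<le> \<sigma>" using bspec[OF DX x'(2)] f(1) x by auto
      also have "\<dots> \<le> r * \<omega>" by (rule \<sigma>(3))
      also have "\<dots> \<le> r * \<bar>w x\<bar>" using \<omega>(2)[OF x'(1)] r by (intro mult_left_mono) auto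
      finally show "\<bar>D X x\<bar> \<le> r * \<bar>w x\<bar>" .
    qed
    show "(\<lambda>x. (\<lambda>(x, v). P x 0 v) (x, \<epsilon> * w x)) absolutely_integrable_on {e2..b}" for \<epsilon>
      using h_abs[of e2 \<epsilon>] e2 e by simp
    show "integral {e2..b} (\<lambda>x. \<bar>(\<lambda>(x, v). P x 0 v) (x, \<epsilon> * w x)\<bar>) \<le> s" if "\<epsilon> \<in> {\<epsilon>0 - 2 * r..\<epsilon>0 + 2 * r}" for \<epsilon>
    proof -
      have "integral {e2..b} (\<lambda>x. \<bar>P x 0 (\<epsilon> * w x)\<bar>) \<le> integral {e..b} (\<lambda>x. \<bar>P x 0 (\<epsilon> * w x)\<bar>)"
        using e e2 by (intro integral_subset_le iabs h_abs) auto
      also have "\<dots> \<le> s" using that epsr by (intro tail_h) auto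
      finally show ?thesis by simp
    qed
    show "(\<lambda>x. (\<lambda>(x, v). P x 0 v) (x, \<epsilon> * w x + D X x)) absolutely_integrable_on {e2..b}" for \<epsilon>
    proof -
      have "Z \<epsilon> absolutely_integrable_on {e2..b}"
        by (rule set_integrable_subset[OF Zadm(1)]) (use e2 in auto)
      then show ?thesis
        by (rule absolutely_integrable_spike[OF _ negligible_empty]) (use \<eta>0 X(2) e e2 in \<open>auto simp: Z_def\<close>)
    qed
  qed
  then obtain \<epsilon> where \<epsilon>_in: "\<epsilon> \<in> {\<epsilon>0 - r..\<epsilon>0 + r}" and tailZ: "integral {e2..b} (\<lambda>x. \<bar>P x 0 (\<epsilon> * w x + D X x)\<bar>) \<le> 3 * s"
    by auto
  have \<epsilon>: "\<bar>\<epsilon> - \<epsilon>0\<bar> \<le> r" using \<epsilon>_in unfolding abs_le_iff atLeastAtMost_iff by linarith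
  have iZ: "Z \<epsilon> integrable_on {s'..t}" if "a \<le> s'" "t \<le> b" for s' t
    by (rule integrable_subinterval_real[OF set_lebesgue_integral_eq_integral(1)[OF Zadm(1)]]) (use that in auto)
  have tailZ': "integral {e2..b} (Z \<epsilon>) \<le> 3 * s"
  proof -
    have "integral {e2..b} (Z \<epsilon>) \<le> integral {e2..b} (\<lambda>x. \<bar>Z \<epsilon> x\<bar>)"
      using e2 by (intro integral_le iZ iabs set_integrable_subset[OF Zadm(1)]) auto
    also have "\<dots> = integral {e2..b} (\<lambda>x. \<bar>P x 0 (\<epsilon> * w x + D X x)\<bar>)"
      by (rule integral_cong) (use \<eta>0 X(2) e e2 in \<open>auto simp: Z_def\<close>)
    finally show ?thesis using tailZ by simp
  qed
  \<comment> \<open>\<open>2 * \<sigma>\<close> pays for \<open>X\<close> and for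
    \<open>D X - f\<close>, \<open>2 * r * M\<close> for passing from \<open>\<epsilon>\<close> to
    \<open>\<epsilon>0\<close> in both arguments, the last term for replacing \<open>f\<close> by
    the discontinuous control.\<close>
  define err where "err x = N * (2 * \<sigma> + 2 * r * M + \<bar>f x - fs A x\<bar>)" for x
  have ierr: "err integrable_on {a..e2}" unfolding err_def
    by (intro integrable_on_mult_right integrable_add fi(1) integrable_continuous_real[OF continuous_on_const])
  have ierr': "err integrable_on {s'..t}" if "a \<le> s'" "t \<le> e2" for s' t
    by (rule integrable_subinterval_real[OF ierr]) (use that in auto)
  have err_le: "integral {a..e2} err + \<sigma> \<le> s"
  proof -
    have "integral {a..e2} err = N * ((e2 - a) * (2 * \<sigma> + 2 * r * M) + integral {a..e2} (\<lambda>x. \<bar>f x - fs A x\<bar>))"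
      unfolding err_def using fi(1) e2
      by (simp add: integral_add[OF integrable_continuous_real[OF continuous_on_const] fi(1)])
    also have "\<dots> \<le> N * ((b - a) * (2 * \<sigma> + 2 * r * M) + \<sigma>)"
      using N(1) fi(2) e2 \<sigma> r M1 by (intro mult_left_mono add_mono mult_right_mono) auto
    also have "\<dots> = \<sigma> * Z2 - \<sigma> + r * Z1" by (simp add: Z1_def Z2_def algebra_simps)
    finally show ?thesis using \<sigma>(4) r(4) by linarith
  qed
  have near: "\<bar>Z \<epsilon> x - P x (\<epsilon>0 * \<eta> x) (\<epsilon>0 * w x + fs A x)\<bar> \<le> err x" if x: "x \<in> {a..e2}" for x
  proof -
    have xab: "x \<in> {a..b}" using x e2 by auto
    note m = Mw[OF xab]
    have fsM: "\<bar>fs A x\<bar> \<le> M"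
    proof (cases "x \<in> {c..e}")
      case True
      have "\<bar>indicat_real A x - \<rho> x\<bar> * \<bar>q x\<bar> \<le> 1 * M"
        using rhob[OF True] p1 m(3) by (intro mult_mono) (auto simp: indicator_def)
      then show ?thesis using True by (simp add: fs_def abs_mult)
    qed (use M1 in \<open>auto simp: fs_def\<close>)
    have fM: "\<bar>f x\<bar> \<le> M" using f(2) by blast
    have dx: "\<bar>D X x - f x\<bar> \<le> \<sigma>" "\<bar>X x\<bar> \<le> \<sigma>" using DX X(3) xab by auto
    have d1: "\<bar>\<epsilon> * t - \<epsilon>0 * t\<bar> \<le> r * M" if "\<bar>t\<bar> \<le> M" for t
      using mult_mono[OF \<epsilon> that] r by (simp add: abs_mult[symmetric] left_diff_distrib)
    have d0: "\<bar>\<epsilon>0 * t\<bar> \<le> M" if "\<bar>t\<bar> \<le> M" for t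
      using mult_mono[of "\<bar>\<epsilon>0\<bar>" 1 "\<bar>t\<bar>" M] that \<epsilon>0 sm0(1) by (simp add: abs_mult)
    have rM: "r * M \<le> M" using r M1 by simp
    have "\<bar>\<epsilon> * \<eta> x + X x\<bar> \<le> 3 * M + 1" "\<bar>\<epsilon>0 * \<eta> x\<bar> \<le> 3 * M + 1"
      using d1[OF m(1)] d0[OF m(1)] dx \<sigma>(2) rM M1 by linarith+
    moreover have "\<bar>\<epsilon> * w x + D X x\<bar> \<le> 3 * M + 1" "\<bar>\<epsilon>0 * w x + fs A x\<bar> \<le> 3 * M + 1"
      using d1[OF m(2)] d0[OF m(2)] dx \<sigma>(2) rM M1 fsM fM by linarith+
    ultimately have "\<bar>Z \<epsilon> x - P x (\<epsilon>0 * \<eta> x) (\<epsilon>0 * w x + fs A x)\<bar>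
        \<le> N * (\<bar>\<epsilon> * \<eta> x + X x - \<epsilon>0 * \<eta> x\<bar> + \<bar>\<epsilon> * w x + D X x - (\<epsilon>0 * w x + fs A x)\<bar>)"
      using N(2) x unfolding Z_def by blast
    also have "\<dots> \<le> err x" unfolding err_def
      using d1[OF m(1)] d1[OF m(2)] dx by (intro mult_left_mono N(1)) linarith
    finally show ?thesis .
  qed
  have fo: "P x (\<epsilon>0 * \<eta> x) (\<epsilon>0 * v) \<le> P x 0 0 + \<epsilon>0 * (Py x * \<eta> x + Pv x * v) + \<kappa> * \<epsilon>0 * (M + \<bar>v\<bar>)"
    if x: "x \<in> {a..e0}" and v: "\<bar>v\<bar> \<le> M" for x v
  proof -
    have m: "\<bar>\<eta> x\<bar> \<le> M" using Mw(1)[of x] x ord by auto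
    have b: "\<bar>\<epsilon>0 * t\<bar> \<le> \<delta>1" if "\<bar>t\<bar> \<le> M" for t
    proof -
      have "\<bar>\<epsilon>0 * t\<bar> \<le> \<epsilon>0 * M" using that \<epsilon>0(1) by (simp add: abs_mult)
      then show ?thesis using sm0(3) by linarith
    qed
    have "\<bar>P x (\<epsilon>0 * \<eta> x) (\<epsilon>0 * v) - P x 0 0 - (Py x * (\<epsilon>0 * \<eta> x) + Pv x * (\<epsilon>0 * v))\<bar> \<le> \<kappa> * (\<bar>\<epsilon>0 * \<eta> x\<bar> + \<bar>\<epsilon>0 * v\<bar>)"
      using \<delta>1(2) x b[OF m] b[OF v] by blast
    also have "\<dots> = \<kappa> * \<epsilon>0 * (\<bar>\<eta> x\<bar> + \<bar>v\<bar>)" using \<epsilon>0(1) by (simp add: abs_mult algebra_simps)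
    also have "\<dots> \<le> \<kappa> * \<epsilon>0 * (M + \<bar>v\<bar>)" using m \<kappa> \<epsilon>0(1) by (intro mult_left_mono) auto
    moreover have "Py x * (\<epsilon>0 * \<eta> x) + Pv x * (\<epsilon>0 * v) = \<epsilon>0 * (Py x * \<eta> x + Pv x * v)" by (simp add: algebra_simps)
    ultimately show ?thesis unfolding abs_le_iff by linarith
  qed
  have cP1: "continuous_on {a..c} (\<lambda>x. Py x * \<eta> x + Pv x * w x)"
    using ord ab by (intro continuous_intros continuous_on_Py continuous_on_Pv ceta cw') auto
  have cP2: "continuous_on {c..t} (\<lambda>x. Py x * \<eta> x)" if "t < b" for t
    using that ord by (intro continuous_intros continuous_on_Py ceta) auto
  have ci: "(\<lambda>_. k) integrable_on {s'..t}" for k s' t :: real by (rule integrable_continuous_real[OF continuous_on_const])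
  have k0: "0 \<le> \<kappa> * \<epsilon>0 * M" using \<kappa> \<epsilon>0(1) M1 by simp
  have piece1: "integral {a..c} (Z \<epsilon>) \<le> integral {a..c} (\<lambda>x. P x 0 0)
      + \<epsilon>0 * integral {a..c} (\<lambda>x. Py x * \<eta> x + Pv x * w x) + \<kappa> * \<epsilon>0 * M * (2 * (c - a)) + integral {a..c} err"
  proof -
    have i: "(\<lambda>x. P x 0 0) integrable_on {a..c}" "(\<lambda>x. \<epsilon>0 * (Py x * \<eta> x + Pv x * w x)) integrable_on {a..c}"
        "err integrable_on {a..c}"
      using ord e e2 by (auto intro!: P00 ierr' integrable_on_mult_right integrable_continuous_real[OF cP1])
    have "integral {a..c} (Z \<epsilon>) \<le> integral {a..c} (\<lambda>x. P x 0 0 + \<epsilon>0 * (Py x * \<eta> x + Pv x * w x) + \<kappa> * \<epsilon>0 * M * 2 + err x)"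
    proof (rule integral_le_open)
      show "Z \<epsilon> integrable_on {a..c}" using ord by (intro iZ) auto
      show "(\<lambda>x. P x 0 0 + \<epsilon>0 * (Py x * \<eta> x + Pv x * w x) + \<kappa> * \<epsilon>0 * M * 2 + err x) integrable_on {a..c}"
        by (intro integrable_add i ci)
      fix x assume x: "a < x" "x < c"
      have xm: "x \<in> {a..e2}" "x \<in> {a..e0}" "x \<in> {a..b}" using x e e2 ord by auto
      have "fs A x = 0" using x by (simp add: fs_def)
      then have "Z \<epsilon> x \<le> P x (\<epsilon>0 * \<eta> x) (\<epsilon>0 * w x) + err x" using near[OF xm(1)] by (simp add: abs_le_iff)
      moreover have "\<kappa> * \<epsilon>0 * (M + \<bar>w x\<bar>) \<le> \<kappa> * \<epsilon>0 * (M * 2)"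
        using Mw(2)[OF xm(3)] \<kappa> \<epsilon>0(1) by (intro mult_left_mono) auto
      ultimately show "Z \<epsilon> x \<le> P x 0 0 + \<epsilon>0 * (Py x * \<eta> x + Pv x * w x) + \<kappa> * \<epsilon>0 * M * 2 + err x"
        using fo[OF xm(2) Mw(2)[OF xm(3)]] by (simp add: mult_ac)
    qed
    also have "\<dots> = integral {a..c} (\<lambda>x. P x 0 0)
      + \<epsilon>0 * integral {a..c} (\<lambda>x. Py x * \<eta> x + Pv x * w x) + \<kappa> * \<epsilon>0 * M * (2 * (c - a)) + integral {a..c} err"
    proof -
      have "((\<lambda>x. P x 0 0 + \<epsilon>0 * (Py x * \<eta> x + Pv x * w x) + \<kappa> * \<epsilon>0 * M * 2 + err x) has_integral
          (integral {a..c} (\<lambda>x. P x 0 0) + integral {a..c} (\<lambda>x. \<epsilon>0 * (Py x * \<eta> x + Pv x * w x))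
          + integral {a..c} (\<lambda>_. \<kappa> * \<epsilon>0 * M * 2) + integral {a..c} err)) {a..c}"
        by (intro has_integral_add integrable_integral i ci)
      then show ?thesis using ord by (simp add: integral_unique)
    qed
    finally show ?thesis .
  qed
  have Ki: "K integrable_on {c..e}" by (rule integrable_continuous_real[OF cK])
  have iAK: "(\<lambda>x. indicat_real A x * K x) integrable_on {c..e}"
    using set_lebesgue_integral_eq_integral(1)[OF indicator_mult_integrable[OF A cK]] by simp
  have piece2: "integral {c..e} (Z \<epsilon>) \<le> integral {c..e} (\<lambda>x. P x 0 0)
      + \<epsilon>0 * integral {c..e} (\<lambda>x. Py x * \<eta> x) + \<kappa> * \<epsilon>0 * M * (e - c)
      + integral {c..e} (\<lambda>x. indicat_real A x * K x) + integral {c..e} err"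
  proof -
    have i: "(\<lambda>x. P x 0 0) integrable_on {c..e}" "(\<lambda>x. \<epsilon>0 * (Py x * \<eta> x)) integrable_on {c..e}"
        "err integrable_on {c..e}"
      using ord e e2 by (auto intro!: P00 ierr' integrable_on_mult_right integrable_continuous_real[OF cP2])
    have "integral {c..e} (Z \<epsilon>) \<le> integral {c..e} (\<lambda>x. P x 0 0 + \<epsilon>0 * (Py x * \<eta> x) + \<kappa> * \<epsilon>0 * M + indicat_real A x * K x + err x)"
    proof (rule integral_le_open)
      show "Z \<epsilon> integrable_on {c..e}" using ord e by (intro iZ) auto
      show "(\<lambda>x. P x 0 0 + \<epsilon>0 * (Py x * \<eta> x) + \<kappa> * \<epsilon>0 * M + indicat_real A x * K x + err x) integrable_on {c..e}"
        by (intro integrable_add i ci iAK)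
      fix x assume x: "c < x" "x < e"
      have xm: "x \<in> {a..e2}" "x \<in> {c..b}" "x \<in> {c..e}" using x e e2 ord by auto
      \<comment> \<open>On the chattering interval the third argument is either 0 or
        \<open>q x\<close>. Taking 0 as reference, only the \<open>L_y\<close> term appears to first
        order, and a jump costs \<open>K x\<close>.\<close>
      have "\<epsilon>0 * w x + fs A x = indicat_real A x * q x"
        using xm(3) q0'[OF xm(2)] by (simp add: fs_def \<rho>_def left_diff_distrib)
      then have z: "Z \<epsilon> x \<le> P x (\<epsilon>0 * \<eta> x) (indicat_real A x * q x) + err x" using near[OF xm(1)] by (simp add: abs_le_iff)
      have "P x (\<epsilon>0 * \<eta> x) (indicat_real A x * q x) \<le> P x (\<epsilon>0 * \<eta> x) 0 + indicat_real A x * K x"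
        by (cases "x \<in> A") (auto simp: K_def)
      moreover have "P x (\<epsilon>0 * \<eta> x) 0 \<le> P x 0 0 + \<epsilon>0 * (Py x * \<eta> x) + \<kappa> * \<epsilon>0 * M"
      proof (cases "x \<le> e0")
        case True
        then show ?thesis using fo[of x 0] x ord M1 by simp
      next
        case False
        then show ?thesis using \<eta>0[of x] k0 by simp
      qed
      ultimately show "Z \<epsilon> x \<le> P x 0 0 + \<epsilon>0 * (Py x * \<eta> x) + \<kappa> * \<epsilon>0 * M + indicat_real A x * K x + err x"
        using z by linarith
    qed
    also have "\<dots> = integral {c..e} (\<lambda>x. P x 0 0)
      + \<epsilon>0 * integral {c..e} (\<lambda>x. Py x * \<eta> x) + \<kappa> * \<epsilon>0 * M * (e - c)
      + integral {c..e} (\<lambda>x. indicat_real A x * K x) + integral {c..e} err"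
    proof -
      have "((\<lambda>x. P x 0 0 + \<epsilon>0 * (Py x * \<eta> x) + \<kappa> * \<epsilon>0 * M + indicat_real A x * K x + err x) has_integral
          (integral {c..e} (\<lambda>x. P x 0 0) + integral {c..e} (\<lambda>x. \<epsilon>0 * (Py x * \<eta> x))
          + integral {c..e} (\<lambda>_. \<kappa> * \<epsilon>0 * M) + integral {c..e} (\<lambda>x. indicat_real A x * K x) + integral {c..e} err)) {c..e}"
        by (intro has_integral_add integrable_integral i ci iAK)
      then show ?thesis using e by (simp add: integral_unique)
    qed
    finally show ?thesis .
  qed
  have piece3: "integral {e..e2} (Z \<epsilon>) \<le> s + integral {e..e2} err"
  proof -
    have i: "(\<lambda>x. \<bar>P x 0 (\<epsilon>0 * w x)\<bar>) integrable_on {e..b}" by (rule iabs[OF h_abs[OF e(1)]])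
    have i': "(\<lambda>x. \<bar>P x 0 (\<epsilon>0 * w x)\<bar>) integrable_on {e..e2}"
      by (rule integrable_subinterval_real[OF i]) (use e2 in auto)
    have ie: "err integrable_on {e..e2}" using e by (intro ierr') auto
    have "integral {e..e2} (Z \<epsilon>) \<le> integral {e..e2} (\<lambda>x. \<bar>P x 0 (\<epsilon>0 * w x)\<bar> + err x)"
    proof (rule integral_le_open[OF _ integrable_add[OF i' ie]])
      show "Z \<epsilon> integrable_on {e..e2}" using e e2 by (intro iZ) auto
      fix x assume x: "e < x" "x < e2"
      have xm: "x \<in> {a..e2}" using x e by auto
      have "fs A x = 0" "\<eta> x = 0" using x e \<eta>0 by (auto simp: fs_def)
      then have "Z \<epsilon> x \<le> P x 0 (\<epsilon>0 * w x) + err x" using near[OF xm] by (simp add: abs_le_iff)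
      then show "Z \<epsilon> x \<le> \<bar>P x 0 (\<epsilon>0 * w x)\<bar> + err x" by linarith
    qed
    also have "\<dots> = integral {e..e2} (\<lambda>x. \<bar>P x 0 (\<epsilon>0 * w x)\<bar>) + integral {e..e2} err"
      by (rule integral_add[OF i' ie])
    also have "integral {e..e2} (\<lambda>x. \<bar>P x 0 (\<epsilon>0 * w x)\<bar>) \<le> integral {e..b} (\<lambda>x. \<bar>P x 0 (\<epsilon>0 * w x)\<bar>)"
      using e2 by (intro integral_subset_le i i') auto
    also have "\<dots> \<le> s" using epsr r by (intro tail_h) auto
    finally show ?thesis by simp
  qed
  \<comment> \<open>The cost was measured at \<open>\<epsilon>0 * \<eta>\<close>; the Lipschitz
    constant on \<open>[a,e0]\<close> moves it to 0, and beyond \<open>e0\<close> nothing changes as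
    \<open>\<eta>\<close> vanishes.\<close>
  have KT: "integral {c..e} K \<le> T + \<kappa>"
  proof -
    have iTe: "(\<lambda>x. \<bar>P x 0 (q x) - P x 0 0\<bar>) integrable_on {c..e}"
      by (rule integrable_subinterval_real[OF iT]) (use e in auto)
    have "integral {c..e} K \<le> integral {c..e} (\<lambda>x. \<bar>P x 0 (q x) - P x 0 0\<bar> + 2 * N0 * (\<epsilon>0 * M))"
    proof (rule integral_le[OF Ki integrable_add[OF iTe ci]])
      fix x assume x: "x \<in> {c..e}"
      show "K x \<le> \<bar>P x 0 (q x) - P x 0 0\<bar> + 2 * N0 * (\<epsilon>0 * M)"
      proof (cases "x \<le> e0")
        case True
        have xm: "x \<in> {a..e0}" "x \<in> {a..b}" using True x ord by auto
        have "\<bar>\<epsilon>0 * \<eta> x\<bar> \<le> \<epsilon>0 * M" using Mw(1)[OF xm(2)] \<epsilon>0(1) by (simp add: abs_mult)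
        moreover from this have "\<bar>\<epsilon>0 * \<eta> x\<bar> \<le> M" using mult_right_mono[OF sm0(1), of M] M1 by linarith
        ultimately have "\<bar>P x (\<epsilon>0 * \<eta> x) v - P x 0 v\<bar> \<le> N0 * (\<epsilon>0 * M)" if "\<bar>v\<bar> \<le> M" for v
        proof -
          have "\<bar>P x (\<epsilon>0 * \<eta> x) v - P x 0 v\<bar> \<le> N0 * (\<bar>\<epsilon>0 * \<eta> x - 0\<bar> + \<bar>v - v\<bar>)"
            using N0(2)[rule_format, OF xm(1), of "\<epsilon>0 * \<eta> x" 0 v v] \<open>\<bar>\<epsilon>0 * \<eta> x\<bar> \<le> M\<close> that M1 by simp
          also have "\<dots> \<le> N0 * (\<epsilon>0 * M)" using \<open>\<bar>\<epsilon>0 * \<eta> x\<bar> \<le> \<epsilon>0 * M\<close> N0(1) by (intro mult_left_mono) auto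
          finally show ?thesis .
        qed
        from this[OF Mw(3)[OF xm(2)]] this[of 0] show ?thesis using M1 by (simp add: K_def)
      next
        case False
        then show ?thesis using \<eta>0[of x] N0(1) \<epsilon>0(1) M1 by (simp add: K_def)
      qed
    qed
    also have "\<dots> = integral {c..e} (\<lambda>x. \<bar>P x 0 (q x) - P x 0 0\<bar>) + 2 * N0 * (\<epsilon>0 * M) * (e - c)"
      using integral_add[OF iTe ci] e by simp
    also have "\<dots> \<le> T + \<epsilon>0 * Z0"
    proof (rule add_mono)
      show "integral {c..e} (\<lambda>x. \<bar>P x 0 (q x) - P x 0 0\<bar>) \<le> T"
        unfolding T_def using e by (intro integral_subset_le iT iTe) auto
      have "2 * N0 * (\<epsilon>0 * M) * (e - c) \<le> 2 * N0 * (\<epsilon>0 * M) * (b - a)"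
        using N0(1) \<epsilon>0(1) M1 e ord by (intro mult_left_mono) auto
      then show "2 * N0 * (\<epsilon>0 * M) * (e - c) \<le> \<epsilon>0 * Z0" by (simp add: Z0_def mult_ac)
    qed
    finally show ?thesis using sm0(4) by linarith
  qed
  have I2: "integral {c..e} (\<lambda>x. Py x * \<eta> x) = integral {c..e0} (\<lambda>x. Py x * \<eta> x)"
  proof -
    have "integral {e0..e} (\<lambda>x. Py x * \<eta> x) = 0"
      using integral_cong[of "{e0..e}" "\<lambda>x. Py x * \<eta> x" "\<lambda>_. 0"] \<eta>0 by simp
    then show ?thesis
      using Henstock_Kurzweil_Integration.integral_combine[OF _ e(1) integrable_continuous_real[OF cP2[OF e(2)]]] ord by simp
  qed
  have comb: "integral {p1..p3} g = integral {p1..p2} g + integral {p2..p3} g"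
    if "p1 \<le> p2" "p2 \<le> p3" "g integrable_on {p1..p3}" for g :: "real \<Rightarrow> real" and p1 p2 p3
    using Henstock_Kurzweil_Integration.integral_combine[OF that] by simp
  have zz: "integral {a..b} (Z \<epsilon>) = integral {a..c} (Z \<epsilon>) + integral {c..e} (Z \<epsilon>) + integral {e..e2} (Z \<epsilon>) + integral {e2..b} (Z \<epsilon>)"
    using comb[of a c b "Z \<epsilon>"] comb[of c e b "Z \<epsilon>"] comb[of e e2 b "Z \<epsilon>"] iZ ord e e2 by simp
  have pp: "integral {a..b} (\<lambda>x. P x 0 0) = integral {a..c} (\<lambda>x. P x 0 0) + integral {c..e} (\<lambda>x. P x 0 0) + integral {e..b} (\<lambda>x. P x 0 0)"
    using comb[of a c b "\<lambda>x. P x 0 0"] comb[of c e b "\<lambda>x. P x 0 0"] P00 ord e by simp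
  have ee: "integral {a..e2} err = integral {a..c} err + integral {c..e} err + integral {e..e2} err"
    using comb[of a c e2 err] comb[of c e e2 err] ierr' ord e e2 by simp
  have pb: "- s \<le> integral {e..b} (\<lambda>x. P x 0 0)" using tail_sub[of e b] e by auto
  have sk: "s \<le> \<kappa> * \<epsilon>0" using \<epsilon>0(3) \<kappa> mult_left_mono[OF \<epsilon>0(3), of \<kappa>] by (simp add: s_def)
  have len: "\<kappa> * \<epsilon>0 * M * (2 * (c - a)) + \<kappa> * \<epsilon>0 * M * (e - c) \<le> \<epsilon>0 * (\<kappa> * (3 * M * (b - a)))"
  proof -
    have "\<kappa> * \<epsilon>0 * M * (2 * (c - a) + (e - c)) \<le> \<kappa> * \<epsilon>0 * M * (3 * (b - a))"
      using k0 ord e by (intro mult_left_mono) auto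
    then show ?thesis by (simp add: algebra_simps)
  qed
  have KB: "\<epsilon>0 * B * integral {c..e} K \<le> \<epsilon>0 * (B * T + B * \<kappa>)"
  proof -
    have "\<epsilon>0 * B * integral {c..e} K \<le> \<epsilon>0 * B * (T + \<kappa>)"
      using KT \<epsilon>0(1) B1 by (intro mult_left_mono) auto
    then show ?thesis by (simp add: algebra_simps)
  qed
  have LL: "\<epsilon>0 * integral {a..c} (\<lambda>x. Py x * \<eta> x + Pv x * w x) + \<epsilon>0 * integral {c..e} (\<lambda>x. Py x * \<eta> x) = \<epsilon>0 * \<Lambda>"
    unfolding \<Lambda>_def I2 by (simp add: algebra_simps)
  \<comment> \<open>The six portions \<open>s\<close>: three from the averaged tail, one each from
    the tail of \<open>y\<close>, from \<open>[e,e2]\<close>, and from the total error. What is left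
    has the common factor \<open>\<epsilon>0\<close>.\<close>
  have "0 \<le> \<epsilon>0 * \<Lambda> + \<epsilon>0 * (\<kappa> * (3 * M * (b - a))) + \<epsilon>0 * (B * T + B * \<kappa>) + 6 * (\<kappa> * \<epsilon>0)"
    using Zadm(2)[of \<epsilon>] zz pp ee piece1 piece2 piece3 tailZ' pb err_le len KB LL cost sk by linarith
  also have "\<dots> = \<epsilon>0 * (\<Lambda> + \<kappa> * (3 * M * (b - a)) + B * T + B * \<kappa> + 6 * \<kappa>)" by (simp add: algebra_simps)
  finally have "0 \<le> \<Lambda> + \<kappa> * (3 * M * (b - a)) + B * T + B * \<kappa> + 6 * \<kappa>"
    using \<epsilon>0(1) by (simp add: zero_le_mult_iff)
  then show ?thesis using \<kappa> unfolding T_def[symmetric] q_def[symmetric] w_def[symmetric] \<Lambda>_def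
    by (simp add: algebra_simps)
qed

text \<open>The bound \<open>M\<close> is supplied by compactness, and \<open>\<kappa>\<close> tends
  to 0.\<close>

lemma key_inequality:
  assumes \<eta>: "C1_from a \<eta>" and \<theta>: "C1_from a \<theta>" and ord: "a < c" "c < e0" "e0 < b"
    and \<theta>0: "\<And>x. c \<le> x \<Longrightarrow> \<theta> x = 0" and \<eta>0: "\<And>x. e0 \<le> x \<Longrightarrow> \<eta> x = 0"
    and q0: "\<And>x. x \<in> {c..b} \<Longrightarrow> D \<theta> x \<noteq> 0"
    and wq: "\<And>x. x \<in> {c..b} \<Longrightarrow> 1 \<le> D \<eta> x / D \<theta> x \<and> D \<eta> x / D \<theta> x \<le> B"
  shows "- B * integral {c..b} (\<lambda>x. \<bar>P x 0 (D \<theta> x) - P x 0 0\<bar>)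
    \<le> integral {a..c} (\<lambda>x. Py x * \<eta> x + Pv x * D \<eta> x) + integral {c..e0} (\<lambda>x. Py x * \<eta> x)"
proof -
  obtain M1 where M1: "\<And>x. x \<in> {a..b} \<Longrightarrow> \<bar>\<eta> x\<bar> \<le> M1"
    using continuous_on_Icc_bounded[OF C1_fromD(4)[OF \<eta>]] by blast
  obtain M2 where M2: "\<And>x. x \<in> {a..b} \<Longrightarrow> \<bar>D \<eta> x\<bar> \<le> M2"
    using continuous_on_Icc_bounded[OF continuous_on_caputo_left[OF \<alpha>0 \<alpha>1 \<eta>]] by blast
  obtain M3 where M3: "\<And>x. x \<in> {a..b} \<Longrightarrow> \<bar>D \<theta> x\<bar> \<le> M3"
    using continuous_on_Icc_bounded[OF continuous_on_caputo_left[OF \<alpha>0 \<alpha>1 \<theta>]] by blast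
  define M where "M = max 1 (max M1 (max M2 M3))"
  have M: "1 \<le> M" "\<And>x. x \<in> {a..b} \<Longrightarrow> \<bar>\<eta> x\<bar> \<le> M \<and> \<bar>D \<eta> x\<bar> \<le> M \<and> \<bar>D \<theta> x\<bar> \<le> M"
    using M1 M2 M3 by (auto simp: M_def max.coboundedI2 max.coboundedI1)
  have B1: "1 \<le> B" using wq[of c] ord by auto
  define C where "C = 3 * M * (b - a) + B + 7"
  have C: "0 < C" using M B1 ab by (simp add: C_def add_nonneg_pos)
  let ?T = "- B * integral {c..b} (\<lambda>x. \<bar>P x 0 (D \<theta> x) - P x 0 0\<bar>)"
  let ?L = "integral {a..c} (\<lambda>x. Py x * \<eta> x + Pv x * D \<eta> x) + integral {c..e0} (\<lambda>x. Py x * \<eta> x)"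
  show "?T \<le> ?L"
  proof (rule field_le_epsilon)
    fix t :: real assume t: "0 < t"
    define \<kappa> where "\<kappa> = min (1 / 2) (t / C)"
    have k: "0 < \<kappa>" "\<kappa> < 1" using t C by (auto simp: \<kappa>_def)
    have "\<kappa> * C \<le> t / C * C" using C by (intro mult_right_mono) (auto simp: \<kappa>_def)
    then have "\<kappa> * C \<le> t" using C by simp
    moreover have "?T - \<kappa> * C \<le> ?L"
      unfolding C_def by (rule key_inequality_aux[OF \<eta> \<theta> ord \<theta>0 \<eta>0 q0 wq k M])
    ultimately show "?T \<le> ?L + t" by linarith
  qed
qed

end

section \<open>The Euler--Lagrange equation\<close>

lemma RL_right_eq: "RL_right b \<alpha> h s = (LINT u:{s..b}|lebesgue. h u * (u - s) powr (\<alpha> - 1)) / Gamma \<alpha>"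
proof -
  have "(\<lambda>u. h u / (u - s) powr (1 - \<alpha>)) = (\<lambda>u. h u * (u - s) powr (\<alpha> - 1))"
    by (auto simp: powr_minus_divide[of _ "1 - \<alpha>", simplified])
  then show ?thesis by (simp add: RL_right_def)
qed

lemma RL_right_kernel_absolutely_integrable:
  fixes h :: "real \<Rightarrow> real"
  assumes "0 < \<alpha>" "s < e" "continuous_on {s..e} h"
  shows "(\<lambda>u. h u * (u - s) powr (\<alpha> - 1)) absolutely_integrable_on {s..e}"
proof -
  have "(\<lambda>u. (u - s) powr (\<alpha> - 1)) absolutely_integrable_on {s..e}"
    using right_kernel_has_integral[of \<alpha> s s e] assms
    by (intro nonnegative_absolutely_integrable_1) (auto intro: has_integral_integrable)
  then show ?thesis
    using assms by (intro absolutely_integrable_bounded_measurable_product_real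
        compact_imp_bounded compact_continuous_image continuous_imp_measurable_on_sets_lebesgue) auto
qed

text \<open>The integral is split at a point \<open>e\<close> between \<open>m\<close> and
  \<open>b\<close>. On \<open>[s,e]\<close> the function is continuous, and reflection turns the
  integral into a left one. On \<open>[e,b]\<close> it is only integrable, but there the kernel is
  Lipschitz in \<open>s\<close>.\<close>

lemma continuous_on_RL_right:
  fixes h :: "real \<Rightarrow> real"
  assumes \<alpha>: "0 < \<alpha>" "\<alpha> < 1" and ch: "continuous_on {a..<b} h" and ih: "h absolutely_integrable_on {a..b}"
  shows "continuous_on {a..<b} (RL_right b \<alpha> h)"
proof -
  have Gn: "Gamma \<alpha> \<noteq> 0" using Gamma_real_pos[OF \<alpha>(1)] by (metis less_irrefl)
  have loc: "continuous_on {a..m} (RL_right b \<alpha> h)" if m: "a \<le> m" "m < b" for m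
  proof -
    define e where "e = (m + b) / 2"
    have e: "m < e" "e < b" using m by (auto simp: e_def)
    have ch': "continuous_on {s..e} h" if "a \<le> s" for s
      by (rule continuous_on_subset[OF ch]) (use that e in auto)
    have ihe: "h absolutely_integrable_on {e..b}"
      by (rule set_integrable_subset[OF ih]) (use e m in auto)
    define R2 where "R2 s = integral {e..b} (\<lambda>u. h u * (u - s) powr (\<alpha> - 1))" for s
    have a2: "(\<lambda>u. h u * (u - s) powr (\<alpha> - 1)) absolutely_integrable_on {e..b}" if "s \<in> {a..m}" for s
    proof -
      have "continuous_on {e..b} (\<lambda>u. (u - s) powr (\<alpha> - 1))"
        using that e by (intro continuous_intros) auto
      then have "(\<lambda>u. (u - s) powr (\<alpha> - 1) * h u) absolutely_integrable_on {e..b}"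
        by (intro absolutely_integrable_bounded_measurable_product_real compact_imp_bounded
            compact_continuous_image continuous_imp_measurable_on_sets_lebesgue ihe) auto
      then show ?thesis by (simp add: mult.commute)
    qed
    have eq: "RL_right b \<alpha> h s = RL_left (- e) \<alpha> (\<lambda>v. h (- v)) (- s) + R2 s / Gamma \<alpha>" if s: "s \<in> {a..m}" for s
    proof -
      have a1: "(\<lambda>u. h u * (u - s) powr (\<alpha> - 1)) absolutely_integrable_on {s..e}"
        using s e by (intro RL_right_kernel_absolutely_integrable \<alpha> ch') auto
      have u: "{s..e} \<union> {e..b} = {s..b}" using s e by auto
      have a3: "(\<lambda>u. h u * (u - s) powr (\<alpha> - 1)) absolutely_integrable_on {s..b}"
        using set_integrable_Un[OF a1 a2[OF s]] by (simp add: u)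
      have "(LINT u:{s..b}|lebesgue. h u * (u - s) powr (\<alpha> - 1)) = integral {s..b} (\<lambda>u. h u * (u - s) powr (\<alpha> - 1))"
        by (rule set_lebesgue_integral_eq_integral(2)[OF a3])
      also have "\<dots> = integral {s..e} (\<lambda>u. h u * (u - s) powr (\<alpha> - 1)) + R2 s"
        unfolding R2_def using s e set_lebesgue_integral_eq_integral(1)[OF a3]
        by (intro Henstock_Kurzweil_Integration.integral_combine[symmetric]) auto
      also have "integral {s..e} (\<lambda>u. h u * (u - s) powr (\<alpha> - 1))
          = integral {- e..- s} (\<lambda>v. h (- v) * (- s - v) powr (\<alpha> - 1))"
      proof -
        have "- v - s = - s - v" for v :: real by simp
        then show ?thesis
          using Henstock_Kurzweil_Integration.integral_reflect_real[of e s "\<lambda>u. h u * (u - s) powr (\<alpha> - 1)", symmetric]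
          by (simp only:)
      qed
      also have "\<dots> = RL_left (- e) \<alpha> (\<lambda>v. h (- v)) (- s) * Gamma \<alpha>"
      proof -
        have "continuous_on {- e..- s} (\<lambda>v. h (- v))"
          by (rule continuous_on_compose2[OF ch'[of s]]) (use s in \<open>auto intro!: continuous_intros\<close>)
        then show ?thesis using \<alpha> Gn by (simp add: RL_left_eq_integral)
      qed
      finally show ?thesis using Gn by (simp add: RL_right_eq add_divide_distrib)
    qed
    have c1: "continuous_on {a..m} (\<lambda>s. RL_left (- e) \<alpha> (\<lambda>v. h (- v)) (- s))"
    proof (rule continuous_on_compose2[of "{- e..- a}" "RL_left (- e) \<alpha> (\<lambda>v. h (- v))" "{a..m}" "\<lambda>s. - s"])
      have "continuous_on {- e..- a} (\<lambda>v. h (- v))"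
        by (rule continuous_on_compose2[OF ch'[of a]]) (auto intro!: continuous_intros)
      then show "continuous_on {- e..- a} (RL_left (- e) \<alpha> (\<lambda>v. h (- v)))"
        using \<alpha> by (intro continuous_on_RL_left) auto
    qed (use e in \<open>auto intro!: continuous_intros\<close>)
    have c2: "continuous_on {a..m} R2"
    proof -
      \<comment> \<open>A bound for the derivative of the kernel in \<open>s\<close>, valid because
        \<open>u - s\<close> is at least \<open>e - m\<close>.\<close>
      define C where "C = (1 - \<alpha>) * (e - m) powr (\<alpha> - 2)"
      define H where "H = integral {e..b} (\<lambda>u. \<bar>h u\<bar>)"
      have iH: "(\<lambda>u. \<bar>h u\<bar>) integrable_on {e..b}"
        using set_lebesgue_integral_eq_integral(1)[OF absolutely_integrable_norm[OF ihe]] by (simp add: o_def)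
      have H0: "0 \<le> H" "0 \<le> C" unfolding H_def C_def using \<alpha> iH by (auto intro: integral_nonneg)
      have k: "\<bar>(u - s) powr (\<alpha> - 1) - (u - s') powr (\<alpha> - 1)\<bar> \<le> C * \<bar>s - s'\<bar>"
        if u: "u \<in> {e..b}" and s: "s \<in> {a..m}" "s' \<in> {a..m}" for u s s'
      proof -
        have "norm ((u - s) powr (\<alpha> - 1) - (u - s') powr (\<alpha> - 1)) \<le> C * norm (s - s')"
        proof (rule field_differentiable_bound[of "{a..m}" "\<lambda>s. (u - s) powr (\<alpha> - 1)" "\<lambda>s. (1 - \<alpha>) * (u - s) powr (\<alpha> - 2)"])
          fix z assume z: "z \<in> {a..m}"
          then have zu: "e - m \<le> u - z" "0 < u - z" using u e by auto
          have "((\<lambda>s. (u - s) powr (\<alpha> - 1)) has_real_derivative (1 - \<alpha>) * (u - z) powr (\<alpha> - 2)) (at z)"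
            using zu by (auto intro!: derivative_eq_intros simp: algebra_simps)
          then show "((\<lambda>s. (u - s) powr (\<alpha> - 1)) has_field_derivative (1 - \<alpha>) * (u - z) powr (\<alpha> - 2)) (at z within {a..m})"
            by (rule has_field_derivative_at_within)
          have "(u - z) powr (\<alpha> - 2) \<le> (e - m) powr (\<alpha> - 2)"
            using zu e \<alpha> by (intro powr_mono2') auto
          then show "norm ((1 - \<alpha>) * (u - z) powr (\<alpha> - 2)) \<le> C"
            using \<alpha> by (simp add: C_def abs_mult)
        qed (use s in auto)
        then show ?thesis by simp
      qed
      have "\<bar>R2 s - R2 s'\<bar> \<le> C * H * \<bar>s - s'\<bar>" if s: "s \<in> {a..m}" "s' \<in> {a..m}" for s s'
      proof -
        note i = set_lebesgue_integral_eq_integral(1)[OF a2[OF s(1)]] set_lebesgue_integral_eq_integral(1)[OF a2[OF s(2)]]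
        have "R2 s - R2 s' = integral {e..b} (\<lambda>u. h u * (u - s) powr (\<alpha> - 1) - h u * (u - s') powr (\<alpha> - 1))"
          unfolding R2_def by (rule integral_diff[symmetric, OF i])
        also have "norm \<dots> \<le> integral {e..b} (\<lambda>u. C * \<bar>s - s'\<bar> * \<bar>h u\<bar>)"
        proof (rule integral_norm_bound_integral[OF integrable_diff[OF i]])
          show "(\<lambda>u. C * \<bar>s - s'\<bar> * \<bar>h u\<bar>) integrable_on {e..b}" by (intro integrable_on_mult_right iH)
          fix u assume u: "u \<in> {e..b}"
          have "\<bar>h u * (u - s) powr (\<alpha> - 1) - h u * (u - s') powr (\<alpha> - 1)\<bar> = \<bar>h u\<bar> * \<bar>(u - s) powr (\<alpha> - 1) - (u - s') powr (\<alpha> - 1)\<bar>"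
            by (simp add: abs_mult[symmetric] right_diff_distrib)
          also have "\<dots> \<le> \<bar>h u\<bar> * (C * \<bar>s - s'\<bar>)" by (intro mult_left_mono k u s) auto
          finally show "norm (h u * (u - s) powr (\<alpha> - 1) - h u * (u - s') powr (\<alpha> - 1)) \<le> C * \<bar>s - s'\<bar> * \<bar>h u\<bar>"
            by (simp add: mult_ac)
        qed
        also have "\<dots> = C * \<bar>s - s'\<bar> * H" unfolding H_def by (rule integral_mult_right)
        finally show ?thesis by (simp add: mult_ac)
      qed
      then have "(C * H)-lipschitz_on {a..m} R2"
        using H0 by (intro lipschitz_onI) (auto simp: dist_real_def)
      then show ?thesis by (rule lipschitz_on_continuous_on)
    qed
    have "continuous_on {a..m} (\<lambda>s. RL_left (- e) \<alpha> (\<lambda>v. h (- v)) (- s) + R2 s / Gamma \<alpha>)"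
      by (intro continuous_intros c1 c2 ballI Gn)
    then show ?thesis by (rule continuous_on_eq) (simp add: eq)
  qed
  show ?thesis unfolding continuous_on_eq_continuous_within
  proof
    fix x assume x: "x \<in> {a..<b}"
    define m where "m = (x + b) / 2"
    have m: "a \<le> m" "m < b" "x < m" using x by (auto simp: m_def)
    have "continuous (at x within {a..m}) (RL_right b \<alpha> h)"
      using loc[OF m(1,2)] x m(3) by (simp add: continuous_on_eq_continuous_within)
    moreover have "at x within {a..<b} = at x within {a..m}"
      by (rule at_within_nhd[of _ "{..<m}"]) (use m in auto)
    ultimately show "continuous (at x within {a..<b}) (RL_right b \<alpha> h)"
      by (simp add: continuous_within)
  qed
qed

text \<open>A bump supported where \<open>\<psi>\<close> differs from \<open>\<psi> x0\<close> by at
  most \<open>\<epsilon>\<close>: its \<open>\<rho>\<close>-weighted average of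
  \<open>\<psi>\<close> is \<open>\<epsilon>\<close>-close to \<open>\<psi> x0\<close>.\<close>

lemma localized_average:
  fixes \<phi> \<rho> \<psi> :: "real \<Rightarrow> real"
  assumes x0: "a < x0" "x0 < c" and crho: "continuous_on {a..c} \<rho>" and cpsi: "continuous_on {a..c} \<psi>"
    and rho0: "\<And>x. x \<in> {a..c} \<Longrightarrow> 0 < \<rho> x" and \<epsilon>: "0 < \<epsilon>"
  shows "\<exists>\<beta>. C1_from a \<beta> \<and> (\<forall>x\<ge>c. \<beta> x = 0) \<and> 0 < integral {a..c} (\<lambda>x. \<beta> x * \<rho> x) \<and>
    \<bar>integral {a..c} (\<lambda>x. \<beta> x * (\<psi> x * \<rho> x)) - \<psi> x0 * integral {a..c} (\<lambda>x. \<beta> x * \<rho> x)\<bar> \<le> \<epsilon> * integral {a..c} (\<lambda>x. \<beta> x * \<rho> x)"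
proof -
  obtain d where d: "d > 0" "\<forall>x\<in>{a..c}. dist x x0 < d \<longrightarrow> dist (\<psi> x) (\<psi> x0) < \<epsilon>"
    using cpsi x0 \<epsilon> unfolding continuous_on_iff by (metis atLeastAtMost_iff less_imp_le)
  define r where "r = min (d / 2) (min (x0 - a) (c - x0))"
  have r: "0 < r" "r < d" "a \<le> x0 - r" "x0 + r \<le> c" using d x0 by (auto simp: r_def)
  define \<beta> where "\<beta> x = (max 0 ((x - (x0 - r)) * ((x0 + r) - x)))^2" for x
  have B: "C1_from (x0 - r) \<beta>" "\<And>x. x0 + r \<le> x \<Longrightarrow> \<beta> x = 0" "\<And>x. 0 \<le> \<beta> x" "\<And>x. x0 - r < x \<Longrightarrow> x < x0 + r \<Longrightarrow> 0 < \<beta> x"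
    using C1_bump[of "x0 - r" "x0 + r"] r unfolding \<beta>_def[abs_def] by auto
  have Ba: "C1_from a \<beta>" using C1_from_antimono[OF B(1) r(3)] .
  have cbeta: "continuous_on S \<beta>" for S by (rule C1_fromD(4)[OF Ba])
  have i: "(\<lambda>x. \<beta> x * \<rho> x) integrable_on {a..c}" "(\<lambda>x. \<beta> x * (\<psi> x * \<rho> x)) integrable_on {a..c}"
    by (intro integrable_continuous_real continuous_intros cbeta crho cpsi)+
  have nn: "0 \<le> \<beta> x * \<rho> x" if "x \<in> {a..c}" for x using B(3)[of x] rho0[OF that] by simp
  have "integral {a..c} (\<lambda>x. \<beta> x * \<rho> x) \<noteq> 0"
  proof
    assume "integral {a..c} (\<lambda>x. \<beta> x * \<rho> x) = 0"
    then have "((\<lambda>x. \<beta> x * \<rho> x) has_integral 0) {a..c}" using integrable_integral[OF i(1)] by simp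
    moreover have "continuous_on {a..c} (\<lambda>x. \<beta> x * \<rho> x)" by (intro continuous_intros cbeta crho)
    ultimately have "\<beta> x0 * \<rho> x0 = 0"
      using has_integral_0_cbox_imp_0[of a c "\<lambda>x. \<beta> x * \<rho> x" x0] nn x0 by (auto simp: box_ne_empty)
    then show False using B(4)[of x0] rho0[of x0] x0 r by simp
  qed
  moreover have "0 \<le> integral {a..c} (\<lambda>x. \<beta> x * \<rho> x)" by (intro integral_nonneg i nn)
  ultimately have pos: "0 < integral {a..c} (\<lambda>x. \<beta> x * \<rho> x)" by simp
  have "norm (integral {a..c} (\<lambda>x. \<beta> x * (\<psi> x * \<rho> x) - \<psi> x0 * (\<beta> x * \<rho> x))) \<le> integral {a..c} (\<lambda>x. \<epsilon> * (\<beta> x * \<rho> x))"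
  proof (rule integral_norm_bound_integral)
    show "(\<lambda>x. \<beta> x * (\<psi> x * \<rho> x) - \<psi> x0 * (\<beta> x * \<rho> x)) integrable_on {a..c}" "(\<lambda>x. \<epsilon> * (\<beta> x * \<rho> x)) integrable_on {a..c}"
      by (intro integrable_diff integrable_on_mult_right i)+
    fix x assume x: "x \<in> {a..c}"
    have "\<beta> x * (\<psi> x * \<rho> x) - \<psi> x0 * (\<beta> x * \<rho> x) = (\<psi> x - \<psi> x0) * (\<beta> x * \<rho> x)" by (simp add: algebra_simps)
    then have e: "\<bar>\<beta> x * (\<psi> x * \<rho> x) - \<psi> x0 * (\<beta> x * \<rho> x)\<bar> = \<bar>\<psi> x - \<psi> x0\<bar> * (\<beta> x * \<rho> x)"
      using nn[OF x] by (simp only: abs_mult[of "\<psi> x - \<psi> x0" "\<beta> x * \<rho> x"] abs_of_nonneg)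
    show "norm (\<beta> x * (\<psi> x * \<rho> x) - \<psi> x0 * (\<beta> x * \<rho> x)) \<le> \<epsilon> * (\<beta> x * \<rho> x)"
    proof (cases "\<bar>x - x0\<bar> < r")
      case True
      then have "\<bar>\<psi> x - \<psi> x0\<bar> \<le> \<epsilon>" using d(2) x r(2) by (force simp: dist_real_def)
      then show ?thesis unfolding real_norm_def e by (intro mult_right_mono nn x)
    next
      case False
      then have "\<beta> x = 0" using B(2)[of x] C1_fromD(3)[OF B(1), of x] by (cases "x0 \<le> x") auto
      then show ?thesis by simp
    qed
  qed
  then have "\<bar>integral {a..c} (\<lambda>x. \<beta> x * (\<psi> x * \<rho> x)) - \<psi> x0 * integral {a..c} (\<lambda>x. \<beta> x * \<rho> x)\<bar> \<le> \<epsilon> * integral {a..c} (\<lambda>x. \<beta> x * \<rho> x)"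
    using integral_diff[OF i(2) integrable_on_mult_right[OF i(1), of "\<psi> x0"]] by simp
  moreover have "\<forall>x\<ge>c. \<beta> x = 0" using B(2) r by auto
  ultimately show ?thesis using Ba pos by blast
qed

section \<open>Vanishing of the first variation and the lemma of du Bois-Reymond\<close>

context fractional_minimizer begin

text \<open>The term with \<open>L\<^sub>v\<close> is cut off at \<open>c\<close>, since \<open>L\<^sub>v\<close> need not be integrable near \<open>b\<close>.\<close>

definition truncated_variation :: "real \<Rightarrow> real \<Rightarrow> (real \<Rightarrow> real) \<Rightarrow> real" where
  "truncated_variation c e0 \<eta> = integral {a..c} (\<lambda>x. Py x * \<eta> x + Pv x * D \<eta> x) + integral {c..e0} (\<lambda>x. Py x * \<eta> x)"

lemma truncated_variation_linear:
  assumes "C1_from a \<eta>" "C1_from a \<theta>" "a < c" "c < e0" "e0 < b"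
  shows "truncated_variation c e0 (\<lambda>x. \<eta> x + k * \<theta> x) = truncated_variation c e0 \<eta> + k * truncated_variation c e0 \<theta>"
proof -
  have i1: "(\<lambda>x. Py x * f x + Pv x * D f x) integrable_on {a..c}" if "C1_from a f" for f
    using assms C1_fromD(4)[OF that] continuous_on_subset[OF continuous_on_caputo_left[OF \<alpha>0 \<alpha>1 that, of b], of "{a..c}"]
    by (intro integrable_continuous_real continuous_intros continuous_on_Py continuous_on_Pv) auto
  have i2: "(\<lambda>x. Py x * f x) integrable_on {c..e0}" if "C1_from a f" for f
    using assms C1_fromD(4)[OF that] by (intro integrable_continuous_real continuous_intros continuous_on_Py) auto
  have D: "D (\<lambda>x. \<eta> x + k * \<theta> x) x = D \<eta> x + k * D \<theta> x" for x
    using caputo_left_add[OF \<alpha>1 assms(1) C1_from_cmult(1)[OF assms(2)]] caputo_left_cmult[OF assms(2)] by simp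
  have "integral {a..c} (\<lambda>x. Py x * (\<eta> x + k * \<theta> x) + Pv x * D (\<lambda>x. \<eta> x + k * \<theta> x) x)
      = integral {a..c} (\<lambda>x. (Py x * \<eta> x + Pv x * D \<eta> x) + k * (Py x * \<theta> x + Pv x * D \<theta> x))"
    unfolding D by (intro integral_cong) (simp add: algebra_simps)
  also have "\<dots> = integral {a..c} (\<lambda>x. Py x * \<eta> x + Pv x * D \<eta> x) + k * integral {a..c} (\<lambda>x. Py x * \<theta> x + Pv x * D \<theta> x)"
    using integral_add[OF i1[OF assms(1)] integrable_on_mult_right[OF i1[OF assms(2)], of k]] by simp
  finally have 1: "integral {a..c} (\<lambda>x. Py x * (\<eta> x + k * \<theta> x) + Pv x * D (\<lambda>x. \<eta> x + k * \<theta> x) x) = \<dots>" .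
  have "integral {c..e0} (\<lambda>x. Py x * (\<eta> x + k * \<theta> x)) = integral {c..e0} (\<lambda>x. Py x * \<eta> x + k * (Py x * \<theta> x))"
    by (intro integral_cong) (simp add: algebra_simps)
  also have "\<dots> = integral {c..e0} (\<lambda>x. Py x * \<eta> x) + k * integral {c..e0} (\<lambda>x. Py x * \<theta> x)"
    using integral_add[OF i2[OF assms(1)] integrable_on_mult_right[OF i2[OF assms(2)], of k]] by simp
  finally show ?thesis unfolding truncated_variation_def 1 by (simp add: algebra_simps)
qed

text \<open>The one-sided key inequality is applied to \<open>\<eta>\<close> and to
  \<open>-\<eta>\<close>, each shifted by \<open>(B + 1) * \<theta>\<close> to gain the required
  sign; the contribution of \<open>\<theta>\<close> is then removed by linearity.\<close>

lemma truncated_variation_bound: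
  assumes \<eta>: "C1_from a \<eta>" and \<theta>: "C1_from a \<theta>" and ord: "a < c" "c < e0" "e0 < b"
    and \<theta>0: "\<And>x. c \<le> x \<Longrightarrow> \<theta> x = 0" and \<eta>0: "\<And>x. e0 \<le> x \<Longrightarrow> \<eta> x = 0"
    and q0: "\<And>x. x \<in> {c..b} \<Longrightarrow> 0 < D \<theta> x"
    and wq: "\<And>x. x \<in> {c..b} \<Longrightarrow> \<bar>D \<eta> x\<bar> \<le> B * D \<theta> x"
  shows "\<bar>truncated_variation c e0 \<eta>\<bar> \<le> (2 * B + 1) * (integral {c..b} (\<lambda>x. \<bar>P x 0 (D \<theta> x) - P x 0 0\<bar>)
      + integral {c..b} (\<lambda>x. \<bar>P x 0 (- D \<theta> x) - P x 0 0\<bar>))"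
proof -
  have B: "0 \<le> B" using wq[of c] q0[of c] ord by (smt (verit) atLeastAtMost_iff zero_le_mult_iff)
  define T1 where "T1 = integral {c..b} (\<lambda>x. \<bar>P x 0 (D \<theta> x) - P x 0 0\<bar>)"
  define T2 where "T2 = integral {c..b} (\<lambda>x. \<bar>P x 0 (- D \<theta> x) - P x 0 0\<bar>)"
  have low: "- (2 * B + 1) * T1 \<le> truncated_variation c e0 \<zeta> + (B + 1) * truncated_variation c e0 \<theta>"
    if z: "C1_from a \<zeta>" "\<And>x. e0 \<le> x \<Longrightarrow> \<zeta> x = 0" "\<And>x. x \<in> {c..b} \<Longrightarrow> \<bar>D \<zeta> x\<bar> \<le> B * D \<theta> x" for \<zeta>
  proof -
    \<comment> \<open>With coefficient \<open>B + 1\<close> the quotient by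
      \<open>D \<theta>\<close> lies in \<open>[1, 2 * B + 1]\<close>.\<close>
    have C: "C1_from a (\<lambda>x. \<zeta> x + (B + 1) * \<theta> x)" by (rule C1_from_add(1)[OF z(1) C1_from_cmult(1)[OF \<theta>]])
    have D: "D (\<lambda>x. \<zeta> x + (B + 1) * \<theta> x) x = D \<zeta> x + (B + 1) * D \<theta> x" for x
      using caputo_left_add[OF \<alpha>1 z(1) C1_from_cmult(1)[OF \<theta>]] caputo_left_cmult[OF \<theta>] by simp
    have "- (2 * B + 1) * T1 \<le> truncated_variation c e0 (\<lambda>x. \<zeta> x + (B + 1) * \<theta> x)"
      unfolding truncated_variation_def T1_def
    proof (rule key_inequality[OF C \<theta> ord \<theta>0])
      fix x assume x: "x \<in> {c..b}"
      show "D \<theta> x \<noteq> 0" using q0[OF x] by simp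
      have "- (B * D \<theta> x) \<le> D \<zeta> x" "D \<zeta> x \<le> B * D \<theta> x" using z(3)[OF x] by auto
      then show "1 \<le> D (\<lambda>x. \<zeta> x + (B + 1) * \<theta> x) x / D \<theta> x \<and> D (\<lambda>x. \<zeta> x + (B + 1) * \<theta> x) x / D \<theta> x \<le> 2 * B + 1"
        unfolding D using q0[OF x] by (simp add: pos_le_divide_eq pos_divide_le_eq algebra_simps)
    qed (use \<theta>0 z(2) ord in auto)
    then show ?thesis using truncated_variation_linear[OF z(1) \<theta> ord] by simp
  qed
  \<comment> \<open>The key inequality with \<open>-\<theta>\<close> in both roles, where the
    quotient is 1, bounds the first variation of \<open>\<theta>\<close> from above.\<close>
  have neg: "- T2 \<le> - truncated_variation c e0 \<theta>"
  proof -
    have C: "C1_from a (\<lambda>x. - 1 * \<theta> x)" by (rule C1_from_cmult(1)[OF \<theta>])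
    have D: "D (\<lambda>x. - 1 * \<theta> x) x = - D \<theta> x" for x using caputo_left_cmult[OF \<theta>, of \<alpha> "- 1" x] by simp
    have "- 1 * integral {c..b} (\<lambda>x. \<bar>P x 0 (D (\<lambda>x. - 1 * \<theta> x) x) - P x 0 0\<bar>) \<le> truncated_variation c e0 (\<lambda>x. - 1 * \<theta> x)"
      unfolding truncated_variation_def
    proof (rule key_inequality[OF C C ord])
      fix x assume x: "x \<in> {c..b}"
      show "D (\<lambda>x. - 1 * \<theta> x) x \<noteq> 0" using q0[OF x] unfolding D by simp
      show "1 \<le> D (\<lambda>x. - 1 * \<theta> x) x / D (\<lambda>x. - 1 * \<theta> x) x \<and> D (\<lambda>x. - 1 * \<theta> x) x / D (\<lambda>x. - 1 * \<theta> x) x \<le> 1"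
        using q0[OF x] unfolding D by simp
    qed (use \<theta>0 ord in auto)
    moreover have "truncated_variation c e0 (\<lambda>x. - 1 * \<theta> x) = - truncated_variation c e0 \<theta>"
      using truncated_variation_linear[OF C1_from_cmult(1)[OF \<theta>, of 0] \<theta> ord, of "- 1"] truncated_variation_linear[OF C1_from_cmult(1)[OF \<theta>, of 0] \<theta> ord, of 0]
        truncated_variation_linear[OF \<theta> \<theta> ord, of "- 1"] truncated_variation_linear[OF \<theta> \<theta> ord, of "- 2"] by (simp add: algebra_simps)
    ultimately show ?thesis unfolding D T2_def by simp
  qed
  have neg': "(B + 1) * truncated_variation c e0 \<theta> \<le> (B + 1) * T2" using neg B by (intro mult_left_mono) auto
  have T0: "0 \<le> B * T2"
  proof -
    have "0 \<le> T2" unfolding T2_def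
      by (cases "(\<lambda>x. \<bar>P x 0 (- D \<theta> x) - P x 0 0\<bar>) integrable_on {c..b}") (auto simp: not_integrable_integral intro: integral_nonneg)
    then show ?thesis using B by simp
  qed
  have "- truncated_variation c e0 \<eta> \<le> (2 * B + 1) * T1 + (B + 1) * T2" using low[OF \<eta> \<eta>0 wq] neg' by linarith
  moreover have "truncated_variation c e0 \<eta> \<le> (2 * B + 1) * T1 + (B + 1) * T2"
  proof -
    have C: "C1_from a (\<lambda>x. - 1 * \<eta> x)" by (rule C1_from_cmult(1)[OF \<eta>])
    have D: "D (\<lambda>x. - 1 * \<eta> x) x = - D \<eta> x" for x using caputo_left_cmult[OF \<eta>, of \<alpha> "- 1" x] by simp
    have "- (2 * B + 1) * T1 \<le> truncated_variation c e0 (\<lambda>x. - 1 * \<eta> x) + (B + 1) * truncated_variation c e0 \<theta>"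
      by (rule low[OF C]) (use \<eta>0 wq D in auto)
    moreover have "truncated_variation c e0 (\<lambda>x. - 1 * \<eta> x) = - truncated_variation c e0 \<eta>"
      using truncated_variation_linear[OF \<eta> \<eta> ord, of "- 2"] by (simp add: algebra_simps)
    ultimately show ?thesis using neg' by linarith
  qed
  ultimately show ?thesis using T0 unfolding T1_def[symmetric] T2_def[symmetric] by (simp add: algebra_simps abs_le_iff)
qed


text \<open>\<open>\<eta> = J^\<alpha> w\<close> vanishes at \<open>b\<close> but not near it, so it
  is cut off on \<open>[c,e0]\<close> and the cut tends to \<open>b\<close>. The factor in the bound
  for the truncated variation stays fixed, while the integrals in it are tails of fixed integrable
  functions.\<close>

lemma weak_Euler_Lagrange:
  assumes Ly: "Py absolutely_integrable_on {a..b}" and w: "C1_from a w" and ord: "a < c1" "c1 < b"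
    and w0: "\<And>x. c1 \<le> x \<Longrightarrow> w x = 0" and mom: "integral {a..c1} (\<lambda>u. w u * (b - u) powr (\<alpha> - 1)) = 0"
  shows "integral {a..b} (\<lambda>x. Py x * RL_left a \<alpha> w x) + integral {a..c1} (\<lambda>x. Pv x * w x) = 0"
proof -
  define \<eta> where "\<eta> = RL_left a \<alpha> w"
  have \<eta>: "C1_from a \<eta>" unfolding \<eta>_def by (rule C1_from_RL_left(1)[OF \<alpha>0 \<alpha>1 w])
  have D\<eta>: "D \<eta> x = w x" if "a \<le> x" for x unfolding \<eta>_def by (rule caputo_left_RL_left[OF \<alpha>0 \<alpha>1 w that])
  \<comment> \<open>Up to the factor \<open>Gamma \<alpha>\<close>, the moment condition is the
    boundary condition at \<open>b\<close>.\<close>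
  have \<eta>b: "\<eta> b = 0"
  proof -
    have "(\<lambda>u. w u * (b - u) powr (\<alpha> - 1)) integrable_on {a..b}"
      by (rule set_lebesgue_integral_eq_integral(1)[OF kernel_mult_absolutely_integrable[OF \<alpha>0 order_refl C1_fromD(4)[OF w]]])
    moreover have "integral {c1..b} (\<lambda>u. w u * (b - u) powr (\<alpha> - 1)) = 0"
      using integral_cong[of "{c1..b}" "\<lambda>u. w u * (b - u) powr (\<alpha> - 1)" "\<lambda>_. 0"] w0 by simp
    ultimately have "integral {a..b} (\<lambda>u. w u * (b - u) powr (\<alpha> - 1)) = 0"
      using Henstock_Kurzweil_Integration.integral_combine[of a c1 b "\<lambda>u. w u * (b - u) powr (\<alpha> - 1)"] ord mom by simp
    then show ?thesis unfolding \<eta>_def RL_left_eq_integral[OF \<alpha>0 C1_fromD(4)[OF w]] by simp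
  qed
  obtain M0 where M0: "\<And>x. x \<in> {a..b} \<Longrightarrow> \<bar>deriv \<eta> x\<bar> \<le> M0"
    using continuous_on_Icc_bounded[OF C1_fromD(2)[OF \<eta>]] by blast
  define M where "M = max 0 M0"
  have M: "0 \<le> M" "\<And>x. x \<in> {a..b} \<Longrightarrow> \<bar>deriv \<eta> x\<bar> \<le> M" using M0 by (auto simp: M_def max.coboundedI2)
  have etab: "\<bar>\<eta> x\<bar> \<le> M * (b - x)" if x: "x \<in> {a..b}" for x
  proof -
    have "norm (\<eta> x - \<eta> b) \<le> M * norm (x - b)"
      by (rule field_differentiable_bound[of "{a..b}" \<eta> "deriv \<eta>"])
         (use M x C1_fromD(1)[OF \<eta>] ab in \<open>auto intro: has_field_derivative_at_within\<close>)
    then show ?thesis using \<eta>b x by simp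
  qed
  have etaM: "\<bar>\<eta> x\<bar> \<le> M * (b - a)" if x: "x \<in> {a..b}" for x
    using etab[OF x] mult_left_mono[of "b - x" "b - a" M] M x by auto
  define c0 where "c0 = (a + b) / 2"
  have c0: "a < c0" "c0 < b" using ab by (auto simp: c0_def)
  define \<theta> where "\<theta> = (\<lambda>x. - 1 * (max 0 ((x - a) * (c0 - x)))^2)"
  have \<theta>: "C1_from a \<theta>" unfolding \<theta>_def by (rule C1_from_cmult(1)[OF C1_bump(1)[OF c0(1)]])
  have \<theta>0: "\<theta> x = 0" if "c0 \<le> x" for x using C1_bump(3)[OF c0(1) that] by (simp add: \<theta>_def)
  have qpos: "0 < D \<theta> x" if "c0 < x" for x unfolding \<theta>_def by (rule caputo_left_bump_pos[OF \<alpha>0 \<alpha>1 c0(1) that])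
  \<comment> \<open>Strictly to the right of the support of the bump, so that
    \<open>D \<theta>\<close> has a positive minimum on \<open>[cm,b]\<close>; also to the right of
    \<open>c1\<close>, so that \<open>w\<close> vanishes there.\<close>
  define cm where "cm = max ((c0 + b) / 2) c1"
  have cm: "c0 < cm" "cm < b" "c1 \<le> cm" "a < cm"
  proof -
    have "c0 < (c0 + b) / 2" "(c0 + b) / 2 < b" using c0 by (simp_all add: field_simps)
    then show "c0 < cm" "cm < b" "c1 \<le> cm" "a < cm"
      unfolding cm_def less_max_iff_disj max_less_iff_conj using c0 ord by auto
  qed
  obtain qm where qm: "0 < qm" "\<And>x. x \<in> {cm..b} \<Longrightarrow> qm \<le> D \<theta> x"
  proof -
    have "continuous_on {cm..b} (D \<theta>)"
      by (rule continuous_on_subset[OF continuous_on_caputo_left[OF \<alpha>0 \<alpha>1 \<theta>, of b]]) (use cm in auto)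
    then obtain x0 where "x0 \<in> {cm..b}" "\<forall>x\<in>{cm..b}. D \<theta> x0 \<le> D \<theta> x"
      using continuous_attains_inf[of "{cm..b}" "D \<theta>"] cm by auto
    then show ?thesis using that[of "D \<theta> x0"] qpos[of x0] cm by auto
  qed
  define C where "C = (b - a) powr (1 - \<alpha>) / ((1 - \<alpha>) * Gamma (1 - \<alpha>))"
  have C: "0 \<le> C" unfolding C_def using \<alpha>1 Gamma_real_pos[of "1 - \<alpha>"] by simp
  \<comment> \<open>\<open>5 * M\<close> will bound the derivative of every cut-off variation and
    \<open>C\<close> transfers the bound to the Caputo derivative. No quantity here depends on the
    cut.\<close>
  define B where "B = 5 * M * C / qm"
  have B: "0 \<le> B" using M C qm by (simp add: B_def)
  have wc: "continuous_on S w" for S by (rule C1_fromD(4)[OF w])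
  have ec: "continuous_on S \<eta>" for S by (rule C1_fromD(4)[OF \<eta>])
  have aPe: "(\<lambda>x. Py x * f x) absolutely_integrable_on {s'..t}" if "continuous_on {s'..t} f" "a \<le> s'" "t \<le> b" for f s' t
  proof -
    have "Py absolutely_integrable_on {s'..t}" by (rule set_integrable_subset[OF Ly]) (use that in auto)
    then have "(\<lambda>x. f x * Py x) absolutely_integrable_on {s'..t}"
      using that(1) by (intro absolutely_integrable_bounded_measurable_product_real compact_imp_bounded
            compact_continuous_image continuous_imp_measurable_on_sets_lebesgue) auto
    then show ?thesis by (simp add: mult.commute)
  qed
  note iPe = set_lebesgue_integral_eq_integral(1)[OF aPe]
  define I where "I = integral {a..b} (\<lambda>x. Py x * \<eta> x) + integral {a..c1} (\<lambda>x. Pv x * w x)"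
  have "\<bar>I\<bar> \<le> 0"
  proof (rule field_le_epsilon)
    fix t :: real assume t: "0 < t"
    define S where "S = (2 * B + 1) * 2 + 2 * (M * (b - a)) + 1"
    have S: "0 < S" unfolding S_def using B M ab by (intro add_nonneg_pos add_nonneg_nonneg mult_nonneg_nonneg) auto
    define s where "s = t / S"
    have s: "0 < s" "S * s = t" using t S by (auto simp: s_def)
    have iabs: "(\<lambda>x. \<bar>f x\<bar>) integrable_on X" if "f absolutely_integrable_on X" for f :: "real \<Rightarrow> real" and X
      using set_lebesgue_integral_eq_integral(1)[OF absolutely_integrable_norm[OF that]] by (simp add: o_def)
    have dT: "\<exists>d. a \<le> d \<and> d < b \<and> (\<forall>e\<in>{d..b}. \<bar>integral {e..b} (\<lambda>x. \<bar>P x (k * \<theta> x) (k * D \<theta> x) - P x 0 0\<bar>)\<bar> \<le> s)" for k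
    proof (rule integral_tail_small[OF ab iabs s(1)])
      have "(\<lambda>x. P x (k * \<theta> x) (D (\<lambda>x. k * \<theta> x) x)) absolutely_integrable_on {a..b}"
        by (rule perturbation_admissible(1)[OF C1_from_cmult(1)[OF \<theta>]]) (use \<theta>0[of b] c0 in auto)
      then have "(\<lambda>x. P x (k * \<theta> x) (k * D \<theta> x)) absolutely_integrable_on {a..b}"
        by (simp add: caputo_left_cmult[OF \<theta>])
      then show "(\<lambda>x. P x (k * \<theta> x) (k * D \<theta> x) - P x 0 0) absolutely_integrable_on {a..b}"
        by (rule set_integral_diff(1)[OF _ P00_absolutely_integrable])
    qed
    obtain d1 where d1: "d1 < b" "\<forall>e\<in>{d1..b}. \<bar>integral {e..b} (\<lambda>x. \<bar>P x (1 * \<theta> x) (1 * D \<theta> x) - P x 0 0\<bar>)\<bar> \<le> s"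
      using dT[of 1] by blast
    obtain d2 where d2: "d2 < b" "\<forall>e\<in>{d2..b}. \<bar>integral {e..b} (\<lambda>x. \<bar>P x (- 1 * \<theta> x) (- 1 * D \<theta> x) - P x 0 0\<bar>)\<bar> \<le> s"
      using dT[of "- 1"] by blast
    obtain d3 where d3: "d3 < b" "\<forall>e\<in>{d3..b}. \<bar>integral {e..b} (\<lambda>x. \<bar>Py x\<bar>)\<bar> \<le> s"
      using integral_tail_small[OF ab iabs[OF Ly] s(1)] by blast
    define d where "d = max cm (max d1 (max d2 d3))"
    have d: "d < b" "cm \<le> d" "d1 \<le> d" "d2 \<le> d" "d3 \<le> d" using d1 d2 d3 cm by (auto simp: d_def)
    \<comment> \<open>The cutoff interval \<open>[c,e0]\<close> has length \<open>\<delta>\<close>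
      and ends at distance \<open>\<delta>\<close> from \<open>b\<close>, so
      \<open>b - x \<le> 2 * \<delta>\<close> on it.\<close>
    define \<delta> where "\<delta> = (b - d) / 3"
    define c where "c = b - 2 * \<delta>"
    define e0 where "e0 = b - \<delta>"
    have \<delta>: "0 < \<delta>" "d < c" "c < e0" "e0 < b" "e0 - c = \<delta>" "b - c = 2 * \<delta>"
      using d(1) unfolding c_def e0_def \<delta>_def by (simp_all add: field_simps)
    have ac: "a < c" "c1 \<le> c" "c0 < c" using \<delta> d cm by auto
    obtain \<mu> \<mu>' where mu: "\<forall>x. (\<mu> has_real_derivative \<mu>' x) (at x)" "continuous_on UNIV \<mu>'"
      "\<forall>x\<le>c. \<mu> x = 0" "\<forall>x\<ge>e0. \<mu> x = 1" "\<forall>x. 0 \<le> \<mu> x" "\<forall>x. \<mu> x \<le> 1" "\<forall>x. \<bar>\<mu>' x\<bar> \<le> 2 / (e0 - c)"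
      using smooth_step[OF \<delta>(3)] by blast
    have dmu: "((\<lambda>x. 1 - \<mu> x) has_real_derivative - \<mu>' x) (at x)" for x
      using DERIV_diff[OF DERIV_const[of 1] mu(1)[rule_format]] by simp
    have cmu: "continuous_on UNIV (\<lambda>x. - \<mu>' x)" by (intro continuous_on_minus mu(2))
    define \<zeta> where "\<zeta> = (\<lambda>x. (1 - \<mu> x) * \<eta> x)"
    have \<zeta>: "C1_from a \<zeta>" "deriv \<zeta> = (\<lambda>x. - \<mu>' x * \<eta> x + (1 - \<mu> x) * deriv \<eta> x)"
      unfolding \<zeta>_def by (rule C1_from_mult[OF \<eta> dmu cmu])+
    have mu0: "\<mu>' x = 0" if "x < c" for x
    proof -
      have "(\<mu> has_real_derivative 0) (at x)"
        by (rule has_field_derivative_transform_within_open[of "\<lambda>_. 0" _ _ "{..<c}"]) (use that mu(3) in auto)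
      then show ?thesis using mu(1) DERIV_unique by blast
    qed
    have \<zeta>0: "\<zeta> x = 0" if "e0 \<le> x" for x using mu(4) that by (simp add: \<zeta>_def)
    have \<zeta>\<eta>: "\<zeta> x = \<eta> x" if "x \<le> c" for x using mu(3) that by (simp add: \<zeta>_def)
    have \<zeta>M: "\<bar>\<zeta> x\<bar> \<le> M * (b - a)" if x: "x \<in> {a..b}" for x
    proof -
      have "\<bar>1 - \<mu> x\<bar> * \<bar>\<eta> x\<bar> \<le> 1 * (M * (b - a))"
        using mu(5,6)[rule_format, of x] etaM[OF x] by (intro mult_mono) auto
      then show ?thesis by (simp add: \<zeta>_def abs_mult)
    qed
    have d\<zeta>: "\<bar>deriv \<zeta> u\<bar> \<le> 5 * M" if u: "u \<in> {a..b}" for u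
    proof -
      \<comment> \<open>The slope \<open>2 / \<delta>\<close> of the cutoff is compensated by
        \<open>|\<eta>| \<le> M * (2 * \<delta>)\<close>.\<close>
      have "\<bar>\<mu>' u * \<eta> u\<bar> \<le> 4 * M"
      proof (cases "u < c")
        case True
        then show ?thesis using mu0 M by simp
      next
        case False
        have "\<bar>\<eta> u\<bar> \<le> M * (2 * \<delta>)"
          using etab[OF u] mult_left_mono[of "b - u" "2 * \<delta>" M] M False \<delta>(6) by auto
        then have "\<bar>\<mu>' u\<bar> * \<bar>\<eta> u\<bar> \<le> 2 / \<delta> * (M * (2 * \<delta>))"
          using mu(7)[rule_format, of u] \<delta> by (intro mult_mono) auto
        then show ?thesis using \<delta>(1) by (simp add: abs_mult)
      qed
      moreover have "\<bar>(1 - \<mu> u) * deriv \<eta> u\<bar> \<le> 1 * M"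
        unfolding abs_mult using mu(5,6)[rule_format, of u] M(2)[OF u] by (intro mult_mono) auto
      ultimately show ?thesis
        using abs_triangle_ineq[of "- \<mu>' u * \<eta> u" "(1 - \<mu> u) * deriv \<eta> u"] by (simp add: \<zeta>(2))
    qed
    have wq: "\<bar>D \<zeta> x\<bar> \<le> B * D \<theta> x" if x: "x \<in> {c..b}" for x
    proof -
      have "\<bar>D \<zeta> x\<bar> \<le> 5 * M * C"
        unfolding C_def using d\<zeta> x ac M by (intro caputo_left_bound \<alpha>0 \<alpha>1 \<zeta>(1)) auto
      also have "\<dots> = B * qm" using qm by (simp add: B_def)
      also have "\<dots> \<le> B * D \<theta> x" using qm(2)[of x] x \<delta> d B by (intro mult_left_mono) auto
      finally show ?thesis .
    qed
    have bound: "\<bar>truncated_variation c e0 \<zeta>\<bar> \<le> (2 * B + 1) * (s + s)"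
    proof -
      have "\<bar>truncated_variation c e0 \<zeta>\<bar> \<le> (2 * B + 1) * (integral {c..b} (\<lambda>x. \<bar>P x 0 (D \<theta> x) - P x 0 0\<bar>)
          + integral {c..b} (\<lambda>x. \<bar>P x 0 (- D \<theta> x) - P x 0 0\<bar>))"
        using \<theta>0 \<zeta>0 qpos wq ac \<delta> by (intro truncated_variation_bound \<zeta>(1) \<theta>) auto
      also have "integral {c..b} (\<lambda>x. \<bar>P x 0 (D \<theta> x) - P x 0 0\<bar>)
          = integral {c..b} (\<lambda>x. \<bar>P x (1 * \<theta> x) (1 * D \<theta> x) - P x 0 0\<bar>)"
        by (rule integral_cong) (use \<theta>0 ac in auto)
      also have "integral {c..b} (\<lambda>x. \<bar>P x 0 (- D \<theta> x) - P x 0 0\<bar>)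
          = integral {c..b} (\<lambda>x. \<bar>P x (- 1 * \<theta> x) (- 1 * D \<theta> x) - P x 0 0\<bar>)"
        by (rule integral_cong) (use \<theta>0 ac in auto)
      also have "(2 * B + 1) * (integral {c..b} (\<lambda>x. \<bar>P x (1 * \<theta> x) (1 * D \<theta> x) - P x 0 0\<bar>)
          + integral {c..b} (\<lambda>x. \<bar>P x (- 1 * \<theta> x) (- 1 * D \<theta> x) - P x 0 0\<bar>)) \<le> (2 * B + 1) * (s + s)"
      proof (intro mult_left_mono add_mono)
        have "c \<in> {d1..b}" "c \<in> {d2..b}" using \<delta> d by auto
        then show "integral {c..b} (\<lambda>x. \<bar>P x (1 * \<theta> x) (1 * D \<theta> x) - P x 0 0\<bar>) \<le> s"
          "integral {c..b} (\<lambda>x. \<bar>P x (- 1 * \<theta> x) (- 1 * D \<theta> x) - P x 0 0\<bar>) \<le> s"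
          using d1(2) d2(2) abs_le_D1 by blast+
      qed (use B in auto)
      finally show ?thesis .
    qed
    have tail: "\<bar>integral {s'..t'} (\<lambda>x. Py x * f x)\<bar> \<le> M * (b - a) * s"
      if f: "continuous_on {s'..t'} f" "\<And>x. x \<in> {a..b} \<Longrightarrow> \<bar>f x\<bar> \<le> M * (b - a)" and st: "c \<le> s'" "t' \<le> b" for f s' t'
    proof -
      have i: "(\<lambda>x. \<bar>Py x\<bar>) integrable_on {u..v}" if "a \<le> u" "v \<le> b" for u v
        by (rule integrable_subinterval_real[OF iabs[OF Ly]]) (use that in auto)
      have "norm (integral {s'..t'} (\<lambda>x. Py x * f x)) \<le> integral {s'..t'} (\<lambda>x. M * (b - a) * \<bar>Py x\<bar>)"
      proof (rule integral_norm_bound_integral)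
        show "(\<lambda>x. Py x * f x) integrable_on {s'..t'}" using st ac by (intro iPe f) auto
        show "(\<lambda>x. M * (b - a) * \<bar>Py x\<bar>) integrable_on {s'..t'}" using st ac by (intro integrable_on_mult_right i) auto
        fix x assume x: "x \<in> {s'..t'}"
        have "\<bar>Py x\<bar> * \<bar>f x\<bar> \<le> \<bar>Py x\<bar> * (M * (b - a))" using f(2)[of x] x st ac by (intro mult_left_mono) auto
        then show "norm (Py x * f x) \<le> M * (b - a) * \<bar>Py x\<bar>" by (simp add: abs_mult mult.commute)
      qed
      also have "\<dots> = M * (b - a) * integral {s'..t'} (\<lambda>x. \<bar>Py x\<bar>)" by (rule integral_mult_right)
      also have "\<dots> \<le> M * (b - a) * s"
      proof (rule mult_left_mono)
        have "integral {s'..t'} (\<lambda>x. \<bar>Py x\<bar>) \<le> integral {c..b} (\<lambda>x. \<bar>Py x\<bar>)"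
          using st ac by (intro integral_subset_le i) auto
        also have "\<dots> \<le> s" using bspec[OF d3(2), of c] \<delta> d by auto
        finally show "integral {s'..t'} (\<lambda>x. \<bar>Py x\<bar>) \<le> s" .
      qed (use M ab in auto)
      finally show ?thesis by simp
    qed
    have "truncated_variation c e0 \<zeta> = integral {a..c} (\<lambda>x. Py x * \<eta> x) + integral {a..c1} (\<lambda>x. Pv x * w x) + integral {c..e0} (\<lambda>x. Py x * \<zeta> x)"
    proof -
      \<comment> \<open>The Caputo derivative depends only on the past, and up to \<open>c\<close>
        the cutoff has not begun.\<close>
      have "D \<zeta> x = w x" if x: "x \<in> {a..c}" for x
      proof -
        have "D \<zeta> x = D \<eta> x"
          by (rule caputo_left_cong) (use x mu0 mu(3) in \<open>auto simp: \<zeta>(2)\<close>)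
        then show ?thesis using D\<eta>[of x] x by simp
      qed
      then have "integral {a..c} (\<lambda>x. Py x * \<zeta> x + Pv x * D \<zeta> x) = integral {a..c} (\<lambda>x. Py x * \<eta> x + Pv x * w x)"
        by (intro integral_cong) (use \<zeta>\<eta> in auto)
      moreover have iPv: "(\<lambda>x. Pv x * w x) integrable_on {a..c}"
        using \<delta> d by (intro integrable_continuous_real continuous_intros continuous_on_Pv wc) auto
      moreover have "integral {a..c} (\<lambda>x. Pv x * w x) = integral {a..c1} (\<lambda>x. Pv x * w x)"
      proof -
        have "integral {c1..c} (\<lambda>x. Pv x * w x) = 0"
          using integral_cong[of "{c1..c}" "\<lambda>x. Pv x * w x" "\<lambda>_. 0"] w0 by simp
        then show ?thesis
          using Henstock_Kurzweil_Integration.integral_combine[OF _ ac(2) iPv] ord by simp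
      qed
      moreover have "(\<lambda>x. Py x * \<eta> x) integrable_on {a..c}" using \<delta> by (intro iPe ec) auto
      ultimately show ?thesis unfolding truncated_variation_def by (simp add: integral_add)
    qed
    moreover have "integral {a..b} (\<lambda>x. Py x * \<eta> x) = integral {a..c} (\<lambda>x. Py x * \<eta> x) + integral {c..b} (\<lambda>x. Py x * \<eta> x)"
      using ac \<delta> by (intro Henstock_Kurzweil_Integration.integral_combine[symmetric] iPe ec) auto
    ultimately have "I = truncated_variation c e0 \<zeta> + integral {c..b} (\<lambda>x. Py x * \<eta> x) - integral {c..e0} (\<lambda>x. Py x * \<zeta> x)"
      unfolding I_def by simp
    moreover have "\<bar>integral {c..b} (\<lambda>x. Py x * \<eta> x)\<bar> \<le> M * (b - a) * s"
      by (rule tail[OF ec etaM]) auto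
    moreover have "\<bar>integral {c..e0} (\<lambda>x. Py x * \<zeta> x)\<bar> \<le> M * (b - a) * s"
      by (rule tail[OF C1_fromD(4)[OF \<zeta>(1)] \<zeta>M]) (use \<delta> in auto)
    ultimately have "\<bar>I\<bar> \<le> (2 * B + 1) * (s + s) + M * (b - a) * s + M * (b - a) * s" using bound by linarith
    also have "\<dots> \<le> S * s" using s unfolding S_def by (simp add: algebra_simps)
    finally show "\<bar>I\<bar> \<le> 0 + t" using s by simp
  qed
  then show ?thesis unfolding I_def \<eta>_def by simp
qed

text \<open>Fractional integration by parts: Fubini moves \<open>J^\<alpha>\<close> from
  \<open>w\<close> to \<open>L_y\<close>, where it becomes the right integral.\<close>

lemma Euler_Lagrange_tested:
  assumes Ly: "Py absolutely_integrable_on {a..b}" and w: "C1_from a w" and ord: "a < c1" "c1 < b"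
    and w0: "\<And>x. c1 \<le> x \<Longrightarrow> w x = 0" and mom: "integral {a..c1} (\<lambda>u. w u * (b - u) powr (\<alpha> - 1)) = 0"
  shows "integral {a..c1} (\<lambda>x. w x * (RL_right b \<alpha> Py x + Pv x)) = 0"
proof -
  define R where "R s = (LINT u:{s..b}|lebesgue. Py u * (u - s) powr (\<alpha> - 1))" for s
  have wc: "continuous_on S w" for S by (rule C1_fromD(4)[OF w])
  have cPy: "continuous_on {a..<b} Py" by (rule continuous_on_Py) simp
  have "integral {a..b} (\<lambda>x. Py x * RL_left a \<alpha> w x)
      = integral {a..b} (\<lambda>u. Py u * integral {a..u} (\<lambda>s. w s * (u - s) powr (\<alpha> - 1))) / Gamma \<alpha>"
    unfolding RL_left_eq_integral[OF \<alpha>0 wc] by (subst integral_divide[symmetric]) simp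
  also have "integral {a..b} (\<lambda>u. Py u * integral {a..u} (\<lambda>s. w s * (u - s) powr (\<alpha> - 1))) = integral {a..b} (\<lambda>s. w s * R s)"
    unfolding R_def by (rule RL_Fubini(2)[OF ab \<alpha>0 cPy Ly wc])
  also have "\<dots> / Gamma \<alpha> = integral {a..b} (\<lambda>s. w s * RL_right b \<alpha> Py s)"
    unfolding RL_right_eq R_def[symmetric] by (subst integral_divide[symmetric]) simp
  also have "\<dots> = integral {a..c1} (\<lambda>s. w s * RL_right b \<alpha> Py s)"
  proof -
    have "(\<lambda>s. w s * R s) integrable_on {a..b}"
      using set_lebesgue_integral_eq_integral(1)[OF RL_Fubini(1)[OF ab \<alpha>0 cPy Ly wc]] unfolding R_def .
    then have "(\<lambda>s. w s * R s / Gamma \<alpha>) integrable_on {a..b}" by (rule integrable_on_divide)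
    then have i: "(\<lambda>s. w s * RL_right b \<alpha> Py s) integrable_on {a..b}"
      unfolding RL_right_eq R_def[symmetric] by simp
    have "integral {c1..b} (\<lambda>s. w s * RL_right b \<alpha> Py s) = 0"
      using integral_cong[of "{c1..b}" "\<lambda>s. w s * RL_right b \<alpha> Py s" "\<lambda>_. 0"] w0 by simp
    then show ?thesis
      using Henstock_Kurzweil_Integration.integral_combine[OF _ _ i, of c1] ord by simp
  qed
  finally have 1: "integral {a..b} (\<lambda>x. Py x * RL_left a \<alpha> w x) = integral {a..c1} (\<lambda>s. w s * RL_right b \<alpha> Py s)" .
  have cR: "continuous_on {a..c1} (RL_right b \<alpha> Py)"
    by (rule continuous_on_subset[OF continuous_on_RL_right[OF \<alpha>0 \<alpha>1 cPy Ly]]) (use ord in auto)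
  have "(\<lambda>s. w s * RL_right b \<alpha> Py s) integrable_on {a..c1}" "(\<lambda>x. w x * Pv x) integrable_on {a..c1}"
    using ord by (auto intro!: integrable_continuous_real continuous_intros wc cR continuous_on_Pv)
  then have "integral {a..c1} (\<lambda>x. w x * (RL_right b \<alpha> Py x + Pv x))
      = integral {a..c1} (\<lambda>s. w s * RL_right b \<alpha> Py s) + integral {a..c1} (\<lambda>x. Pv x * w x)"
    by (simp add: distrib_left integral_add mult.commute)
  then show ?thesis using weak_Euler_Lagrange[OF Ly w ord w0 mom] 1 by simp
qed

text \<open>The left side \<open>\<phi>\<close> annihilates every test function orthogonal to
  \<open>\<rho> = (b - x) powr (\<alpha> - 1)\<close>, so it should be a multiple of
  \<open>\<rho>\<close>. In terms of the quotient \<open>\<psi>\<close> this is constancy, as in the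
  lemma of du Bois-Reymond.\<close>

lemma Euler_Lagrange:
  assumes Ly: "Py absolutely_integrable_on {a..b}"
  shows "\<exists>K. \<forall>x\<in>{a..<b}. RL_right b \<alpha> Py x + Pv x = K / (b - x) powr (1 - \<alpha>)"
proof -
  define \<phi> where "\<phi> x = RL_right b \<alpha> Py x + Pv x" for x
  define \<psi> where "\<psi> x = \<phi> x * (b - x) powr (1 - \<alpha>)" for x
  define \<rho> where "\<rho> x = (b - x) powr (\<alpha> - 1)" for x
  have cPy: "continuous_on {a..<b} Py" by (rule continuous_on_Py) simp
  have cphi: "continuous_on {a..<b} \<phi>"
    unfolding \<phi>_def by (intro continuous_on_add continuous_on_RL_right[OF \<alpha>0 \<alpha>1 cPy Ly] continuous_on_Pv) simp
  have cpsi: "continuous_on {a..<b} \<psi>"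
    unfolding \<psi>_def by (intro continuous_on_mult cphi continuous_intros) auto
  have crho: "continuous_on {a..<b} \<rho>" unfolding \<rho>_def by (intro continuous_intros) auto
  have \<psi>\<rho>: "\<psi> x * \<rho> x = \<phi> x" if "x < b" for x
  proof -
    have "(b - x) powr (1 - \<alpha>) * (b - x) powr (\<alpha> - 1) = 1" using that by (simp add: powr_add[symmetric])
    then show ?thesis by (simp add: \<psi>_def \<rho>_def mult.assoc)
  qed
  have const: "\<psi> x1 = \<psi> x2" if x12: "x1 \<in> {a<..<b}" "x2 \<in> {a<..<b}" for x1 x2
  proof (rule ccontr)
    assume ne: "\<psi> x1 \<noteq> \<psi> x2"
    define \<epsilon> where "\<epsilon> = \<bar>\<psi> x1 - \<psi> x2\<bar> / 3"
    have \<epsilon>: "0 < \<epsilon>" using ne by (simp add: \<epsilon>_def)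
    define c where "c = (max x1 x2 + b) / 2"
    have c: "a < c" "c < b" "x1 < c" "x2 < c" using x12 by (auto simp: c_def max_def)
    have sub: "{a..c} \<subseteq> {a..<b}" using c by auto
    note cont = continuous_on_subset[OF crho sub] continuous_on_subset[OF cpsi sub] continuous_on_subset[OF cphi sub]
    have rho_pos: "0 < \<rho> x" if "x \<in> {a..c}" for x using that c by (auto simp: \<rho>_def)
    have la: "\<exists>\<beta>. C1_from a \<beta> \<and> (\<forall>x\<ge>c. \<beta> x = 0) \<and> 0 < integral {a..c} (\<lambda>x. \<beta> x * \<rho> x) \<and>
        \<bar>integral {a..c} (\<lambda>x. \<beta> x * \<phi> x) - \<psi> x0 * integral {a..c} (\<lambda>x. \<beta> x * \<rho> x)\<bar> \<le> \<epsilon> * integral {a..c} (\<lambda>x. \<beta> x * \<rho> x)"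
      if "a < x0" "x0 < c" for x0
    proof -
      have "integral {a..c} (\<lambda>x. \<beta> x * (\<psi> x * \<rho> x)) = integral {a..c} (\<lambda>x. \<beta> x * \<phi> x)" for \<beta>
        by (rule integral_cong) (use \<psi>\<rho> c in auto)
      then show ?thesis using localized_average[OF that cont(1,2) rho_pos \<epsilon>] by simp
    qed
    obtain \<beta>1 where b1: "C1_from a \<beta>1" "\<forall>x\<ge>c. \<beta>1 x = 0" "0 < integral {a..c} (\<lambda>x. \<beta>1 x * \<rho> x)"
        "\<bar>integral {a..c} (\<lambda>x. \<beta>1 x * \<phi> x) - \<psi> x1 * integral {a..c} (\<lambda>x. \<beta>1 x * \<rho> x)\<bar> \<le> \<epsilon> * integral {a..c} (\<lambda>x. \<beta>1 x * \<rho> x)"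
      using la[of x1] x12 c by auto
    obtain \<beta>2 where b2: "C1_from a \<beta>2" "\<forall>x\<ge>c. \<beta>2 x = 0" "0 < integral {a..c} (\<lambda>x. \<beta>2 x * \<rho> x)"
        "\<bar>integral {a..c} (\<lambda>x. \<beta>2 x * \<phi> x) - \<psi> x2 * integral {a..c} (\<lambda>x. \<beta>2 x * \<rho> x)\<bar> \<le> \<epsilon> * integral {a..c} (\<lambda>x. \<beta>2 x * \<rho> x)"
      using la[of x2] x12 c by auto
    define N1 where "N1 = integral {a..c} (\<lambda>x. \<beta>1 x * \<rho> x)"
    define N2 where "N2 = integral {a..c} (\<lambda>x. \<beta>2 x * \<rho> x)"
    define I1 where "I1 = integral {a..c} (\<lambda>x. \<beta>1 x * \<phi> x)"
    define I2 where "I2 = integral {a..c} (\<lambda>x. \<beta>2 x * \<phi> x)"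
    have N: "0 < N1" "0 < N2" "\<bar>I1 - \<psi> x1 * N1\<bar> \<le> \<epsilon> * N1" "\<bar>I2 - \<psi> x2 * N2\<bar> \<le> \<epsilon> * N2"
      using b1 b2 by (simp_all add: N1_def N2_def I1_def I2_def)
    have cb: "continuous_on S \<beta>1" "continuous_on S \<beta>2" for S using C1_fromD(4) b1(1) b2(1) by blast+
    have lin: "integral {a..c} (\<lambda>x. (N2 * \<beta>1 x + - N1 * \<beta>2 x) * g x)
        = N2 * integral {a..c} (\<lambda>x. \<beta>1 x * g x) - N1 * integral {a..c} (\<lambda>x. \<beta>2 x * g x)" if g: "continuous_on {a..c} g" for g
    proof -
      have i: "(\<lambda>x. \<beta>1 x * g x) integrable_on {a..c}" "(\<lambda>x. \<beta>2 x * g x) integrable_on {a..c}"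
        by (intro integrable_continuous_real continuous_on_mult cb g)+
      have "integral {a..c} (\<lambda>x. (N2 * \<beta>1 x + - N1 * \<beta>2 x) * g x)
          = integral {a..c} (\<lambda>x. N2 * (\<beta>1 x * g x) - N1 * (\<beta>2 x * g x))"
        by (rule integral_cong) (simp add: algebra_simps)
      also have "\<dots> = integral {a..c} (\<lambda>x. N2 * (\<beta>1 x * g x)) - integral {a..c} (\<lambda>x. N1 * (\<beta>2 x * g x))"
        by (rule integral_diff; rule integrable_on_mult_right; rule i)
      finally show ?thesis by simp
    qed
    \<comment> \<open>Two bumps near \<open>x1\<close> and \<open>x2\<close>, weighted so that their
      moments against \<open>\<rho>\<close> cancel, form a legitimate test function. It shows that
      the two averages of \<open>\<psi>\<close> agree, so \<open>\<psi> x1\<close> and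
      \<open>\<psi> x2\<close> differ by at most \<open>2 * \<epsilon>\<close>, against the choice
      of \<open>\<epsilon>\<close>.\<close>
    have "integral {a..c} (\<lambda>x. (N2 * \<beta>1 x + - N1 * \<beta>2 x) * (RL_right b \<alpha> Py x + Pv x)) = 0"
    proof (rule Euler_Lagrange_tested[OF Ly _ c(1,2)])
      show "C1_from a (\<lambda>x. N2 * \<beta>1 x + - N1 * \<beta>2 x)"
        by (rule C1_from_add(1)[OF C1_from_cmult(1)[OF b1(1)] C1_from_cmult(1)[OF b2(1)]])
      show "N2 * \<beta>1 x + - N1 * \<beta>2 x = 0" if "c \<le> x" for x using b1(2) b2(2) that by simp
      show "integral {a..c} (\<lambda>u. (N2 * \<beta>1 u + - N1 * \<beta>2 u) * (b - u) powr (\<alpha> - 1)) = 0"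
        using lin[OF cont(1)] unfolding \<rho>_def[symmetric] N1_def[symmetric] N2_def[symmetric] by simp
    qed
    then have "N2 * I1 - N1 * I2 = 0"
      using lin[OF cont(3)] unfolding \<phi>_def[symmetric] I1_def[symmetric] I2_def[symmetric] by simp
    then have "N1 * N2 * (\<psi> x1 - \<psi> x2) = N1 * (I2 - \<psi> x2 * N2) - N2 * (I1 - \<psi> x1 * N1)"
      by (simp add: algebra_simps)
    then have "N1 * N2 * \<bar>\<psi> x1 - \<psi> x2\<bar> \<le> N1 * \<bar>I2 - \<psi> x2 * N2\<bar> + N2 * \<bar>I1 - \<psi> x1 * N1\<bar>"
      using N(1,2) abs_triangle_ineq4[of "N1 * (I2 - \<psi> x2 * N2)" "N2 * (I1 - \<psi> x1 * N1)"]
        abs_mult[of "N1 * N2" "\<psi> x1 - \<psi> x2"] by (simp add: abs_mult)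
    also have "\<dots> \<le> N1 * (\<epsilon> * N2) + N2 * (\<epsilon> * N1)"
      using N by (intro add_mono mult_left_mono) auto
    also have "\<dots> = N1 * N2 * (2 * \<epsilon>)" by (simp add: algebra_simps)
    finally have "\<bar>\<psi> x1 - \<psi> x2\<bar> \<le> 2 * \<epsilon>" using N(1,2) by (simp add: mult_le_cancel_left)
    then show False using ne by (simp add: \<epsilon>_def)
  qed
  define m where "m = (a + b) / 2"
  have m: "a < m" "m < b" using ab by (auto simp: m_def)
  have psiK: "\<psi> x = \<psi> m" if x: "x \<in> {a..<b}" for x
  proof (cases "x = a")
    case True
    \<comment> \<open>The point \<open>a\<close> is not covered by the localisation in the open
      interval and follows by continuity.\<close>
    have cl: "closure {a<..<m} = {a..m}" using m by simp
    have "\<psi> a = \<psi> m"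
    proof (rule continuous_constant_on_closure[of "{a<..<m}" \<psi> "\<psi> m" a])
      show "continuous_on (closure {a<..<m}) \<psi>"
        unfolding cl by (rule continuous_on_subset[OF cpsi]) (use m in auto)
      show "\<psi> x = \<psi> m" if "x \<in> {a<..<m}" for x using const[of x m] that m by auto
      show "a \<in> closure {a<..<m}" unfolding cl using m by simp
    qed
    then show ?thesis using True by simp
  next
    case False
    then show ?thesis using const[of x m] x m by auto
  qed
  show ?thesis
  proof (intro exI[of _ "\<psi> m"] ballI)
    fix x assume x: "x \<in> {a..<b}"
    then have "(b - x) powr (1 - \<alpha>) \<noteq> 0" by simp
    then show "RL_right b \<alpha> Py x + Pv x = \<psi> m / (b - x) powr (1 - \<alpha>)"
      using psiK[OF x] by (simp add: \<psi>_def \<phi>_def[symmetric] eq_divide_eq)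
  qed
qed

end

theorem theorem4p1:
  fixes a b \<alpha> ya yb :: real
    and L :: "real \<times> real \<times> real \<Rightarrow> real"
    and y :: "real \<Rightarrow> real"
  assumes "a < b" and "0 < \<alpha>" and "\<alpha> < 1"
    and L_C1: "C1_on ({a..<b} \<times> UNIV) L"
    and J_defined: "\<And>z. z \<in> admissible a b ya yb \<Longrightarrow> set_integrable lebesgue {a..b} (along a \<alpha> L z)"
    and extremizer: "is_extremizer (J_functional a b \<alpha> L) (admissible a b ya yb) y"
    and Ly_L1: "set_integrable lebesgue {a..b} (along a \<alpha> (partial_y L) y)"
  shows "\<exists>K. \<forall>x\<in>{a..<b}.
           RL_right b \<alpha> (along a \<alpha> (partial_y L) y) x + along a \<alpha> (partial_v L) y x
             = K / (b - x) powr (1 - \<alpha>)"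
proof -
  let ?A = "admissible a b ya yb"
  have y: "y \<in> ?A" and ext: "(\<forall>z\<in>?A. J_functional a b \<alpha> L y \<le> J_functional a b \<alpha> L z) \<or>
      (\<forall>z\<in>?A. J_functional a b \<alpha> L z \<le> J_functional a b \<alpha> L y)"
    using extremizer by (auto simp: is_extremizer_def)
  from ext show ?thesis
  proof
    assume "\<forall>z\<in>?A. J_functional a b \<alpha> L y \<le> J_functional a b \<alpha> L z"
    then interpret fractional_minimizer a b \<alpha> ya yb L y
      using assms y by unfold_locales auto
    show ?thesis by (rule Euler_Lagrange[OF Ly_L1])
  next
    assume max: "\<forall>z\<in>?A. J_functional a b \<alpha> L z \<le> J_functional a b \<alpha> L y"
    \<comment> \<open>A maximizer for \<open>L\<close> is a minimizer for \<open>-L\<close>, and the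
      resulting equation changes sign as a whole.\<close>
    let ?L = "\<lambda>p. - L p"
    have al: "along a \<alpha> ?L z = (\<lambda>x. - along a \<alpha> L z x)" for z by (simp add: along_def fun_eq_iff)
    have J: "J_functional a b \<alpha> ?L z = - J_functional a b \<alpha> L z" for z
      by (simp add: J_functional_def al set_lebesgue_integral_def)
    have C1: "C1_on ({a..<b} \<times> UNIV) ?L"
    proof -
      obtain L' where L': "\<forall>p\<in>{a..<b} \<times> UNIV. (L has_derivative blinfun_apply (L' p)) (at p within {a..<b} \<times> UNIV)"
        "continuous_on ({a..<b} \<times> UNIV) L'" using L_C1 unfolding C1_on_def by blast
      have "blinfun_apply (- L' p) = (\<lambda>h. - blinfun_apply (L' p) h)" for p
        by (simp add: fun_eq_iff blinfun.minus_left)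
      then have d: "(?L has_derivative blinfun_apply (- L' p)) (at p within {a..<b} \<times> UNIV)"
        if "p \<in> {a..<b} \<times> UNIV" for p
        using has_derivative_minus[OF bspec[OF L'(1) that]] by simp
      show ?thesis unfolding C1_on_def
        by (intro exI[of _ "\<lambda>p. - L' p"] conjI ballI d continuous_on_minus[OF L'(2)])
    qed
    interpret fractional_minimizer a b \<alpha> ya yb ?L y
    proof
      show "set_integrable lebesgue {a..b} (along a \<alpha> ?L z)" if "z \<in> ?A" for z
        using J_defined[OF that] unfolding al by (simp add: set_integrable_def)
    qed (use assms(1-3) C1 y max J in auto)
    \<comment> \<open>Nothing is known about \<open>L\<close> at \<open>x = b\<close>, so the sign
      rule is confined to \<open>x < b\<close>; the missing point is negligible in the
      integrals.\<close>
    have py: "along a \<alpha> (partial_y ?L) y x = - along a \<alpha> (partial_y L) y x" if "x \<in> {a..<b}" for x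
      using DERIV_imp_deriv[OF DERIV_minus[OF C1_on_partial_derivatives(1)[OF L_C1 that]]]
      by (simp add: along_def partial_y_def)
    have pv: "along a \<alpha> (partial_v ?L) y x = - along a \<alpha> (partial_v L) y x" if "x \<in> {a..<b}" for x
      using DERIV_imp_deriv[OF DERIV_minus[OF C1_on_partial_derivatives(2)[OF L_C1 that]]]
      by (simp add: along_def partial_v_def)
    have "(\<lambda>x. - along a \<alpha> (partial_y L) y x) absolutely_integrable_on {a..b}"
      using Ly_L1 by (simp add: set_integrable_def)
    then have "along a \<alpha> (partial_y ?L) y absolutely_integrable_on {a..b}"
      by (rule absolutely_integrable_spike[of _ _ "{b}"]) (use py in auto)
    from Euler_Lagrange[OF this] obtain K where
      K: "\<forall>x\<in>{a..<b}. RL_right b \<alpha> (along a \<alpha> (partial_y ?L) y) x + along a \<alpha> (partial_v ?L) y x = K / (b - x) powr (1 - \<alpha>)" by blast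
    show ?thesis
    proof (intro exI[of _ "- K"] ballI)
      fix x assume x: "x \<in> {a..<b}"
      have "RL_right b \<alpha> (along a \<alpha> (partial_y ?L) y) x = RL_right b \<alpha> (\<lambda>u. - along a \<alpha> (partial_y L) y u) x"
        by (rule RL_right_cong) (use py x in auto)
      also have "\<dots> = - RL_right b \<alpha> (along a \<alpha> (partial_y L) y) x" by (rule RL_right_uminus)
      finally show "RL_right b \<alpha> (along a \<alpha> (partial_y L) y) x + along a \<alpha> (partial_v L) y x = - K / (b - x) powr (1 - \<alpha>)"
        using bspec[OF K x] pv[OF x] by simp
    qed
  qed
qed

end
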